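(* For any irreducible matrix $A\in\mathbb{R}_+^{n\times n}$ with $\lambda(A)=1$, each of the following problems can be solved in $O(n^3\log n)$ time: (P1) for a given $x\in\mathbb{R}_+^n$ and integer $t\ge1$, decide whether $x\in\operatorname{Attr}(A,t)$; (P2) for a given $k$ with $0\le k<\gamma$, compute the periodic power $A^r$ where $r\equiv k\pmod\gamma$ (that is, $A^r$ for $r\ge T(A)$, $r\equiv k\pmod\gamma$); (P3) for a given $x\in\mathbb{R}_+^n$, compute the ultimate period of $\{A^r\otimes x,\ r\ge0\}$, meaning the least integer $\alpha\ge 1$ such that $A^{r+\alpha}\otimes x=A^r\otimes x$ for all $r\ge T(A)$.
   Context: Max algebra: on $\mathbb{R}_+=[0,\infty)$ put $a\oplus b=\max(a,b)$, $a\otimes b=ab$, extended to matrices and vectors by $(A\oplus B)_{ij}=\max(a_{ij},b_{ij})$, $(A\otimes B)_{ij}=\max_k a_{ik}b_{kj}$; $A^k$ is the $k$-th max-algebraic power, $A^0=I$. The digraph $\mathcal{D}(A)$ has nodes $1,\dots,n$ and an edge $(i,j)$ of weight $a_{ij}$ iff $a_{ij}\neq 0$; the weight of a path is the product of its edge weights, and the geometric mean of a cycle with $k$ edges is its weight to the power $1/k$. $\lambda(A)$ is the maximum cycle geometric mean. $A$ is definite if $\lambda(A)=1$, and irreducible if for all nodes $i,j$ there is a path in $\mathcal{D}(A)$ from $i$ to $j$. A cycle is critical if its geometric mean equals $\lambda(A)$; the critical graph $\mathcal{C}(A)$ consists of all nodes (the set $N_c(A)$) and edges belonging to critical cycles.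 The cyclicity of a strongly connected digraph is the gcd of the lengths of its cycles; the cyclicity $\gamma$ of $\mathcal{C}(A)$ is the lcm of the cyclicities of its strongly connected components. For a definite $B$, $B^*=I\oplus B\oplus\dots\oplus B^{n-1}$ and $Q(B)$ has entries $q_{ij}=\bigoplus_{k\in N_c(B)}b^*_{ik}b^*_{kj}$. The transient $T(A)$ of an irreducible definite $A$ is an integer such that $A^{t\gamma}=Q(A^\gamma)$ whenever $t\gamma\ge T(A)$, and $A^{r+\gamma}=A^r$ for all $r\ge T(A)$ (such an integer exists). Powers $A^r$ with $r\ge T(A)$ are called periodic powers. The $t$-attraction cone $\operatorname{Attr}(A,t)$ is the set of all $x\in\mathbb{R}_+^n$ for which there exists an integer $r$ with $A^r\otimes x=A^{r+t}\otimes x$. Time is counted in elementary operations (arithmetic operations and comparisons). *)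

theory Defs
  imports
    Complex_Main
    "HOL-Library.Landau_Symbols"
    "HOL-Number_Theory.Cong"
    "Jordan_Normal_Form.Matrix"
    "Graph_Theory.Digraph_Component"
begin

section \<open>Max algebra\<close>

text \<open>
  Max-algebraic matrices and vectors are real matrices and vectors with nonnegative entries;
  the nodes \<open>1,\<dots>,n\<close> become the indices \<open>0,\<dots>,n-1\<close>. The empty max-algebraic sum is \<open>0\<close>, the
  neutral element of \<open>max\<close> on the nonnegative reals.
\<close>

definition nonneg_mats :: "nat \<Rightarrow> real mat set" where
  "nonneg_mats n = {A \<in> carrier_mat n n. \<forall>i<n. \<forall>j<n. 0 \<le> A $$ (i, j)}"

definition nonneg_vecs :: "nat \<Rightarrow> real vec set" where
  "nonneg_vecs n = {x \<in> carrier_vec n. \<forall>i<n. 0 \<le> x $ i}"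

definition osum :: "('k \<Rightarrow> real) \<Rightarrow> 'k set \<Rightarrow> real" where
  "osum f S = Max (insert 0 (f ` S))"

definition max_mult_mat :: "real mat \<Rightarrow> real mat \<Rightarrow> real mat"  (infixl "\<otimes>\<^sub>m" 70) where
  "A \<otimes>\<^sub>m B = mat (dim_row A) (dim_col B)
     (\<lambda>(i, j). osum (\<lambda>k. A $$ (i, k) * B $$ (k, j)) {..<dim_col A})"

definition max_mult_vec :: "real mat \<Rightarrow> real vec \<Rightarrow> real vec"  (infixl "\<otimes>\<^sub>v" 70) where
  "A \<otimes>\<^sub>v x = vec (dim_row A) (\<lambda>i. osum (\<lambda>k. A $$ (i, k) * x $ k) {..<dim_col A})"

primrec max_pow :: "real mat \<Rightarrow> nat \<Rightarrow> real mat" where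
  "max_pow A 0 = 1\<^sub>m (dim_row A)"
| "max_pow A (Suc k) = max_pow A k \<otimes>\<^sub>m A"

definition max_star :: "real mat \<Rightarrow> real mat" where
  "max_star B = mat (dim_row B) (dim_row B)
     (\<lambda>(i, j). osum (\<lambda>m. max_pow B m $$ (i, j)) {..<dim_row B})"


section \<open>The weighted digraph and the critical graph\<close>

definition mat_digraph :: "real mat \<Rightarrow> (nat, nat \<times> nat) pre_digraph" where
  "mat_digraph A =
     \<lparr>verts = {..<dim_row A},
      arcs = {(i, j). i < dim_row A \<and> j < dim_row A \<and> A $$ (i, j) \<noteq> 0},
      tail = fst, head = snd\<rparr>"

definition irreducible_mat :: "real mat \<Rightarrow> bool" where
  "irreducible_mat A \<longleftrightarrow> strongly_connected (mat_digraph A)"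

definition walk_weight :: "real mat \<Rightarrow> (nat \<times> nat) list \<Rightarrow> real" where
  "walk_weight A p = prod_list (map (\<lambda>e. A $$ e) p)"

definition geometric_mean :: "real mat \<Rightarrow> (nat \<times> nat) list \<Rightarrow> real" where
  "geometric_mean A p = root (length p) (walk_weight A p)"

text \<open>
  Cycles are elementary (loops included), so there are finitely many of them. Without any cycle
  the maximum cycle geometric mean is \<open>0\<close>.
\<close>

definition max_cycle_mean :: "real mat \<Rightarrow> real" where
  "max_cycle_mean A = osum (geometric_mean A) {p. pre_digraph.cycle (mat_digraph A) p}"

definition definite_mat :: "real mat \<Rightarrow> bool" where
  "definite_mat A \<longleftrightarrow> max_cycle_mean A = 1"

definition critical_cycle :: "real mat \<Rightarrow> (nat \<times> nat) list \<Rightarrow> bool" where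
  "critical_cycle A p \<longleftrightarrow>
     pre_digraph.cycle (mat_digraph A) p \<and> geometric_mean A p = max_cycle_mean A"

definition critical_nodes :: "real mat \<Rightarrow> nat set" where
  "critical_nodes A = {v. \<exists>p e. critical_cycle A p \<and> e \<in> set p \<and> (v = fst e \<or> v = snd e)}"

definition critical_graph :: "real mat \<Rightarrow> (nat, nat \<times> nat) pre_digraph" where
  "critical_graph A =
     \<lparr>verts = critical_nodes A, arcs = \<Union> {set p | p. critical_cycle A p},
      tail = fst, head = snd\<rparr>"

definition sc_cyclicity :: "('a, 'b) pre_digraph \<Rightarrow> nat" where
  "sc_cyclicity G = Gcd {length p | p. pre_digraph.cycle G p}"

definition crit_cyclicity :: "real mat \<Rightarrow> nat" where
  "crit_cyclicity A = Lcm (sc_cyclicity ` pre_digraph.sccs (critical_graph A))"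


section \<open>Periodic powers, attraction cones, ultimate periods\<close>

definition Q_mat :: "real mat \<Rightarrow> real mat" where
  "Q_mat B = mat (dim_row B) (dim_row B)
     (\<lambda>(i, j). osum (\<lambda>k. max_star B $$ (i, k) * max_star B $$ (k, j)) (critical_nodes B))"

text \<open>
  The defining property of the transient does not determine it uniquely; results that refer to
  it are stated for every integer with this property.
\<close>

definition is_transient :: "real mat \<Rightarrow> nat \<Rightarrow> bool" where
  "is_transient A T \<longleftrightarrow>
     (\<forall>t. T \<le> t * crit_cyclicity A \<longrightarrow>
        max_pow A (t * crit_cyclicity A) = Q_mat (max_pow A (crit_cyclicity A))) \<and>
     (\<forall>r\<ge>T. max_pow A (r + crit_cyclicity A) = max_pow A r)"

definition attraction_cone :: "real mat \<Rightarrow> nat \<Rightarrow> real vec set" where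
  "attraction_cone A t =
     {x \<in> nonneg_vecs (dim_row A). \<exists>r. max_pow A r \<otimes>\<^sub>v x = max_pow A (r + t) \<otimes>\<^sub>v x}"

definition ultimate_period :: "real mat \<Rightarrow> real vec \<Rightarrow> nat \<Rightarrow> nat" where
  "ultimate_period A x T =
     (LEAST \<alpha>. 1 \<le> \<alpha> \<and> (\<forall>r\<ge>T. max_pow A (r + \<alpha>) \<otimes>\<^sub>v x = max_pow A r \<otimes>\<^sub>v x))"


section \<open>Algorithms and elementary operations\<close>

text \<open>
  A uniform machine model: one finite program serves all dimensions. The memory consists of
  integer cells and real cells, each addressed by an array name and two integer indices that
  are computed at run time. Elementary operations are the arithmetic operations and comparisons
  on integers (including division with remainder, as times and powers are given as arbitrarily
  large integers) and on reals. Real numbers can only be combined with each other by arithmetic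
  operations and compared; they cannot be rounded or turned into integers, and the only real
  constants in a program are integers.
\<close>

record state =
  icell :: "string \<Rightarrow> int \<Rightarrow> int \<Rightarrow> int"
  rcell :: "string \<Rightarrow> int \<Rightarrow> int \<Rightarrow> real"

datatype iexp =
    IConst int
  | ICell string iexp iexp
  | IAdd iexp iexp | ISub iexp iexp | IMul iexp iexp | IDiv iexp iexp | IMod iexp iexp

datatype rexp =
    RConst int
  | RCell string iexp iexp
  | RAdd rexp rexp | RSub rexp rexp | RMul rexp rexp | RDiv rexp rexp

datatype bexp =
    ILess iexp iexp | IEq iexp iexp
  | RLess rexp rexp | REq rexp rexp
  | BNot bexp | BAnd bexp bexp

datatype com =
    Skip
  | IAssign string iexp iexp iexp
  | RAssign string iexp iexp rexp
  | Seq com com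
  | If bexp com com
  | While bexp com

primrec ival :: "iexp \<Rightarrow> state \<Rightarrow> int" where
  "ival (IConst c) s = c"
| "ival (ICell a i j) s = icell s a (ival i s) (ival j s)"
| "ival (IAdd e f) s = ival e s + ival f s"
| "ival (ISub e f) s = ival e s - ival f s"
| "ival (IMul e f) s = ival e s * ival f s"
| "ival (IDiv e f) s = ival e s div ival f s"
| "ival (IMod e f) s = ival e s mod ival f s"

primrec rval :: "rexp \<Rightarrow> state \<Rightarrow> real" where
  "rval (RConst c) s = of_int c"
| "rval (RCell a i j) s = rcell s a (ival i s) (ival j s)"
| "rval (RAdd e f) s = rval e s + rval f s"
| "rval (RSub e f) s = rval e s - rval f s"
| "rval (RMul e f) s = rval e s * rval f s"
| "rval (RDiv e f) s = rval e s / rval f s"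

primrec bval :: "bexp \<Rightarrow> state \<Rightarrow> bool" where
  "bval (ILess e f) s \<longleftrightarrow> ival e s < ival f s"
| "bval (IEq e f) s \<longleftrightarrow> ival e s = ival f s"
| "bval (RLess e f) s \<longleftrightarrow> rval e s < rval f s"
| "bval (REq e f) s \<longleftrightarrow> rval e s = rval f s"
| "bval (BNot b) s \<longleftrightarrow> \<not> bval b s"
| "bval (BAnd b c) s \<longleftrightarrow> bval b s \<and> bval c s"

text \<open>
  Besides arithmetic operations and comparisons, each constant, memory access and logical
  connective is also charged one unit of time.
\<close>

primrec icost :: "iexp \<Rightarrow> nat" where
  "icost (IConst c) = 1"
| "icost (ICell a i j) = 1 + icost i + icost j"
| "icost (IAdd e f) = 1 + icost e + icost f"
| "icost (ISub e f) = 1 + icost e + icost f"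
| "icost (IMul e f) = 1 + icost e + icost f"
| "icost (IDiv e f) = 1 + icost e + icost f"
| "icost (IMod e f) = 1 + icost e + icost f"

primrec rcost :: "rexp \<Rightarrow> nat" where
  "rcost (RConst c) = 1"
| "rcost (RCell a i j) = 1 + icost i + icost j"
| "rcost (RAdd e f) = 1 + rcost e + rcost f"
| "rcost (RSub e f) = 1 + rcost e + rcost f"
| "rcost (RMul e f) = 1 + rcost e + rcost f"
| "rcost (RDiv e f) = 1 + rcost e + rcost f"

primrec bcost :: "bexp \<Rightarrow> nat" where
  "bcost (ILess e f) = 1 + icost e + icost f"
| "bcost (IEq e f) = 1 + icost e + icost f"
| "bcost (RLess e f) = 1 + rcost e + rcost f"
| "bcost (REq e f) = 1 + rcost e + rcost f"
| "bcost (BNot b) = 1 + bcost b"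
| "bcost (BAnd b c) = 1 + bcost b + bcost c"

definition upd :: "(string \<Rightarrow> int \<Rightarrow> int \<Rightarrow> 'v) \<Rightarrow> string \<Rightarrow> int \<Rightarrow> int \<Rightarrow> 'v
    \<Rightarrow> (string \<Rightarrow> int \<Rightarrow> int \<Rightarrow> 'v)" where
  "upd m a i j v = m(a := (m a)(i := (m a i)(j := v)))"

text \<open>\<open>exec c s t s'\<close>: started in \<open>s\<close>, the program \<open>c\<close> halts in \<open>s'\<close> after time \<open>t\<close>.\<close>

inductive exec :: "com \<Rightarrow> state \<Rightarrow> nat \<Rightarrow> state \<Rightarrow> bool" where
  Skip: "exec Skip s 1 s"
| IAssign: "exec (IAssign a i j e) s (1 + icost i + icost j + icost e)
     (s\<lparr>icell := upd (icell s) a (ival i s) (ival j s) (ival e s)\<rparr>)"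
| RAssign: "exec (RAssign a i j e) s (1 + icost i + icost j + rcost e)
     (s\<lparr>rcell := upd (rcell s) a (ival i s) (ival j s) (rval e s)\<rparr>)"
| Seq: "exec c s t s' \<Longrightarrow> exec d s' t' s'' \<Longrightarrow> exec (Seq c d) s (t + t') s''"
| IfTrue: "bval b s \<Longrightarrow> exec c s t s' \<Longrightarrow> exec (If b c d) s (1 + bcost b + t) s'"
| IfFalse: "\<not> bval b s \<Longrightarrow> exec d s t s' \<Longrightarrow> exec (If b c d) s (1 + bcost b + t) s'"
| WhileFalse: "\<not> bval b s \<Longrightarrow> exec (While b c) s (1 + bcost b) s"
| WhileTrue: "bval b s \<Longrightarrow> exec c s t s' \<Longrightarrow> exec (While b c) s' t' s''
     \<Longrightarrow> exec (While b c) s (1 + bcost b + t + t') s''"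

lemma exec_deterministic:
  "exec c s t s' \<Longrightarrow> exec c s u s'' \<Longrightarrow> t = u \<and> s' = s''"
proof (induction arbitrary: u s'' rule: exec.induct)
  case (WhileFalse b s c)
  from WhileFalse.prems WhileFalse.hyps show ?case by (cases rule: exec.cases) auto
next
  case (WhileTrue b s c t s' t' s3)
  from WhileTrue.prems WhileTrue.hyps(1) obtain t1 s1 t2
    where "exec c s t1 s1" "exec (While b c) s1 t2 s''" "u = 1 + bcost b + t1 + t2"
    by (cases rule: exec.cases) auto
  with WhileTrue.IH show ?case by blast
next
  case (Seq c s t s' d t' s3)
  from Seq.prems obtain t1 s1 t2
    where "exec c s t1 s1" "exec d s1 t2 s''" "u = t1 + t2"
    by (cases rule: exec.cases) auto
  with Seq.IH show ?case by blast
next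
  case (IfTrue b s c t s' d)
  from IfTrue.prems IfTrue.hyps(1) obtain t1
    where "exec c s t1 s''" "u = 1 + bcost b + t1"
    by (cases rule: exec.cases) auto
  with IfTrue.IH show ?case by blast
next
  case (IfFalse b s d t s' c)
  from IfFalse.prems IfFalse.hyps(1) obtain t1
    where "exec d s t1 s''" "u = 1 + bcost b + t1"
    by (cases rule: exec.cases) auto
  with IfFalse.IH show ?case by blast
qed (erule exec.cases; simp)+

text \<open>
  A computational problem is given by a set of instances, the size of an instance, and the
  conditions that the initial memory holds the instance and that the final memory holds a
  correct answer. Nothing is assumed about the initial contents of the other memory cells.
\<close>

definition solvable_in_time ::
  "'i set \<Rightarrow> ('i \<Rightarrow> nat) \<Rightarrow> ('i \<Rightarrow> state \<Rightarrow> bool) \<Rightarrow> ('i \<Rightarrow> state \<Rightarrow> bool)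
    \<Rightarrow> (nat \<Rightarrow> real) set \<Rightarrow> bool" where
  "solvable_in_time insts sz input output F \<longleftrightarrow>
     (\<exists>c. \<exists>f\<in>F. \<forall>p\<in>insts. \<forall>s. input p s \<longrightarrow>
        (\<exists>t s'. exec c s t s' \<and> real t \<le> f (sz p) \<and> output p s'))"

definition holds_int :: "state \<Rightarrow> string \<Rightarrow> int \<Rightarrow> bool" where
  "holds_int s a v \<longleftrightarrow> icell s a 0 0 = v"

definition holds_vec :: "state \<Rightarrow> string \<Rightarrow> real vec \<Rightarrow> bool" where
  "holds_vec s a x \<longleftrightarrow> (\<forall>i<dim_vec x. rcell s a (int i) 0 = x $ i)"

definition holds_mat :: "state \<Rightarrow> string \<Rightarrow> real mat \<Rightarrow> bool" where
  "holds_mat s a A \<longleftrightarrow>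
     (\<forall>i<dim_row A. \<forall>j<dim_col A. rcell s a (int i) (int j) = A $$ (i, j))"

definition irreducible_definite :: "real mat set" where
  "irreducible_definite =
     {A. A \<in> nonneg_mats (dim_row A) \<and> irreducible_mat A \<and> definite_mat A}"

end

theory Submission
  imports Defs "HOL-Real_Asymp.Real_Asymp"
begin

text \<open>
  Call a node critical if it lies on a closed walk of weight \<open>1\<close>; it then lies on one of length
  at most \<open>n\<close>. If \<open>l \<le> n\<close> is the length of a closed walk of weight \<open>1\<close> through \<open>i\<close>, then row \<open>i\<close> of
  \<open>A\<^sup>r\<close> has period \<open>l\<close> for \<open>r \<ge> n\<^sup>2\<close>: a longer walk visits some node twice at times congruent
  modulo \<open>l\<close>, so a closed walk whose length is a multiple of \<open>l\<close> can be cut out and replaced by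
  rounds of the critical one. Hence repeated squaring reaches the periodic regime of all critical
  rows after \<open>O(log n)\<close> squarings. For an edge \<open>i \<rightarrow> \<sigma> i\<close> of a critical closed walk, row \<open>i\<close> of
  \<open>A\<^bsup>r+1\<^esup>\<close> is a multiple of row \<open>\<sigma> i\<close> of \<open>A\<^sup>r\<close>, so following \<open>\<sigma>\<close> gives every later critical row
  from the power already computed. The remaining rows follow from
  \<open>A\<^sup>r = max\<^sub>c A\<^sup>R\<^sub>i\<^sub>c A\<^bsup>r-R\<^esup>\<^sub>c\<^sub>j\<close> over critical \<open>c\<close>, valid for all large \<open>r\<close> because the weights of
  walks avoiding critical nodes tend to \<open>0\<close>. The cyclicity \<open>\<gamma>\<close> itself is never computed: lengths of
  \<open>\<sigma>\<close>-cycles, which are at most \<open>n\<close>, serve as row periods instead.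
\<close>

section \<open>Max-algebraic powers and optimal walks\<close>

text \<open>The obstacle is size. The transient of the whole matrix depends on how close the
  noncritical cycle means come to 1, so no function of \<open>n\<close> bounds it, and \<gamma>, a
  least common multiple, can outgrow every polynomial in \<open>n\<close>. Statements about
  \<open>A\<close> as a whole are therefore "eventually" statements; they are carried to every
  \<open>r \<ge> T\<close> by adding multiples of \<gamma>, which requires \<gamma> to be positive.
  The threshold \<open>n * n\<close> comes from a pigeonhole over the \<open>n + 1\<close> times
  \<open>0, l, ..., n * l\<close> with \<open>l \<le> n\<close>. P1 and P3 share one computation:
  there is a number \<open>D\<close>, the lcm of at most \<open>n\<close> component periods, such
  that \<alpha> is an eventual period of the orbit of \<open>x\<close> iff \<open>D\<close> divides
  \<alpha>. So \<open>D\<close> is the ultimate period, and \<open>x\<close> lies in the cone for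
  \<open>t\<close> iff \<open>D\<close> divides \<open>t\<close>. Costs: about
  \<open>2 * log 2 n\<close> rounds with two cubic products each give the bound. All else is cubic
  in total, since each critical node needs at most \<open>n\<close> candidate periods, tested at
  \<open>n\<close> positions each. The integers involved may be huge, but each operation on them
  costs one unit.\<close>

lemma osum_ge: "finite S \<Longrightarrow> k \<in> S \<Longrightarrow> f k \<le> osum f S"
  unfolding osum_def by (rule Max_ge) auto

lemma osum_nonneg [simp]: "finite S \<Longrightarrow> 0 \<le> osum f S"
  unfolding osum_def by (rule Max_ge) auto

lemma osum_le: "finite S \<Longrightarrow> 0 \<le> c \<Longrightarrow> (\<And>k. k \<in> S \<Longrightarrow> f k \<le> c) \<Longrightarrow> osum f S \<le> c"
  unfolding osum_def by (subst Max_le_iff) auto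

lemma osum_attained:
  assumes "finite S" "0 < osum f S"
  obtains k where "k \<in> S" "osum f S = f k"
proof -
  have "osum f S \<in> insert 0 (f ` S)"
    unfolding osum_def using assms(1) by (intro Max_in) auto
  with assms(2) that show thesis by auto
qed

lemma osum_cong: "S = S' \<Longrightarrow> (\<And>k. k \<in> S' \<Longrightarrow> f k = g k) \<Longrightarrow> osum f S = osum g S'"
  unfolding osum_def by (auto intro!: arg_cong[of _ _ Max] image_cong)

lemma osum_empty [simp]: "osum f {} = 0"
  by (simp add: osum_def)

lemma osum_lessThan_Suc: "osum f {..<Suc m} = max (osum f {..<m}) (f m)"
  by (simp add: osum_def lessThan_Suc insert_commute[of 0] max.commute)

text \<open>Weights are plain index functions, not matrices, so that the same locale can be
  instantiated for derived weights on the same index set (\<open>noncrit\<close>,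
  \<open>unit_diag\<close>). The link back to \<open>max_pow\<close> is
  \<open>max_pow_eq_mpow\<close>.\<close>

locale nonneg_matrix =
  fixes n :: nat and a :: "nat \<Rightarrow> nat \<Rightarrow> real"
  assumes nonneg: "i < n \<Longrightarrow> j < n \<Longrightarrow> 0 \<le> a i j"
begin

primrec mpow :: "nat \<Rightarrow> nat \<Rightarrow> nat \<Rightarrow> real" where
  "mpow 0 i j = (if i = j then 1 else 0)"
| "mpow (Suc r) i j = osum (\<lambda>k. mpow r i k * a k j) {..<n}"

lemma mpow_nonneg [simp]: "0 \<le> mpow r i j"
  by (cases r) auto

lemma mpow_1: "i < n \<Longrightarrow> j < n \<Longrightarrow> mpow 1 i j = a i j"
proof -
  assume i: "i < n" and j: "j < n"
  have "osum (\<lambda>k. mpow 0 i k * a k j) {..<n} \<le> a i j"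
    by (rule osum_le) (use i j nonneg in auto)
  moreover have "mpow 0 i i * a i j \<le> osum (\<lambda>k. mpow 0 i k * a k j) {..<n}"
    by (rule osum_ge[where f = "\<lambda>k. mpow 0 i k * a k j"]) (use i in auto)
  ultimately show ?thesis by simp
qed

text \<open>The optimal walks behind the two factors concatenate. The induction removes the last
  edge of the second walk; an entry 0 has no such edge and is trivial.\<close>

lemma mpow_mult_le:
  assumes "k < n"
  shows "j < n \<Longrightarrow> mpow r i k * mpow s k j \<le> mpow (r + s) i j"
proof (induction s arbitrary: j)
  case (Suc s)
  show ?case
  proof (cases "0 < mpow (Suc s) k j")
    case True
    then obtain m where m: "m < n" "mpow (Suc s) k j = mpow s k m * a m j"
      by (auto elim: osum_attained[rotated])
    have "mpow r i k * mpow (Suc s) k j = (mpow r i k * mpow s k m) * a m j"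
      using m by simp
    also have "\<dots> \<le> mpow (r + s) i m * a m j"
      using Suc m nonneg by (intro mult_right_mono) auto
    also have "\<dots> \<le> mpow (r + Suc s) i j"
      using m by (simp, intro osum_ge[where f = "\<lambda>k. mpow (r + s) i k * a k j"]) auto
    finally show ?thesis .
  next
    case False
    then have "mpow (Suc s) k j = 0" using mpow_nonneg[of "Suc s" k j] by linarith
    then show ?thesis by (simp del: mpow.simps)
  qed
qed auto

text \<open>A walk is a total function of time, viewed through a window of times, so that cutting it
  at chosen times needs no list surgery.\<close>

definition walk_prod :: "(nat \<Rightarrow> nat) \<Rightarrow> nat \<Rightarrow> nat \<Rightarrow> real" where
  "walk_prod v p q = (\<Prod>k\<in>{p..<q}. a (v k) (v (Suc k)))"

lemma walk_prod_split: "p \<le> q \<Longrightarrow> q \<le> r \<Longrightarrow> walk_prod v p r = walk_prod v p q * walk_prod v q r"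
  by (simp add: walk_prod_def prod.atLeastLessThan_concat)

lemma walk_prod_nonneg: "(\<And>k. k \<le> q \<Longrightarrow> v k < n) \<Longrightarrow> 0 \<le> walk_prod v p q"
  unfolding walk_prod_def by (intro prod_nonneg ballI nonneg) auto

lemma walk_prod_le:
  "p \<le> q \<Longrightarrow> (\<And>k. k \<le> q \<Longrightarrow> v k < n) \<Longrightarrow> walk_prod v p q \<le> mpow (q - p) (v p) (v q)"
proof (induction q)
  case (Suc q)
  show ?case
  proof (cases "p = Suc q")
    case False
    with Suc.prems have pq: "p \<le> q" by simp
    have "walk_prod v p (Suc q) = walk_prod v p q * a (v q) (v (Suc q))"
      using pq by (simp add: walk_prod_def)
    also have "\<dots> \<le> mpow (q - p) (v p) (v q) * mpow 1 (v q) (v (Suc q))"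
      using Suc pq nonneg mpow_1 by (intro mult_mono) (auto intro: walk_prod_nonneg simp del: mpow.simps)
    also have "\<dots> \<le> mpow (q - p + 1) (v p) (v (Suc q))"
      using Suc.prems by (intro mpow_mult_le) auto
    finally show ?thesis using pq by (simp add: Suc_diff_le del: mpow.simps)
  qed (simp add: walk_prod_def)
qed (simp add: walk_prod_def)

lemma mpow_walk:
  "0 < mpow r i j \<Longrightarrow> i < n \<Longrightarrow> j < n \<Longrightarrow>
    \<exists>v. v 0 = i \<and> v r = j \<and> (\<forall>k. v k < n) \<and> walk_prod v 0 r = mpow r i j"
proof (induction r arbitrary: j)
  case 0
  then show ?case
    by (intro exI[of _ "\<lambda>_. i"]) (auto simp: walk_prod_def split: if_splits)
next
  case (Suc r)
  from Suc.prems(1) obtain m where m: "m < n" "mpow (Suc r) i j = mpow r i m * a m j"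
    by (auto elim: osum_attained[rotated])
  with Suc.prems(1) have "0 < mpow r i m * a m j" by simp
  then have "0 < mpow r i m"
    using mpow_nonneg[of r i m] by (auto simp: zero_less_mult_iff)
  with Suc.IH m Suc.prems obtain v where
    v: "v 0 = i" "v r = m" "\<forall>k. v k < n" "walk_prod v 0 r = mpow r i m" by blast
  let ?v = "v(Suc r := j)"
  have "walk_prod ?v 0 r = walk_prod v 0 r"
    unfolding walk_prod_def by (intro prod.cong) auto
  then have "walk_prod ?v 0 (Suc r) = mpow r i m * a m j"
    using v by (simp add: walk_prod_def)
  moreover have "?v 0 = i" "?v (Suc r) = j" "\<forall>k. ?v k < n" using v Suc.prems by auto
  ultimately show ?case using m(2) by metis
qed

text \<open>Bellman's principle: the product of the three segment optima lies between the weight of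
  the walk and the power entry, and these two coincide. Two cut times are offered at once because
  closed pieces will be removed between them.\<close>

lemma mpow_optimal_walk:
  assumes "0 < mpow r i j" "i < n" "j < n"
  obtains v where "v 0 = i" "v r = j" "\<And>k. v k < n" "walk_prod v 0 r = mpow r i j"
    "\<And>p q. p \<le> q \<Longrightarrow> q \<le> r \<Longrightarrow>
       mpow r i j = mpow p i (v p) * mpow (q - p) (v p) (v q) * mpow (r - q) (v q) j"
proof -
  from mpow_walk[OF assms] obtain v where
    v: "v 0 = i" "v r = j" "\<And>k. v k < n" "walk_prod v 0 r = mpow r i j" by blast
  show thesis
  proof (rule that[of v])
    fix p q assume pq: "p \<le> q" "q \<le> r"
    have "mpow r i j = walk_prod v 0 p * walk_prod v p q * walk_prod v q r"
      using v pq walk_prod_split[of 0 p r v] walk_prod_split[of p q r v] by simp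
    also have "\<dots> \<le> mpow (p - 0) (v 0) (v p) * mpow (q - p) (v p) (v q) * mpow (r - q) (v q) (v r)"
      using v pq by (intro mult_mono walk_prod_le mult_nonneg_nonneg walk_prod_nonneg) auto
    finally have "mpow r i j \<le> mpow p i (v p) * mpow (q - p) (v p) (v q) * mpow (r - q) (v q) j"
      using v by simp
    moreover have "mpow p i (v p) * mpow (q - p) (v p) (v q) * mpow (r - q) (v q) j
        \<le> mpow (p + (q - p)) i (v q) * mpow (r - q) (v q) j"
      using v by (intro mult_right_mono mpow_mult_le) auto
    moreover have "\<dots> \<le> mpow (p + (q - p) + (r - q)) i j"
      using v assms by (intro mpow_mult_le) auto
    ultimately show "mpow r i j = mpow p i (v p) * mpow (q - p) (v p) (v q) * mpow (r - q) (v q) j"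
      using pq by simp
  qed (use v in auto)
qed

lemma mpow_add:
  assumes "i < n" "j < n"
  shows "mpow (r + s) i j = osum (\<lambda>k. mpow r i k * mpow s k j) {..<n}"
proof (rule antisym)
  show "osum (\<lambda>k. mpow r i k * mpow s k j) {..<n} \<le> mpow (r + s) i j"
    using assms by (intro osum_le mpow_mult_le) auto
  show "mpow (r + s) i j \<le> osum (\<lambda>k. mpow r i k * mpow s k j) {..<n}"
  proof (cases "0 < mpow (r + s) i j")
    case True
    from mpow_optimal_walk[OF this assms] obtain v where
      v: "v 0 = i" "v (r + s) = j" "\<And>k. v k < n"
      "\<And>p q. p \<le> q \<Longrightarrow> q \<le> r + s \<Longrightarrow>
        mpow (r + s) i j = mpow p i (v p) * mpow (q - p) (v p) (v q) * mpow (r + s - q) (v q) j"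
      by metis
    from v(4)[of r r] have "mpow (r + s) i j = mpow r i (v r) * mpow s (v r) j" by simp
    also have "\<dots> \<le> osum (\<lambda>k. mpow r i k * mpow s k j) {..<n}"
      using v by (intro osum_ge[where f = "\<lambda>k. mpow r i k * mpow s k j"]) auto
    finally show ?thesis .
  next
    case False
    then show ?thesis using osum_nonneg[of "{..<n}"] by (meson finite_lessThan not_less order_trans)
  qed
qed

end

section \<open>Definite weights: shortening walks and the periodicity of critical rows\<close>

locale definite_matrix = nonneg_matrix +
  assumes closed_le_1: "i < n \<Longrightarrow> mpow r i i \<le> 1"
begin

text \<open>The optimal walk is sampled only at the \<open>n + 1\<close> times
  \<open>0, l, ..., n * l\<close>. Two samples coincide; the closed piece between them has length
  \<open>m * l\<close> and weight at most 1, so its removal loses nothing and keeps the length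
  modulo \<open>l\<close>.\<close>

lemma mpow_cut:
  assumes "1 \<le> l" "n * l \<le> r" "i < n" "j < n"
  shows "\<exists>m\<ge>1. m * l \<le> n * l \<and> mpow r i j \<le> mpow (r - m * l) i j"
proof (cases "0 < mpow r i j")
  case True
  from mpow_optimal_walk[OF True assms(3,4)] obtain v where
    v: "v 0 = i" "v r = j" "\<And>k. v k < n"
    "\<And>p q. p \<le> q \<Longrightarrow> q \<le> r \<Longrightarrow>
      mpow r i j = mpow p i (v p) * mpow (q - p) (v p) (v q) * mpow (r - q) (v q) j"
    by metis
  have "\<not> inj_on (\<lambda>k. v (k * l)) {..n}"
  proof
    assume "inj_on (\<lambda>k. v (k * l)) {..n}"
    then have "card {..n} \<le> card {..<n}" using v by (intro card_inj_on_le) auto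
    then show False by simp
  qed
  then obtain p q where pq: "p < q" "q \<le> n" "v (p * l) = v (q * l)"
    unfolding inj_on_def by (metis atMost_iff linorder_neqE_nat)
  let ?p = "p * l" and ?q = "q * l"
  have qr: "?p \<le> ?q" "?q \<le> n * l" "?q \<le> r"
    using pq assms by (auto intro: mult_le_mono1 order_trans)
  have "mpow r i j = mpow ?p i (v ?p) * mpow (?q - ?p) (v ?p) (v ?p) * mpow (r - ?q) (v ?p) j"
    using v(4)[of ?p ?q] qr pq by simp
  also have "\<dots> \<le> mpow ?p i (v ?p) * 1 * mpow (r - ?q) (v ?p) j"
    using v closed_le_1 by (intro mult_right_mono mult_left_mono) auto
  also have "\<dots> \<le> mpow (?p + (r - ?q)) i j"
    using v assms by (simp add: mpow_mult_le)
  also have "?p + (r - ?q) = r - (q - p) * l"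
    using qr by (simp add: diff_mult_distrib)
  finally show ?thesis
    using pq qr by (intro exI[of _ "q - p"]) (auto simp: diff_mult_distrib intro: order_trans[OF diff_le_self])
next
  case False
  with assms show ?thesis by (intro exI[of _ 1]) (auto intro: order_trans[of _ 0] simp: not_less)
qed

text \<open>Repeated cuts with \<open>l = 1\<close>.\<close>

lemma mpow_short:
  assumes "i < n" "j < n"
  shows "\<exists>q<n. q \<le> r \<and> mpow r i j \<le> mpow q i j"
proof (induction r rule: less_induct)
  case (less r)
  show ?case
  proof (cases "r < n")
    case False
    with mpow_cut[of 1 r i j] assms obtain m where
      m: "1 \<le> m" "m \<le> n" "mpow r i j \<le> mpow (r - m) i j" by auto
    moreover from False m assms have "r - m < r" by linarith
    with less.IH obtain q where "q < n" "q \<le> r - m" "mpow (r - m) i j \<le> mpow q i j" by blast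
    ultimately show ?thesis by (intro exI[of _ q]) auto
  qed auto
qed

definition crit :: "nat \<Rightarrow> bool" where
  "crit i \<longleftrightarrow> i < n \<and> (\<exists>l\<ge>1. mpow l i i = 1)"

text \<open>The first edge of the closed walk is kept and only the way back is shortened; closed
  walks never exceed 1, so the product stays exactly 1. The equation
  \<open>a i j * mpow q j i = 1\<close> says that the edge lies on a closed walk of weight 1, and in
  this form the program can test it.\<close>

lemma crit_short:
  assumes "crit i"
  obtains j q where "q < n" "j < n" "a i j * mpow q j i = 1"
proof -
  from assms obtain l where l: "l \<ge> 1" "mpow l i i = 1" and i: "i < n" by (auto simp: crit_def)
  from mpow_add[of i i 1 "l - 1"] l i
  have "osum (\<lambda>k. mpow 1 i k * mpow (l - 1) k i) {..<n} = 1" by simp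
  then obtain j where j: "j < n" "1 = mpow 1 i j * mpow (l - 1) j i"
    using osum_attained[of "{..<n}" "\<lambda>k. mpow 1 i k * mpow (l - 1) k i"] by force
  with mpow_1 i have 1: "a i j * mpow (l - 1) j i = 1" by simp
  from mpow_short[of j i "l - 1"] i j obtain q where
    q: "q < n" "mpow (l - 1) j i \<le> mpow q j i" by blast
  have "1 \<le> a i j * mpow q j i"
    using 1 q i j nonneg mult_left_mono[of "mpow (l - 1) j i" "mpow q j i" "a i j"] by simp
  moreover have "a i j * mpow q j i \<le> 1"
    using mpow_mult_le[OF j(1) i, of 1 i q] mpow_1[OF i j(1)] closed_le_1[OF i, of "1 + q"]
    by (simp del: mpow.simps)
  ultimately show thesis using that q j by fastforce
qed

text \<open>One and the same closed walk, started at \<open>i\<close> or at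
  \<open>j\<close>.\<close>

lemma crit_edgeI:
  assumes "a i j * mpow q j i = 1" "i < n" "j < n"
  shows "mpow (Suc q) i i = 1" "mpow (Suc q) j j = 1" "crit i" "crit j" "0 < a i j"
proof -
  have a: "a i j = mpow 1 i j" using assms mpow_1 by simp
  show 1: "mpow (Suc q) i i = 1"
    using mpow_mult_le[of j i 1 i q] closed_le_1[of i "Suc q"] assms a
    by (intro antisym) (simp_all del: mpow.simps add: mult.commute)
  show 2: "mpow (Suc q) j j = 1"
    using mpow_mult_le[of i j q j 1] closed_le_1[of j "Suc q"] assms a
    by (intro antisym) (simp_all del: mpow.simps add: mult.commute)
  show "crit i" "crit j" using 1 2 assms unfolding crit_def by (metis Suc_eq_plus1 le_add2)+
  show "0 < a i j" using assms nonneg[of i j] by (cases "a i j = 0") auto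
qed

lemma crit_cycle_power:
  assumes "mpow l i i = 1" "i < n"
  shows "mpow (m * l) i i = 1"
proof (induction m)
  case (Suc m)
  then have "1 \<le> mpow (Suc m * l) i i"
    using mpow_mult_le[of i i l i "m * l"] assms by simp
  with closed_le_1[of i] assms show ?case by (intro antisym) auto
qed simp

lemma crit_row_ge:
  assumes "mpow l i i = 1" "i < n" "j < n"
  shows "mpow r i j \<le> mpow (r + m * l) i j"
  using mpow_mult_le[of i j "m * l" i r] crit_cycle_power[of l i m] assms by (simp add: add.commute)

lemma crit_row_period:
  assumes "mpow l i i = 1" "1 \<le> l" "l \<le> n" "n * n \<le> r" "i < n" "j < n"
  shows "mpow (r + m * l) i j = mpow r i j"
proof -
  have 1: "mpow (r + l) i j = mpow r i j" if "n * n \<le> r" for r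
  proof (rule antisym)
    have "n * l \<le> n * n" using assms by simp
    with that have nl: "n * l \<le> r + l" by linarith
    then obtain m where m: "m \<ge> 1" "m * l \<le> n * l" "mpow (r + l) i j \<le> mpow (r + l - m * l) i j"
      using mpow_cut[of l "r + l" i j] assms by auto
    \<comment> \<open>The cut took \<open>m * l\<close> steps from length \<open>r + l\<close>;
      putting back \<open>m - 1\<close> critical rounds at \<open>i\<close> gives length
      \<open>r\<close> exactly.\<close>
    have "mpow (r + l - m * l) i j \<le> mpow (r + l - m * l + (m - 1) * l) i j"
      by (rule crit_row_ge) (use assms in auto)
    also have "r + l - m * l + (m - 1) * l = r"
      using m nl by (cases m) (auto simp: algebra_simps)
    finally show "mpow (r + l) i j \<le> mpow r i j" using m by linarith
    show "mpow r i j \<le> mpow (r + l) i j"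
      using crit_row_ge[of l i j r 1] assms by simp
  qed
  show ?thesis
  proof (induction m)
    case (Suc m)
    have "mpow (r + Suc m * l) i j = mpow (r + m * l + l) i j" by (simp add: algebra_simps)
    also have "\<dots> = mpow (r + m * l) i j" using assms by (intro 1) auto
    finally show ?case using Suc by simp
  qed simp
qed

text \<open>The harder inequality prefixes the way back from \<open>j\<close> to \<open>i\<close>: a
  round of length \<open>Suc p\<close> at \<open>j\<close> leaves row \<open>j\<close> unchanged by
  periodicity, and the weight of the way back is inverse to \<open>a i j\<close>.\<close>

lemma crit_row_step:
  assumes "a i j * mpow q j i = 1" "i < n" "j < n" "k < n" "n * n \<le> r"
  shows "mpow (Suc r) i k = a i j * mpow r j k"
proof (rule antisym)
  have a: "a i j = mpow 1 i j" using assms mpow_1 by simp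
  show "a i j * mpow r j k \<le> mpow (Suc r) i k"
    using mpow_mult_le[of j k 1 i r] assms a by simp
  \<comment> \<open>The given \<open>q\<close> may be large, while \<open>crit_row_period\<close>
    needs a round of length \<open>Suc p \<le> n\<close>.\<close>
  from mpow_short[of j i q] assms obtain p where p: "p < n" "mpow q j i \<le> mpow p j i" by blast
  have "1 \<le> a i j * mpow p j i"
    using assms p nonneg mult_left_mono[of "mpow q j i" "mpow p j i" "a i j"] by simp
  moreover have "a i j * mpow p j i \<le> 1"
    using mpow_mult_le[OF assms(3,2), of 1 i p] a closed_le_1[OF assms(2), of "1 + p"]
    by (simp del: mpow.simps)
  ultimately have p1: "a i j * mpow p j i = 1" by simp
  have "mpow p j i * mpow (Suc r) i k \<le> mpow (p + Suc r) j k"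
    using assms by (intro mpow_mult_le) auto
  also have "\<dots> = mpow (r + 1 * Suc p) j k" by (simp add: algebra_simps del: mpow.simps)
  also have "\<dots> = mpow r j k"
    using crit_edgeI[OF p1] p assms by (intro crit_row_period) auto
  finally have "a i j * (mpow p j i * mpow (Suc r) i k) \<le> a i j * mpow r j k"
    using nonneg assms by (intro mult_left_mono) auto
  then show "mpow (Suc r) i k \<le> a i j * mpow r j k"
    using p1 by (simp add: mult.assoc[symmetric] del: mpow.simps)
qed

end

section \<open>Walks avoiding the critical nodes\<close>

lemma eventually_ball_lessThan:
  "(\<And>i. i < (m::nat) \<Longrightarrow> eventually (P i) F) \<Longrightarrow> eventually (\<lambda>x. \<forall>i<m. P i x) F"
  using eventually_ball_finite[of "{..<m}" "\<lambda>x i. P i x" F] by (simp add: Ball_def)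

context nonneg_matrix
begin

text \<open>Among the first \<open>n + 1\<close> nodes of a walk two coincide. The closed piece
  between them contributes at most \<rho>, and removing at most \<open>n\<close> steps lowers
  \<open>r div n\<close> by at most one. \<open>K\<close> takes care of walks shorter than
  \<open>n\<close>.\<close>

lemma mpow_decay:
  assumes rho: "0 < \<rho>" "\<rho> \<le> 1" "\<And>i l. i < n \<Longrightarrow> 1 \<le> l \<Longrightarrow> l \<le> n \<Longrightarrow> mpow l i i \<le> \<rho>"
    and K: "0 \<le> K" "\<And>i j r. i < n \<Longrightarrow> j < n \<Longrightarrow> r < n \<Longrightarrow> mpow r i j \<le> K"
    and ij: "i < n" "j < n"
  shows "mpow r i j \<le> K * \<rho> ^ (r div n)"
proof (induction r rule: less_induct)
  case (less r)
  show ?case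
  proof (cases "n \<le> r \<and> 0 < mpow r i j")
    case False
    then show ?thesis using K rho ij by (auto simp: not_less intro: order_trans[of _ 0])
  next
    case True
    from mpow_optimal_walk[OF _ ij, of r] True obtain v where
      v: "v 0 = i" "v r = j" "\<And>k. v k < n"
      "\<And>p q. p \<le> q \<Longrightarrow> q \<le> r \<Longrightarrow>
        mpow r i j = mpow p i (v p) * mpow (q - p) (v p) (v q) * mpow (r - q) (v q) j"
      by metis
    have "\<not> inj_on v {..n}"
    proof
      assume "inj_on v {..n}"
      then have "card {..n} \<le> card {..<n}" using v by (intro card_inj_on_le) auto
      then show False by simp
    qed
    then obtain p q where pq: "p < q" "q \<le> n" "v p = v q"
      unfolding inj_on_def by (metis atMost_iff linorder_neqE_nat)
    let ?r = "r - (q - p)"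
    have "mpow r i j = mpow (q - p) (v p) (v p) * (mpow p i (v p) * mpow (r - q) (v p) j)"
      using v(4)[of p q] pq True by simp
    also have "\<dots> \<le> \<rho> * mpow (p + (r - q)) i j"
      using pq v rho ij by (intro mult_mono mpow_mult_le rho) auto
    also have "\<rho> * mpow (p + (r - q)) i j \<le> \<rho> * (K * \<rho> ^ (r div n - 1))"
    proof (rule mult_left_mono)
      have eq: "p + (r - q) = ?r" using pq True by simp
      have "r - n \<le> ?r" using pq True by simp
      then have "(r - n) div n \<le> ?r div n" by (rule div_le_mono)
      then have "\<rho> ^ (?r div n) \<le> \<rho> ^ (r div n - 1)"
        using True ij rho by (intro power_decreasing) (simp_all add: le_div_geq)
      moreover have "mpow ?r i j \<le> K * \<rho> ^ (?r div n)"
        using pq True by (intro less.IH) auto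
      ultimately show "mpow (p + (r - q)) i j \<le> K * \<rho> ^ (r div n - 1)"
        unfolding eq using K by (meson mult_left_mono order_trans)
    qed (use rho in auto)
    finally have "mpow r i j \<le> \<rho> * (K * \<rho> ^ (r div n - 1))" .
    moreover have "r div n \<ge> 1" using True ij by (simp add: div_greater_zero_iff Suc_le_eq)
    then have "\<rho> * \<rho> ^ (r div n - 1) = \<rho> ^ (r div n)"
      by (cases "r div n") auto
    then have "\<rho> * (K * \<rho> ^ (r div n - 1)) = K * \<rho> ^ (r div n)"
      by (metis mult.left_commute)
    ultimately show ?thesis by metis
  qed
qed

lemma mpow_tendsto_0:
  assumes "\<And>i l. i < n \<Longrightarrow> 1 \<le> l \<Longrightarrow> l \<le> n \<Longrightarrow> mpow l i i < 1" "i < n" "j < n"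
  shows "(\<lambda>r. mpow r i j) \<longlonglongrightarrow> 0"
proof -
  define D where "D = (\<lambda>(l, i). mpow l i i) ` ({1..n} \<times> {..<n})"
  \<comment> \<open>The \<open>1/2\<close> keeps \<rho> positive even when all short closed walks
    have weight 0; as a maximum of finitely many values below 1 it stays below 1.\<close>
  define \<rho> where "\<rho> = Max (insert (1/2) D)"
  have "finite D" unfolding D_def by auto
  have rho: "0 < \<rho>" "\<rho> < 1"
    using assms \<open>finite D\<close> by (auto simp: \<rho>_def D_def Max_gr_iff intro!: disjI1)
  have rho_ge: "mpow l i i \<le> \<rho>" if "i < n" "1 \<le> l" "l \<le> n" for i l
    using \<open>finite D\<close> that unfolding \<rho>_def D_def by (intro Max_ge) force+
  define E where "E = (\<lambda>(r, i, j). mpow r i j) ` ({..<n} \<times> {..<n} \<times> {..<n})"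
  define K where "K = Max (insert 0 E)"
  have "finite E" unfolding E_def by auto
  then have K: "0 \<le> K" "mpow r i j \<le> K" if "i < n" "j < n" "r < n" for i j r
    using that unfolding K_def E_def by (auto intro!: Max_ge) force+
  have "(\<lambda>r. K * \<rho> ^ (r div n)) \<longlonglongrightarrow> K * 0"
  proof (intro tendsto_mult tendsto_const)
    have "filterlim (\<lambda>r. r div n) sequentially sequentially"
      using assms by (intro filterlim_at_top_div_const_nat) auto
    then show "(\<lambda>r. \<rho> ^ (r div n)) \<longlonglongrightarrow> 0"
      using filterlim_compose[OF LIMSEQ_realpow_zero[of \<rho>]] rho by auto
  qed
  then have lim: "(\<lambda>r. K * \<rho> ^ (r div n)) \<longlonglongrightarrow> 0" by simp
  have "mpow r i j \<le> K * \<rho> ^ (r div n)" for r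
    using rho rho_ge K assms by (intro mpow_decay) auto
  then show ?thesis
    by (intro tendsto_sandwich[OF _ _ tendsto_const lim] always_eventually allI) auto
qed

lemma mpow_mono_matrix:
  assumes "nonneg_matrix n b" "\<And>i j. i < n \<Longrightarrow> j < n \<Longrightarrow> b i j \<le> a i j"
  shows "i < n \<Longrightarrow> j < n \<Longrightarrow> nonneg_matrix.mpow n b r i j \<le> mpow r i j"
proof (induction r arbitrary: j)
  interpret b: nonneg_matrix n b by fact
  case 0
  then show ?case by simp
next
  interpret b: nonneg_matrix n b by fact
  case (Suc r)
  have "b.mpow r i k * b k j \<le> osum (\<lambda>k. mpow r i k * a k j) {..<n}" if "k < n" for k
  proof -
    have "b.mpow r i k * b k j \<le> mpow r i k * a k j"
      using Suc that assms by (intro mult_mono b.nonneg) auto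
    also have "\<dots> \<le> osum (\<lambda>k. mpow r i k * a k j) {..<n}"
      using that by (intro osum_ge[where f = "\<lambda>k. mpow r i k * a k j"]) auto
    finally show ?thesis .
  qed
  then show ?case by (auto intro!: osum_le)
qed

end

section \<open>Irreducible definite weights: sending long walks through critical nodes\<close>

locale irreducible_definite_matrix = definite_matrix +
  assumes irreducible: "i < n \<Longrightarrow> j < n \<Longrightarrow> \<exists>r. 0 < mpow r i j"
    and crit_exists: "\<exists>i. crit i"
begin

text \<open>Zeroing entries instead of deleting nodes keeps the index set, so that the locale
  applies again.\<close>

definition noncrit :: "nat \<Rightarrow> nat \<Rightarrow> real" where
  "noncrit i j = (if crit i \<or> crit j then 0 else a i j)"

sublocale N: nonneg_matrix n noncrit
  by unfold_locales (auto simp: noncrit_def nonneg)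

lemma noncrit_power_le: "i < n \<Longrightarrow> j < n \<Longrightarrow> N.mpow r i j \<le> mpow r i j"
  by (rule mpow_mono_matrix) (auto simp: noncrit_def nonneg intro: N.nonneg_matrix_axioms)

text \<open>A closed walk at a noncritical node has weight below 1, since weight 1 would make the
  node critical; at a critical node all entries of \<open>noncrit\<close> vanish.\<close>

lemma noncrit_power_tendsto_0:
  assumes "i < n" "j < n"
  shows "(\<lambda>r. N.mpow r i j) \<longlonglongrightarrow> 0"
proof (rule N.mpow_tendsto_0)
  fix i l assume il: "i < n" "1 \<le> l" "l \<le> n"
  show "N.mpow l i i < 1"
  proof (cases "crit i")
    case True
    then have "N.mpow l i i = 0"
      using il by (cases l) (auto simp: noncrit_def osum_def image_constant_conv)
    then show ?thesis by simp
  next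
    case False
    then have "mpow l i i \<noteq> 1" using il by (auto simp: crit_def)
    with closed_le_1[of i l] noncrit_power_le[of i i l] il show ?thesis by linarith
  qed
qed (use assms in auto)

text \<open>
  Shortening a walk of length \<open>r\<close>, inserting a detour through a critical node and closing the
  gap with critical cycles loses at most a factor that does not depend on \<open>r\<close>.
\<close>

lemma mpow_bounded_below:
  assumes "i < n" "j < n"
  obtains \<delta> r0 where "0 < \<delta>" "\<And>r. r0 \<le> r \<Longrightarrow> mpow r i j = 0 \<or> \<delta> \<le> mpow r i j"
proof -
  from crit_exists obtain c where c: "crit c" "c < n" by (auto simp: crit_def)
  from crit_short[OF c(1)] obtain d q where dq: "q < n" "d < n" "a c d * mpow q d c = 1" .
  define l where "l = Suc q"
  have l: "mpow l c c = 1" "1 \<le> l" using crit_edgeI[OF dq(3) c(2) dq(2)] by (auto simp: l_def)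
  from irreducible assms c obtain g h where gh: "0 < mpow g i c" "0 < mpow h c i" by meson
  \<comment> \<open>The price of one detour from \<open>i\<close> to the critical node
    \<open>c\<close> and back.\<close>
  define w where "w = mpow g i c * mpow h c i"
  have w: "0 < w" using gh by (simp add: w_def)
  have w_le: "w \<le> mpow (g + h) i i" using c assms by (simp add: w_def mpow_mult_le)
  have w_pow: "w ^ m \<le> mpow (m * (g + h)) i i" for m
  proof (induction m)
    case (Suc m)
    have "w ^ Suc m \<le> mpow (g + h) i i * mpow (m * (g + h)) i i"
      using w_le Suc w by (simp add: mult_mono)
    also have "\<dots> \<le> mpow (Suc m * (g + h)) i i"
      using mpow_mult_le[of i i "g + h" i "m * (g + h)"] assms by (simp add: algebra_simps)
    finally show ?case .
  qed simp
  define E where "E = {mpow s i j | s. s < n * l \<and> 0 < mpow s i j}"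
  have "finite E" by (simp add: E_def)
  define \<epsilon> where "\<epsilon> = Min (insert 1 E)"
  have eps: "0 < \<epsilon>" using \<open>finite E\<close> by (auto simp: \<epsilon>_def E_def)
  \<comment> \<open>Cuts by multiples of \<open>l\<close> end in a length below
    \<open>n * l\<close>. The removed length \<open>m * l\<close> is recorded because it has to be
    refilled later.\<close>
  have reduce: "\<exists>s m. s < n * l \<and> r = s + m * l \<and> mpow r i j \<le> mpow s i j" for r
  proof (induction r rule: less_induct)
    case (less r)
    show ?case
    proof (cases "r < n * l")
      case False
      then obtain m where m: "1 \<le> m" "m * l \<le> n * l" "mpow r i j \<le> mpow (r - m * l) i j"
        using mpow_cut[of l r i j] l assms by auto
      moreover have "r - m * l < r" using False m l c by (cases m; cases l) auto
      with less.IH obtain s m' where s: "s < n * l" "r - m * l = s + m' * l"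
        "mpow (r - m * l) i j \<le> mpow s i j" by blast
      moreover have "m * l \<le> r" using m False by linarith
      then have "r = s + (m + m') * l" using s(2) by (simp add: algebra_simps)
      ultimately show ?thesis by (intro exI[of _ s] exI[of _ "m + m'"]) auto
    qed auto
  qed
  show thesis
  \<comment> \<open>Taking \<open>l\<close> detours makes their total length
    \<open>l * (g + h)\<close> a multiple of \<open>l\<close>. Beyond the threshold the removed
    length \<open>m * l\<close> exceeds it, and what is left can be filled with rounds of length
    \<open>l\<close> at \<open>c\<close>.\<close>
  proof (rule that[of "w ^ l * \<epsilon>" "n * l + l * (g + h)"])
    show "0 < w ^ l * \<epsilon>" using w eps by simp
    fix r assume r: "n * l + l * (g + h) \<le> r"
    show "mpow r i j = 0 \<or> w ^ l * \<epsilon> \<le> mpow r i j"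
    proof (cases "mpow r i j = 0")
      case False
      then have pos: "0 < mpow r i j" using mpow_nonneg[of r i j] by linarith
      from reduce[of r] obtain s m where s: "s < n * l" "r = s + m * l" "mpow r i j \<le> mpow s i j" by blast
      from pos s have "mpow s i j \<in> E" by (auto simp: E_def)
      then have es: "\<epsilon> \<le> mpow s i j" using \<open>finite E\<close> by (simp add: \<epsilon>_def)
      have "l * (g + h) < m * l" using r s by linarith
      then have gm: "g + h < m" by (simp add: mult.commute)
      \<comment> \<open>One of the \<open>l\<close> detours carries the \<open>m - (g + h)\<close>
        critical rounds at \<open>c\<close>, the other \<open>l - 1\<close> make no extra rounds;
        together they have length \<open>m * l\<close>.\<close>
      have "w ^ l = w * w ^ (l - 1)" using l by (cases l) auto
      also have "\<dots> \<le> (mpow g i c * mpow ((m - (g + h)) * l) c c * mpow h c i) * mpow ((l - 1) * (g + h)) i i"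
        using crit_cycle_power[OF l(1) c(2)] w_pow w by (intro mult_mono) (auto simp: w_def)
      also have "\<dots> \<le> mpow (g + (m - (g + h)) * l + h) i i * mpow ((l - 1) * (g + h)) i i"
        using c assms
        by (intro mult_right_mono order_trans[OF mult_right_mono[OF mpow_mult_le] mpow_mult_le]) auto
      also have "\<dots> \<le> mpow (g + (m - (g + h)) * l + h + (l - 1) * (g + h)) i i"
        using assms by (intro mpow_mult_le) auto
      also have "g + (m - (g + h)) * l + h + (l - 1) * (g + h) = m * l"
      proof -
        obtain m' where m': "m = g + h + m'" using gm less_imp_add_positive by blast
        show ?thesis using l unfolding m' by (cases l) (auto simp: algebra_simps)
      qed
      finally have "w ^ l * \<epsilon> \<le> mpow (m * l) i i * mpow s i j"
        using es eps by (intro mult_mono) auto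
      also have "\<dots> \<le> mpow (m * l + s) i j" using assms by (intro mpow_mult_le) auto
      finally show ?thesis using s by (simp add: add.commute)
    qed auto
  qed
qed

text \<open>Any choice of critical edges will do. A predicate instead of one fixed function lets the
  table computed by the program serve as \<sigma>.\<close>

definition crit_succ :: "(nat \<Rightarrow> nat) \<Rightarrow> bool" where
  "crit_succ \<sigma> \<longleftrightarrow> (\<forall>i. crit i \<longrightarrow> \<sigma> i < n \<and> (\<exists>q. a i (\<sigma> i) * mpow q (\<sigma> i) i = 1))"

lemma crit_succ_exists: "\<exists>\<sigma>. crit_succ \<sigma>"
  unfolding crit_succ_def by (rule choice) (metis crit_short)

definition succ_weight :: "(nat \<Rightarrow> nat) \<Rightarrow> nat \<Rightarrow> nat \<Rightarrow> real" where
  "succ_weight \<sigma> i s = (\<Prod>k<s. a ((\<sigma> ^^ k) i) ((\<sigma> ^^ Suc k) i))"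

lemma crit_orbit: "crit_succ \<sigma> \<Longrightarrow> crit i \<Longrightarrow> crit ((\<sigma> ^^ s) i)"
  by (induction s) (auto simp: crit_succ_def dest: crit_edgeI intro: crit_def[THEN iffD1, THEN conjunct1])

lemma crit_less: "crit i \<Longrightarrow> i < n"
  by (simp add: crit_def)

text \<open>Iterates \<open>crit_row_step\<close>. The induction treats the last step of the orbit,
  so it uses its hypothesis at \<open>Suc r\<close>.\<close>

lemma crit_row_orbit:
  assumes "crit_succ \<sigma>" "crit i" "k < n" "n * n \<le> r"
  shows "mpow (r + s) i k = succ_weight \<sigma> i s * mpow r ((\<sigma> ^^ s) i) k"
  using assms(4)
proof (induction s arbitrary: r)
  case (Suc s)
  define c where "c = (\<sigma> ^^ s) i"
  have c: "crit c" using crit_orbit assms c_def by simp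
  then obtain q where q: "\<sigma> c < n" "a c (\<sigma> c) * mpow q (\<sigma> c) c = 1"
    using assms(1) unfolding crit_succ_def by blast
  have "mpow (r + Suc s) i k = mpow (Suc r + s) i k" by (simp del: mpow.simps)
  also have "\<dots> = succ_weight \<sigma> i s * mpow (Suc r) c k"
    using Suc.IH[of "Suc r"] Suc.prems c_def by simp
  also have "mpow (Suc r) c k = a c (\<sigma> c) * mpow r (\<sigma> c) k"
    by (rule crit_row_step[OF q(2)]) (use q c assms Suc.prems in \<open>auto dest: crit_less\<close>)
  finally show ?case by (simp add: succ_weight_def c_def)
qed (simp add: succ_weight_def)

lemma succ_weight_le:
  assumes "crit_succ \<sigma>" "crit i"
  shows "succ_weight \<sigma> i s \<le> mpow s i ((\<sigma> ^^ s) i)"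
proof -
  have "succ_weight \<sigma> i s = walk_prod (\<lambda>k. (\<sigma> ^^ k) i) 0 s"
    by (simp add: succ_weight_def walk_prod_def atLeast0LessThan)
  also have "\<dots> \<le> mpow (s - 0) ((\<sigma> ^^ 0) i) ((\<sigma> ^^ s) i)"
    using assms crit_orbit crit_less by (intro walk_prod_le) auto
  finally show ?thesis by simp
qed

definition crit_mid :: "nat \<Rightarrow> nat \<Rightarrow> nat \<Rightarrow> nat \<Rightarrow> real" where
  "crit_mid R r i j = osum (\<lambda>c. mpow R i c * mpow (r - R) c j) {c. crit c}"

lemma finite_crit [simp]: "finite {c. crit c}"
  by (rule finite_subset[of _ "{..<n}"]) (auto simp: crit_def)

lemma crit_mid_le: "i < n \<Longrightarrow> j < n \<Longrightarrow> R \<le> r \<Longrightarrow> crit_mid R r i j \<le> mpow r i j"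
  unfolding crit_mid_def by (rule osum_le) (use crit_less mpow_mult_le[of _ j R i "r - R"] in auto)

text \<open>A critical visit at time \<open>k\<close> is moved to time \<open>R\<close>. If
  \<open>k \<le> R\<close>, the walk follows \<sigma> from \<open>c\<close> until time
  \<open>R\<close>, which loses nothing on row \<open>c\<close>. If \<open>k > R\<close>, the prefix
  is long enough to cut a multiple of the length of a critical round from it; the suffix absorbs
  these steps because row \<open>c\<close> is periodic, and \<open>k\<close> has decreased. Both
  cases need at least \<open>n * n\<close> steps for the suffix.\<close>

lemma crit_visit:
  assumes "n * n \<le> R" "R + n * n \<le> r" "k + n * n \<le> r" "crit c" "i < n" "j < n"
  shows "mpow k i c * mpow (r - k) c j \<le> crit_mid R r i j"
  using assms(3)
proof (induction k rule: less_induct)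
  case (less k)
  note c = crit_less[OF \<open>crit c\<close>]
  show ?case
  proof (cases "k \<le> R")
    case True
    from crit_succ_exists obtain \<sigma> where \<sigma>: "crit_succ \<sigma>" ..
    let ?d = "(\<sigma> ^^ (R - k)) c"
    have d: "crit ?d" "?d < n" using crit_orbit[OF \<sigma> \<open>crit c\<close>] crit_less by auto
    have "mpow (r - k) c j = mpow (r - R + (R - k)) c j"
      using True assms by simp
    also have "\<dots> = succ_weight \<sigma> c (R - k) * mpow (r - R) ?d j"
      using \<sigma> assms by (intro crit_row_orbit) auto
    also have "\<dots> \<le> mpow (R - k) c ?d * mpow (r - R) ?d j"
      using succ_weight_le[OF \<sigma> \<open>crit c\<close>] by (intro mult_right_mono) auto
    finally have "mpow k i c * mpow (r - k) c j \<le> mpow k i c * mpow (R - k) c ?d * mpow (r - R) ?d j"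
      by (simp add: mult_left_mono mult.assoc)
    also have "\<dots> \<le> mpow (k + (R - k)) i ?d * mpow (r - R) ?d j"
      using c d assms by (intro mult_right_mono mpow_mult_le) auto
    also have "\<dots> = mpow R i ?d * mpow (r - R) ?d j" using True by simp
    also have "\<dots> \<le> crit_mid R r i j"
      unfolding crit_mid_def using d
      by (intro osum_ge[where f = "\<lambda>c. mpow R i c * mpow (r - R) c j"]) auto
    finally show ?thesis .
  next
    case False
    from crit_short[OF \<open>crit c\<close>] obtain d q where
      dq: "q < n" "d < n" "a c d * mpow q d c = 1" .
    let ?l = "Suc q"
    have l: "mpow ?l c c = 1" using crit_edgeI[OF dq(3) c dq(2)] by simp
    have "n * ?l \<le> n * n" using dq by (intro mult_le_mono2) simp
    then have "n * ?l \<le> k" using False assms by simp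
    then obtain m where m: "1 \<le> m" "m * ?l \<le> n * ?l" "mpow k i c \<le> mpow (k - m * ?l) i c"
      using mpow_cut[of ?l k i c] assms c by auto
    have mk: "m * ?l \<le> k" using m \<open>n * ?l \<le> k\<close> by linarith
    have "mpow k i c * mpow (r - k) c j \<le> mpow (k - m * ?l) i c * mpow (r - k) c j"
      using m by (intro mult_right_mono) auto
    also have "\<dots> = mpow (k - m * ?l) i c * mpow (r - (k - m * ?l)) c j"
    proof -
      have "r - k + m * ?l = r - (k - m * ?l)" using mk less.prems by linarith
      moreover have "mpow (r - k) c j = mpow (r - k + m * ?l) c j"
        using crit_row_period[OF l, of "r - k" j m] dq c less.prems assms by simp
      ultimately show ?thesis by metis
    qed
    also have "\<dots> \<le> crit_mid R r i j"
      using less.prems m mk by (intro less.IH) auto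
    finally show ?thesis .
  qed
qed

text \<open>An optimal walk either meets a critical node early enough for \<open>crit_visit\<close>,
  or its first \<open>r - n * n\<close> steps avoid them all. The latter pushes its weight below the
  lower bound that nonzero entries obey.\<close>

lemma eventually_mpow_eq_crit_mid:
  assumes "n * n \<le> R"
  shows "\<forall>\<^sub>F r in sequentially. \<forall>i<n. \<forall>j<n. mpow r i j = crit_mid R r i j"
proof (intro eventually_ball_lessThan)
  fix i j assume ij: "i < n" "j < n"
  from mpow_bounded_below[OF ij] obtain \<delta> r0 where
    \<delta>: "0 < \<delta>" "\<And>r. r0 \<le> r \<Longrightarrow> mpow r i j = 0 \<or> \<delta> \<le> mpow r i j" by metis
  define E where "E = (\<lambda>k. mpow (n * n) k j) ` {..<n}"
  \<comment> \<open>\<open>K\<close> bounds the last \<open>n * n\<close> steps, so a prefix below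
    \<open>\<delta> / K\<close> puts the whole walk below \<delta>; the inserted 1 keeps
    \<open>K\<close> positive.\<close>
  define K where "K = Max (insert 1 E)"
  have "finite E" by (simp add: E_def)
  then have K: "1 \<le> K" "k < n \<Longrightarrow> mpow (n * n) k j \<le> K" for k
    unfolding K_def E_def by (auto intro!: Max_ge)
  have "\<forall>\<^sub>F s in sequentially. \<forall>k<n. N.mpow s i k < \<delta> / K"
    using \<delta> K ij noncrit_power_tendsto_0 by (intro eventually_ball_lessThan order_tendstoD(2)) auto
  then have ev: "\<forall>\<^sub>F r in sequentially. \<forall>k<n. N.mpow (r - n * n) i k < \<delta> / K"
    using filterlim_minus_const_nat_at_top[of "n * n"] unfolding filterlim_iff by auto
  show "\<forall>\<^sub>F r in sequentially. mpow r i j = crit_mid R r i j"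
    using ev eventually_ge_at_top[of r0] eventually_ge_at_top[of "R + n * n"]
      eventually_ge_at_top[of "n * n"]
  proof eventually_elim
    case (elim r)
    have nonneg_mid: "0 \<le> crit_mid R r i j" by (simp add: crit_mid_def)
    have "mpow r i j \<le> crit_mid R r i j"
    proof (cases "mpow r i j = 0")
      case False
      then have pos: "0 < mpow r i j" using mpow_nonneg[of r i j] by linarith
      from mpow_optimal_walk[OF pos ij] obtain v where
        v: "v 0 = i" "v r = j" "\<And>k. v k < n" "walk_prod v 0 r = mpow r i j"
        "\<And>p q. p \<le> q \<Longrightarrow> q \<le> r \<Longrightarrow>
          mpow r i j = mpow p i (v p) * mpow (q - p) (v p) (v q) * mpow (r - q) (v q) j"
        by metis
      let ?s = "r - n * n"
      show ?thesis
      proof (cases "\<exists>k\<le>?s. crit (v k)")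
        case True
        then obtain k where k: "k \<le> ?s" "crit (v k)" by blast
        from v(5)[of k k] k have "mpow r i j = mpow k i (v k) * mpow (r - k) (v k) j" by simp
        also have "\<dots> \<le> crit_mid R r i j"
          using k elim assms ij by (intro crit_visit) auto
        finally show ?thesis .
      next
        case False
        have "walk_prod v 0 ?s = N.walk_prod v 0 ?s"
          unfolding walk_prod_def N.walk_prod_def
          using False by (intro prod.cong) (auto simp: noncrit_def)
        also have "\<dots> \<le> N.mpow (?s - 0) (v 0) (v ?s)"
          using v by (intro N.walk_prod_le) auto
        also have "\<dots> < \<delta> / K" using elim v by simp
        finally have "walk_prod v 0 ?s < \<delta> / K" .
        moreover have "walk_prod v ?s r \<le> K"
          using walk_prod_le[of ?s r v] v elim K by (auto intro: order_trans)
        moreover have "0 \<le> walk_prod v 0 ?s" "0 \<le> walk_prod v ?s r"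
          using v by (auto intro: walk_prod_nonneg)
        ultimately have "walk_prod v 0 ?s * walk_prod v ?s r < \<delta>"
          using K \<delta> mult_strict_right_mono[of "walk_prod v 0 ?s" "\<delta> / K" K]
            mult_left_mono[of "walk_prod v ?s r" K "walk_prod v 0 ?s"] by simp
        then have "mpow r i j < \<delta>" using v walk_prod_split[of 0 ?s r v] by simp
        with \<delta> elim pos show ?thesis by fastforce
      qed
    qed (use nonneg_mid in simp)
    with crit_mid_le[OF ij, of R r] elim show ?case by simp
  qed
qed

end

section \<open>Periods of orbits\<close>

lemma osum_mult_left:
  assumes "finite S" "0 \<le> c"
  shows "osum (\<lambda>k. c * f k) S = c * osum f S"
proof (rule antisym)
  show "osum (\<lambda>k. c * f k) S \<le> c * osum f S"
    using assms by (intro osum_le mult_left_mono osum_ge) auto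
  show "c * osum f S \<le> osum (\<lambda>k. c * f k) S"
  proof (cases "osum f S = 0")
    case False
    then have "0 < osum f S" using osum_nonneg[OF assms(1), of f] by linarith
    with assms(1) obtain k where "k \<in> S" "osum f S = f k" by (rule osum_attained)
    then show ?thesis using assms osum_ge[of S k "\<lambda>k. c * f k"] by simp
  qed (use assms in simp)
qed

lemma osum_nested_le:
  assumes "finite S" "finite C" "\<And>c. c \<in> C \<Longrightarrow> 0 \<le> f c" "\<And>k. k \<in> S \<Longrightarrow> 0 \<le> x k"
  shows "osum (\<lambda>k. osum (\<lambda>c. f c * g c k) C * x k) S \<le> osum (\<lambda>c. f c * osum (\<lambda>k. g c k * x k) S) C"
proof (rule osum_le)
  fix k assume k: "k \<in> S"
  show "osum (\<lambda>c. f c * g c k) C * x k \<le> osum (\<lambda>c. f c * osum (\<lambda>k. g c k * x k) S) C"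
  proof (cases "0 < osum (\<lambda>c. f c * g c k) C")
    case True
    then obtain c where c: "c \<in> C" "osum (\<lambda>c. f c * g c k) C = f c * g c k"
      using assms(2) by (auto elim: osum_attained[rotated])
    have "osum (\<lambda>c. f c * g c k) C * x k = f c * (g c k * x k)" using c by simp
    also have "\<dots> \<le> f c * osum (\<lambda>k. g c k * x k) S"
      using assms c k osum_ge[of S k "\<lambda>k. g c k * x k"] by (intro mult_left_mono) auto
    also have "\<dots> \<le> osum (\<lambda>c. f c * osum (\<lambda>k. g c k * x k) S) C"
      using assms c by (intro osum_ge[where f = "\<lambda>c. f c * osum (\<lambda>k. g c k * x k) S"]) auto
    finally show ?thesis .
  next
    case False
    then have "osum (\<lambda>c. f c * g c k) C = 0"
      using osum_nonneg[OF assms(2), of "\<lambda>c. f c * g c k"] by linarith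
    then show ?thesis using assms by simp
  qed
qed (use assms in auto)

lemma osum_nested:
  assumes "finite S" "finite C" "\<And>c. c \<in> C \<Longrightarrow> 0 \<le> f c" "\<And>k. k \<in> S \<Longrightarrow> 0 \<le> x k"
  shows "osum (\<lambda>k. osum (\<lambda>c. f c * g c k) C * x k) S = osum (\<lambda>c. f c * osum (\<lambda>k. g c k * x k) S) C"
proof (rule antisym)
  \<comment> \<open>The converse is the same inequality with the two index sets and the two outer
    factors exchanged.\<close>
  have "osum (\<lambda>c. osum (\<lambda>k. x k * g c k) S * f c) C \<le> osum (\<lambda>k. x k * osum (\<lambda>c. g c k * f c) C) S"
    by (rule osum_nested_le) (use assms in auto)
  then show "osum (\<lambda>c. f c * osum (\<lambda>k. g c k * x k) S) C \<le> osum (\<lambda>k. osum (\<lambda>c. f c * g c k) C * x k) S"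
    by (simp add: mult.commute)
qed (rule osum_nested_le[OF assms])

lemma osum_if:
  assumes "finite S"
  shows "osum (\<lambda>c. if P c then f c else 0) S = osum f {c \<in> S. P c}"
proof (rule antisym)
  show "osum (\<lambda>c. if P c then f c else 0) S \<le> osum f {c \<in> S. P c}"
    using assms by (intro osum_le) (auto intro: osum_ge)
  have "f c \<le> osum (\<lambda>c. if P c then f c else 0) S" if "c \<in> S" "P c" for c
    using osum_ge[OF assms that(1), of "\<lambda>c. if P c then f c else 0"] that by simp
  then show "osum f {c \<in> S. P c} \<le> osum (\<lambda>c. if P c then f c else 0) S"
    using assms by (intro osum_le) auto
qed

text \<open>As \<open>z\<close> has a period \<open>l \<le> N\<close>, the positions below
  \<open>N\<close> represent all residues modulo \<open>l\<close>, so the finite test finds true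
  periods. The remainder of any period modulo the least one would be a smaller period unless it is
  0.\<close>

lemma least_period:
  fixes z :: "nat \<Rightarrow> 'a" and l N :: nat
  assumes l: "1 \<le> l" "l \<le> N" "\<And>s. z (s + l) = z s"
  defines "p \<equiv> LEAST p. 1 \<le> p \<and> (\<forall>s<N. z (s + p) = z s)"
  shows "1 \<le> p" "p \<le> l" "(\<forall>s. z (s + \<alpha>) = z s) \<longleftrightarrow> p dvd \<alpha>"
proof -
  have p: "1 \<le> p \<and> (\<forall>s<N. z (s + p) = z s)"
    unfolding p_def by (rule LeastI[of _ l]) (use l in auto)
  then show "1 \<le> p" by simp
  show "p \<le> l" unfolding p_def by (rule Least_le) (use l in auto)
  have least: "p \<le> q" if "1 \<le> q" "\<And>s. z (s + q) = z s" for q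
    unfolding p_def by (rule Least_le) (use that in auto)
  have mul: "z (s + q * m) = z s" if "\<And>s. z (s + q) = z s" for q m s
  proof (induction m)
    case (Suc m)
    have "z (s + q * Suc m) = z (s + q * m + q)" by (simp add: algebra_simps)
    then show ?case using Suc that by simp
  qed simp
  have zmod: "z (s mod l + u) = z (s + u)" for s u
  proof -
    have "s + u = s mod l + u + l * (s div l)" by simp
    then show ?thesis using mul[OF l(3)] by metis
  qed
  have pz: "z (s + p) = z s" for s
  proof -
    have "s mod l < N" using l(1,2) mod_less_divisor[of l s] by linarith
    with p have "z (s mod l + p) = z (s mod l + 0)" by simp
    then show ?thesis unfolding zmod by simp
  qed
  show "(\<forall>s. z (s + \<alpha>) = z s) \<longleftrightarrow> p dvd \<alpha>"
  proof
    assume "p dvd \<alpha>"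
    then show "\<forall>s. z (s + \<alpha>) = z s" using mul[OF pz] by (auto simp: dvd_def)
  next
    assume a: "\<forall>s. z (s + \<alpha>) = z s"
    have "z (s + \<alpha> mod p) = z s" for s
    proof -
      have "s + \<alpha> = s + \<alpha> mod p + p * (\<alpha> div p)" by simp
      then show ?thesis using mul[OF pz] a by metis
    qed
    with least[of "\<alpha> mod p"] p have "\<alpha> mod p = 0"
      by (metis mod_less_divisor not_less less_eq_Suc_le One_nat_def gr0I)
    then show "p dvd \<alpha>" by auto
  qed
qed

section \<open>Eventual periods of the orbit of a vector\<close>

context nonneg_matrix
begin

definition mvec :: "nat \<Rightarrow> (nat \<Rightarrow> real) \<Rightarrow> nat \<Rightarrow> real" where
  "mvec r x i = osum (\<lambda>k. mpow r i k * x k) {..<n}"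

lemma mvec_add:
  assumes "i < n" "\<And>k. k < n \<Longrightarrow> 0 \<le> x k"
  shows "mvec (r + s) x i = osum (\<lambda>k. mpow r i k * mvec s x k) {..<n}"
proof -
  have "mvec (r + s) x i = osum (\<lambda>k. osum (\<lambda>c. mpow r i c * mpow s c k) {..<n} * x k) {..<n}"
    unfolding mvec_def using assms by (intro osum_cong) (auto simp: mpow_add)
  also have "\<dots> = osum (\<lambda>k. mpow r i k * mvec s x k) {..<n}"
    unfolding mvec_def using assms by (intro osum_nested) auto
  finally show ?thesis .
qed

end

context irreducible_definite_matrix
begin

lemma succ_weight_nonneg: "crit_succ \<sigma> \<Longrightarrow> crit i \<Longrightarrow> 0 \<le> succ_weight \<sigma> i s"
  unfolding succ_weight_def
  by (intro prod_nonneg ballI nonneg) (metis crit_orbit crit_less)+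

lemma crit_mvec_orbit:
  assumes "crit_succ \<sigma>" "crit i" "n * n \<le> r"
  shows "mvec (r + s) x i = succ_weight \<sigma> i s * mvec r x ((\<sigma> ^^ s) i)"
proof -
  have "mvec (r + s) x i = osum (\<lambda>k. succ_weight \<sigma> i s * (mpow r ((\<sigma> ^^ s) i) k * x k)) {..<n}"
    unfolding mvec_def using crit_row_orbit[OF assms(1,2) _ assms(3)] by (intro osum_cong) auto
  then show ?thesis
    using succ_weight_nonneg[OF assms(1,2)] by (simp add: osum_mult_left mvec_def)
qed

lemma crit_period_exists:
  assumes "crit i"
  obtains l where "1 \<le> l" "l \<le> n" "mpow l i i = 1"
    "\<And>r j m. n * n \<le> r \<Longrightarrow> j < n \<Longrightarrow> mpow (r + m * l) i j = mpow r i j"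
proof -
  from crit_short[OF assms] obtain j q where q: "q < n" "j < n" "a i j * mpow q j i = 1" .
  note i = crit_less[OF assms]
  note l = crit_edgeI(1)[OF q(3) i q(2)]
  show thesis
  proof (rule that[of "Suc q"])
    show "mpow (r + m * Suc q) i j = mpow r i j" if "n * n \<le> r" "j < n" for r j m
      using crit_row_period[OF l] q i that by simp
  qed (use q l in auto)
qed

text \<open>Eventually every component is a fixed max-linear combination of the critical components
  \<open>n * n\<close> steps earlier, so it inherits their common period.\<close>

lemma eventually_mvec_period:
  assumes "\<And>k. k < n \<Longrightarrow> 0 \<le> x k"
    and "\<And>c. crit c \<Longrightarrow> \<forall>\<^sub>F r in sequentially. mvec (r + \<alpha>) x c = mvec r x c"
  shows "\<forall>\<^sub>F r in sequentially. \<forall>i<n. mvec (r + \<alpha>) x i = mvec r x i"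
proof -
  let ?R = "n * n"
  have ev1: "\<forall>\<^sub>F r in sequentially. \<forall>c<n. crit c \<longrightarrow> mvec (r - ?R + \<alpha>) x c = mvec (r - ?R) x c"
  proof (intro eventually_ball_lessThan)
    fix c
    show "\<forall>\<^sub>F r in sequentially. crit c \<longrightarrow> mvec (r - ?R + \<alpha>) x c = mvec (r - ?R) x c"
      using assms(2)[of c] filterlim_minus_const_nat_at_top[of ?R]
      by (cases "crit c") (auto simp: filterlim_iff)
  qed
  have ev2: "\<forall>\<^sub>F r in sequentially. \<forall>i<n. \<forall>j<n. mpow r i j = crit_mid ?R r i j"
    by (rule eventually_mpow_eq_crit_mid) simp
  then have ev3: "\<forall>\<^sub>F r in sequentially. \<forall>i<n. \<forall>j<n. mpow (r + \<alpha>) i j = crit_mid ?R (r + \<alpha>) i j"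
    by (rule eventually_compose_filterlim[OF _ filterlim_add_const_nat_at_top])
  have mid: "mvec r x i = osum (\<lambda>c. mpow ?R i c * mvec (r - ?R) x c) {c. crit c}"
    if "\<forall>i<n. \<forall>j<n. mpow r i j = crit_mid ?R r i j" "i < n" for r i
  proof -
    have "mvec r x i = osum (\<lambda>k. osum (\<lambda>c. mpow ?R i c * mpow (r - ?R) c k) {c. crit c} * x k) {..<n}"
      unfolding mvec_def using that by (intro osum_cong) (auto simp: crit_mid_def)
    also have "\<dots> = osum (\<lambda>c. mpow ?R i c * mvec (r - ?R) x c) {c. crit c}"
      unfolding mvec_def by (rule osum_nested) (use assms in auto)
    finally show ?thesis .
  qed
  show ?thesis
    using ev1 ev2 ev3 eventually_ge_at_top[of ?R]
  proof eventually_elim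
    case (elim r)
    show ?case
    proof (intro allI impI)
      fix i assume i: "i < n"
      have "r + \<alpha> - ?R = r - ?R + \<alpha>" using elim by simp
      then show "mvec (r + \<alpha>) x i = mvec r x i"
        using mid[of r i] mid[of "r + \<alpha>" i] elim i by (auto intro!: osum_cong dest: crit_less)
    qed
  qed
qed

text \<open>For \<open>y = mvec R x\<close> and critical \<open>i\<close> this is component
  \<open>i\<close> at time \<open>R + s\<close>: all later values come from one stored vector and a
  table of the orbit.\<close>

definition orbit_val :: "(nat \<Rightarrow> nat) \<Rightarrow> (nat \<Rightarrow> real) \<Rightarrow> nat \<Rightarrow> nat \<Rightarrow> real" where
  "orbit_val \<sigma> y i s = succ_weight \<sigma> i s * y ((\<sigma> ^^ s) i)"

definition orbit_period :: "(nat \<Rightarrow> nat) \<Rightarrow> (nat \<Rightarrow> real) \<Rightarrow> nat \<Rightarrow> nat" where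
  "orbit_period \<sigma> y i =
     (LEAST p. 1 \<le> p \<and> (\<forall>s<n. orbit_val \<sigma> y i (s + p) = orbit_val \<sigma> y i s))"

text \<open>A critical row has some period \<open>l \<le> n\<close> from time \<open>n * n\<close>
  on. Hence \<open>n\<close> consecutive values decide about periods, and holding eventually is the
  same as holding from \<open>R\<close> on.\<close>

lemma orbit_period:
  assumes "crit_succ \<sigma>" "crit i" "n * n \<le> R"
  shows "1 \<le> orbit_period \<sigma> (mvec R x) i" "orbit_period \<sigma> (mvec R x) i \<le> n"
    "(\<forall>\<^sub>F r in sequentially. mvec (r + \<alpha>) x i = mvec r x i) \<longleftrightarrow> orbit_period \<sigma> (mvec R x) i dvd \<alpha>"
    "\<exists>p. 1 \<le> p \<and> p \<le> n \<and> (\<forall>s<n. orbit_val \<sigma> (mvec R x) i (s + p) = orbit_val \<sigma> (mvec R x) i s)"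
proof -
  let ?z = "\<lambda>s. mvec (R + s) x i"
  have z: "orbit_val \<sigma> (mvec R x) i = ?z"
    using crit_mvec_orbit[OF assms(1,2,3)] by (auto simp: orbit_val_def)
  from crit_period_exists[OF assms(2)] obtain l where
    l: "1 \<le> l" "l \<le> n" "\<And>r j m. n * n \<le> r \<Longrightarrow> j < n \<Longrightarrow> mpow (r + m * l) i j = mpow r i j"
    by metis
  have vl: "mvec (r + m * l) x i = mvec r x i" if "n * n \<le> r" for r m
    unfolding mvec_def using l(3) that by (intro osum_cong) auto
  have zl: "?z (s + l) = ?z s" for s
    using vl[of "R + s" 1] assms by (simp add: add.assoc)
  note lp = least_period[of l n ?z, OF l(1,2) zl]
  show "1 \<le> orbit_period \<sigma> (mvec R x) i" using lp(1) by (simp add: orbit_period_def z)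
  show "orbit_period \<sigma> (mvec R x) i \<le> n" using lp(2) l by (simp add: orbit_period_def z)
  show "\<exists>p. 1 \<le> p \<and> p \<le> n \<and> (\<forall>s<n. orbit_val \<sigma> (mvec R x) i (s + p) = orbit_val \<sigma> (mvec R x) i s)"
    using l zl z by (intro exI[of _ l]) auto
  have "(\<forall>\<^sub>F r in sequentially. mvec (r + \<alpha>) x i = mvec r x i) \<longleftrightarrow> (\<forall>s. ?z (s + \<alpha>) = ?z s)"
  proof
    assume "\<forall>\<^sub>F r in sequentially. mvec (r + \<alpha>) x i = mvec r x i"
    then obtain r0 where r0: "\<And>r. r0 \<le> r \<Longrightarrow> mvec (r + \<alpha>) x i = mvec r x i"
      by (auto simp: eventually_sequentially)
    show "\<forall>s. ?z (s + \<alpha>) = ?z s"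
    proof
      fix s
      \<comment> \<open>Adding \<open>r0 * l\<close> passes the unknown threshold without changing
        the value.\<close>
      have "?z (s + \<alpha>) = mvec (R + s + \<alpha> + r0 * l) x i"
        using vl[of "R + s + \<alpha>" r0] assms by (simp add: add.assoc)
      also have "\<dots> = mvec (R + s + r0 * l + \<alpha>) x i" by (simp add: algebra_simps)
      also have "\<dots> = mvec (R + s + r0 * l) x i"
        using l by (intro r0) (cases l; simp)
      also have "\<dots> = ?z s" using vl[of "R + s" r0] assms by simp
      finally show "?z (s + \<alpha>) = ?z s" .
    qed
  next
    assume a: "\<forall>s. ?z (s + \<alpha>) = ?z s"
    show "\<forall>\<^sub>F r in sequentially. mvec (r + \<alpha>) x i = mvec r x i"
      using eventually_ge_at_top[of R]
    proof eventually_elim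
      case (elim r)
      then show ?case using a[rule_format, of "r - R"] by (simp add: add.assoc)
    qed
  qed
  then show "(\<forall>\<^sub>F r in sequentially. mvec (r + \<alpha>) x i = mvec r x i) \<longleftrightarrow> orbit_period \<sigma> (mvec R x) i dvd \<alpha>"
    using lp(3)[of \<alpha>] by (simp add: orbit_period_def z add.assoc)
qed

lemma eventual_period_iff:
  assumes "crit_succ \<sigma>" "n * n \<le> R" "\<And>k. k < n \<Longrightarrow> 0 \<le> x k"
  shows "(\<forall>\<^sub>F r in sequentially. \<forall>i<n. mvec (r + \<alpha>) x i = mvec r x i) \<longleftrightarrow>
    (\<forall>i. crit i \<longrightarrow> orbit_period \<sigma> (mvec R x) i dvd \<alpha>)" (is "?L \<longleftrightarrow> ?R")
proof
  assume ?L
  show ?R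
  proof (intro allI impI)
    fix i assume i: "crit i"
    from \<open>?L\<close> have "\<forall>\<^sub>F r in sequentially. mvec (r + \<alpha>) x i = mvec r x i"
      by eventually_elim (use crit_less[OF i] in auto)
    then show "orbit_period \<sigma> (mvec R x) i dvd \<alpha>" using orbit_period(3) assms i by blast
  qed
next
  assume ?R
  then show ?L using orbit_period(3) assms by (intro eventually_mvec_period) blast+
qed

text \<open>A cycle of \<sigma> may be glued from edges of different critical walks, so it remains
  to show that its weight \<open>w\<close> is 1. Each passage multiplies row \<open>d\<close> by
  \<open>w\<close>, but row \<open>d\<close> also has a period \<open>p\<close>; so \<open>p\<close>
  passages yield \<open>w ^ p = 1\<close>. Row \<open>c\<close> reaches \<open>d\<close> after
  \<open>t\<close> steps and inherits the period.\<close>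

lemma orbit_cycle_period:
  assumes "crit_succ \<sigma>" "crit c" "(\<sigma> ^^ (t + l)) c = (\<sigma> ^^ t) c" "n * n \<le> r" "j < n"
  shows "mpow (r + l * m) c j = mpow r c j"
proof -
  define d where "d = (\<sigma> ^^ t) c"
  have d: "crit d" "d < n" using crit_orbit assms crit_less by (auto simp: d_def)
  have dl: "(\<sigma> ^^ l) d = d" using assms(3) by (simp add: d_def funpow_add[symmetric, THEN fun_cong, unfolded comp_def] add.commute)
  define w where "w = succ_weight \<sigma> d l"
  have w0: "0 \<le> w" unfolding w_def using assms d by (intro succ_weight_nonneg)
  have wl: "mpow (u + l) d j = w * mpow u d j" if "n * n \<le> u" "j < n" for u j
    using crit_row_orbit[OF assms(1) d(1) that(2,1), of l] dl by (simp add: w_def)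
  have wpow: "mpow (u + m * l) d j = w ^ m * mpow u d j" if "n * n \<le> u" "j < n" for u m j
  proof (induction m)
    case (Suc m)
    have "mpow (u + Suc m * l) d j = mpow (u + m * l + l) d j" by (simp add: algebra_simps)
    then show ?case using wl[of "u + m * l" j] that Suc by simp
  qed simp
  from crit_period_exists[OF d(1)] obtain p where
    p: "1 \<le> p" "p \<le> n" "mpow p d d = 1"
      "\<And>r j m. n * n \<le> r \<Longrightarrow> j < n \<Longrightarrow> mpow (r + m * p) d j = mpow r d j" by metis
  \<comment> \<open>The exponent \<open>n * n * p\<close> is at least \<open>n * n\<close> and a
    multiple of \<open>p\<close>, so the diagonal entry there is 1 and can be cancelled.\<close>
  have big: "n * n \<le> n * n * p" using p(1) by (cases p) auto
  have "mpow (n * n * p + p * l) d d = mpow (n * n * p) d d"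
    using p(4)[OF big d(2), of l] by (simp add: mult.commute)
  with wpow[OF big d(2), of p] have "w ^ p = 1"
    using crit_cycle_power[OF p(3) d(2), of "n * n"] by simp
  then have "w = 1" using power_eq_imp_eq_base[of w p 1] w0 p(1) by simp
  have far: "mpow (u + l) c j = mpow u c j" if "n * n + t \<le> u" for u
  proof -
    have u: "u = u - t + t" "n * n \<le> u - t" using that by auto
    have "mpow (u + l) c j = mpow (u - t + l + t) c j" using u by simp
    also have "\<dots> = succ_weight \<sigma> c t * mpow (u - t + l) d j"
      using crit_row_orbit[OF assms(1,2,5), of "u - t + l" t] u d_def by simp
    also have "\<dots> = succ_weight \<sigma> c t * mpow (u - t) d j"
      using wl[of "u - t" j] u assms \<open>w = 1\<close> by simp
    also have "\<dots> = mpow (u - t + t) c j"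
      using crit_row_orbit[OF assms(1,2,5), of "u - t" t] u d_def by simp
    finally show ?thesis using u by simp
  qed
  from crit_period_exists[OF assms(2)] obtain q where
    q: "1 \<le> q" "\<And>r j m. n * n \<le> r \<Longrightarrow> j < n \<Longrightarrow> mpow (r + m * q) c j = mpow r c j" by metis
  \<comment> \<open>The threshold \<open>n * n + t\<close> of \<open>far\<close> is lowered to
    \<open>n * n\<close> by looking \<open>t * q\<close> steps ahead, where \<open>q\<close> is a
    known period of row \<open>c\<close>.\<close>
  have step: "mpow (u + l) c j = mpow u c j" if "n * n \<le> u" for u
  proof -
    have "t \<le> t * q" using q(1) by (cases q) auto
    have "mpow (u + l) c j = mpow (u + l + t * q) c j"
      using q(2)[of "u + l" j t] that assms by simp
    also have "\<dots> = mpow (u + t * q + l) c j" by (simp add: algebra_simps)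
    also have "\<dots> = mpow (u + t * q) c j" using that \<open>t \<le> t * q\<close> by (intro far) linarith
    also have "\<dots> = mpow u c j" using q(2)[of u j t] that assms by simp
    finally show ?thesis .
  qed
  show ?thesis
  proof (induction m)
    case (Suc m)
    have "mpow (r + l * Suc m) c j = mpow (r + l * m + l) c j" by (simp add: algebra_simps)
    then show ?case using step[of "r + l * m"] assms Suc by simp
  qed simp
qed

text \<open>The exponent \<open>r\<close> is replaced by a far one, congruent to it modulo
  \<open>g\<close>, at which the critical factorization holds. Row \<open>c\<close> then has two
  periods, \<open>g\<close> from \<open>T\<close> on and \<open>l c\<close> from
  \<open>n * n\<close> on. Exponents that differ by a combination of both give the same row, so no
  divisibility between the two is required.\<close>

lemma periodic_power_eq:
  assumes "crit_succ \<sigma>" "n * n \<le> R" "1 \<le> g"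
    and T: "\<And>r i j. T \<le> r \<Longrightarrow> i < n \<Longrightarrow> j < n \<Longrightarrow> mpow (r + g) i j = mpow r i j"
    and r: "T \<le> r" "[r = k] (mod g)"
    and l: "\<And>c. crit c \<Longrightarrow> 1 \<le> l c \<and> (\<sigma> ^^ (n + l c)) c = (\<sigma> ^^ n) c"
    and s: "\<And>c. s c = nat ((int k - 2 * int R) mod int (l c))"
    and ij: "i < n" "j < n"
  shows "mpow r i j =
    osum (\<lambda>c. mpow R i c * (if crit c then succ_weight \<sigma> c (s c) * mpow R ((\<sigma> ^^ s c) c) j else 0)) {..<n}"
proof -
  have Tm: "mpow (u + g * m) i j = mpow u i j" if "T \<le> u" "i < n" "j < n" for u m i j
  proof (induction m)
    case (Suc m)
    have "mpow (u + g * Suc m) i j = mpow (u + g * m + g) i j" by (simp add: algebra_simps)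
    then show ?case using T[of "u + g * m" i j] that Suc by simp
  qed simp
  from eventually_mpow_eq_crit_mid[OF assms(2)] obtain r0 where
    r0: "\<And>r i j. r0 \<le> r \<Longrightarrow> i < n \<Longrightarrow> j < n \<Longrightarrow> mpow r i j = crit_mid R r i j"
    unfolding eventually_sequentially by blast
  define m where "m = r0 + R + n * n + k"
  define r' where "r' = r + g * m"
  have "m \<le> g * m" using assms(3) by (cases g) auto
  then have "m \<le> r'" unfolding r'_def by linarith
  then have r': "r0 \<le> r'" "R + n * n \<le> r'" "k \<le> r'" unfolding m_def by linarith+
  have "[r' = k] (mod g)" using r(2) unfolding r'_def unique_euclidean_semiring_class.cong_def by simp
  then obtain X where "r' = X * g + k" using cong_le_nat[OF r'(3)] by blast
  then have X: "r' = k + g * X" by (simp add: mult.commute)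
  have row: "mpow (r' - R) c j = succ_weight \<sigma> c (s c) * mpow R ((\<sigma> ^^ s c) c) j" if c: "crit c" for c
  proof -
    let ?u = "r' - R" and ?v = "R + s c"
    define y where "y = - ((int k - 2 * int R) div int (l c))"
    have v: "int ?v = int k - int R + int (l c) * y"
    proof -
      have "int (s c) = (int k - 2 * int R) mod int (l c)"
        using l[OF c] by (simp add: s)
      also have "\<dots> = int k - 2 * int R + int (l c) * y"
        by (simp add: y_def minus_div_mult_eq_mod[symmetric] algebra_simps)
      finally show ?thesis by simp
    qed
    \<comment> \<open>The quotient \<open>y\<close> may be negative. Adding \<open>Z\<close> rounds
      makes both exponents natural numbers and moves them past \<open>T\<close>, where
      \<open>g\<close> is a period.\<close>
    define Z where "Z = T + nat \<bar>y\<bar>"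
    have "T \<le> Z" and yZ: "0 \<le> y + int Z" by (auto simp: Z_def)
    have "Z \<le> l c * Z" using l[OF c] by (cases "l c") auto
    then have TZ: "T \<le> ?v + l c * Z" using \<open>T \<le> Z\<close> by linarith
    have "int (?u + l c * nat (y + int Z)) = int (?v + l c * Z + g * X)"
      using v X r' yZ by (simp add: of_nat_diff algebra_simps)
    then have eq: "?u + l c * nat (y + int Z) = ?v + l c * Z + g * X"
      by (simp only: of_nat_eq_iff)
    have per: "mpow (u + l c * m) c j = mpow u c j" if "n * n \<le> u" for u m
      using orbit_cycle_period[OF assms(1) c _ that ij(2)] l[OF c] by blast
    have "mpow ?u c j = mpow (?u + l c * nat (y + int Z)) c j"
      using r' by (intro per[symmetric]) simp
    also have "\<dots> = mpow (?v + l c * Z) c j"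
      unfolding eq using Tm TZ crit_less[OF c] ij by simp
    also have "\<dots> = mpow ?v c j" using per assms by simp
    also have "\<dots> = succ_weight \<sigma> c (s c) * mpow R ((\<sigma> ^^ s c) c) j"
      using assms c ij by (intro crit_row_orbit) auto
    finally show ?thesis .
  qed
  have "mpow r i j = mpow r' i j" unfolding r'_def using Tm r ij by simp
  also have "\<dots> = osum (\<lambda>c. mpow R i c * mpow (r' - R) c j) {c. crit c}"
    using r0 r' ij by (simp add: crit_mid_def)
  also have "\<dots> = osum (\<lambda>c. mpow R i c * (if crit c then mpow (r' - R) c j else 0)) {..<n}"
  proof -
    have "{c. crit c} = {c \<in> {..<n}. crit c}" by (auto dest: crit_less)
    then show ?thesis
      using osum_if[of "{..<n}" crit "\<lambda>c. mpow R i c * mpow (r' - R) c j"]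
      by (simp add: if_distrib cong: if_cong)
  qed
  also have "\<dots> = osum (\<lambda>c. mpow R i c * (if crit c then succ_weight \<sigma> c (s c) * mpow R ((\<sigma> ^^ s c) c) j else 0)) {..<n}"
    using row by (intro osum_cong) auto
  finally show ?thesis .
qed

end

section \<open>Time-bounded correctness of programs\<close>

text \<open>A weakest precondition for total correctness with time. The equations below let the
  simplifier execute loop-free code and add up its cost.\<close>

definition runs :: "com \<Rightarrow> state \<Rightarrow> (nat \<Rightarrow> state \<Rightarrow> bool) \<Rightarrow> bool" where
  "runs c s Q \<longleftrightarrow> (\<exists>t s'. exec c s t s' \<and> Q t s')"

inductive_cases exec_SkipE: "exec Skip s t s'"
inductive_cases exec_IAssignE: "exec (IAssign a i j e) s t s'"
inductive_cases exec_RAssignE: "exec (RAssign a i j e) s t s'"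
inductive_cases exec_SeqE: "exec (Seq c d) s t s'"
inductive_cases exec_IfE: "exec (If b c d) s t s'"

lemma runs_Skip [simp]: "runs Skip s Q \<longleftrightarrow> Q 1 s"
  unfolding runs_def by (metis exec_SkipE exec.Skip)

lemma runs_IAssign [simp]:
  "runs (IAssign a i j e) s Q \<longleftrightarrow> Q (1 + icost i + icost j + icost e)
     (s\<lparr>icell := upd (icell s) a (ival i s) (ival j s) (ival e s)\<rparr>)"
  unfolding runs_def by (metis exec_IAssignE exec.IAssign)

lemma runs_RAssign [simp]:
  "runs (RAssign a i j e) s Q \<longleftrightarrow> Q (1 + icost i + icost j + rcost e)
     (s\<lparr>rcell := upd (rcell s) a (ival i s) (ival j s) (rval e s)\<rparr>)"
  unfolding runs_def by (metis exec_RAssignE exec.RAssign)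

lemma runs_Seq [simp]: "runs (Seq c d) s Q \<longleftrightarrow> runs c s (\<lambda>t s'. runs d s' (\<lambda>u. Q (t + u)))"
  unfolding runs_def by (metis exec_SeqE exec.Seq)

lemma runs_If [simp]:
  "runs (If b c d) s Q \<longleftrightarrow> runs (if bval b s then c else d) s (\<lambda>t. Q (1 + bcost b + t))"
proof -
  have "exec (If b c d) s t s' \<longleftrightarrow>
      (\<exists>u. t = 1 + bcost b + u \<and> exec (if bval b s then c else d) s u s')" for t s'
  proof
    assume "exec (If b c d) s t s'"
    then show "\<exists>u. t = 1 + bcost b + u \<and> exec (if bval b s then c else d) s u s'"
      by (rule exec_IfE) auto
  qed (metis exec.IfTrue exec.IfFalse)
  note exec_If = this
  show ?thesis unfolding runs_def exec_If by blast
qed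

lemma runsI: "exec c s t s' \<Longrightarrow> Q t s' \<Longrightarrow> runs c s Q"
  unfolding runs_def by blast

lemma runs_mono: "runs c s P \<Longrightarrow> (\<And>t s'. P t s' \<Longrightarrow> Q t s') \<Longrightarrow> runs c s Q"
  unfolding runs_def by blast

lemma runs_le:
  "runs c s (\<lambda>t s'. t \<le> B \<and> P s') \<Longrightarrow> B \<le> B' \<Longrightarrow> (\<And>s'. P s' \<Longrightarrow> Q s') \<Longrightarrow>
    runs c s (\<lambda>t s'. t \<le> B' \<and> Q s')"
  by (erule runs_mono) auto

text \<open>The invariant is indexed by the number of rounds made, and the demand
  \<open>k < M\<close> while the guard holds gives termination. The bound has \<open>M + 1\<close>
  for the final failing test.\<close>

lemma runs_While:
  assumes "I 0 s"
    and step: "\<And>k s. I k s \<Longrightarrow> bval b s \<Longrightarrow> k < M \<and> runs c s (\<lambda>t s'. t \<le> B \<and> I (Suc k) s')"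
  shows "runs (While b c) s (\<lambda>t s'. t \<le> (M + 1) * (B + 1 + bcost b) \<and> (\<exists>k\<le>M. I k s' \<and> \<not> bval b s'))"
proof -
  have "runs (While b c) s (\<lambda>t s'. t \<le> (M - k + 1) * (B + 1 + bcost b) \<and> (\<exists>k\<le>M. I k s' \<and> \<not> bval b s'))"
    if "I k s" "k \<le> M" for k s
    using that
  proof (induction "M - k" arbitrary: k s)
    case 0
    then have b: "\<not> bval b s" using step[of k s] by auto
    with 0 show ?case by (intro runsI[OF exec.WhileFalse[OF b]]) auto
  next
    case (Suc d)
    show ?case
    proof (cases "bval b s")
      case False
      with Suc.prems show ?thesis by (intro runsI[OF exec.WhileFalse[OF False]]) auto
    next
      case True
      with step[OF Suc.prems(1)] obtain t s' where
        s': "exec c s t s'" "t \<le> B" "I (Suc k) s'" "k < M" unfolding runs_def by blast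
      have "d = M - Suc k" "Suc k \<le> M" using Suc.hyps(2) s'(4) by auto
      from Suc.hyps(1)[OF this(1) s'(3) this(2)] obtain t' s'' where
        s'': "exec (While b c) s' t' s''" "t' \<le> (M - Suc k + 1) * (B + 1 + bcost b)"
          "\<exists>k\<le>M. I k s'' \<and> \<not> bval b s''"
        unfolding runs_def by blast
      have "M - k + 1 = Suc (M - Suc k + 1)" using s' by simp
      then have "1 + bcost b + t + t' \<le> (M - k + 1) * (B + 1 + bcost b)"
        using s' s'' by simp
      then show ?thesis
        unfolding runs_def using exec.WhileTrue[OF True s'(1) s''(1)] s''(3) by blast
    qed
  qed
  from this[of 0 s] assms(1) show ?thesis by simp
qed

abbreviation var :: "string \<Rightarrow> iexp" where
  "var v \<equiv> ICell v (IConst 0) (IConst 0)"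

abbreviation Let_var :: "string \<Rightarrow> iexp \<Rightarrow> com" where
  "Let_var v e \<equiv> IAssign v (IConst 0) (IConst 0) e"

abbreviation "set_var v x s \<equiv> s\<lparr>icell := upd (icell s) v 0 0 x\<rparr>"

definition For :: "string \<Rightarrow> iexp \<Rightarrow> com \<Rightarrow> com" where
  "For v e c = Seq (Let_var v (IConst 0))
     (While (ILess (var v) e) (Seq c (Let_var v (IAdd (var v) (IConst 1)))))"

lemma upd_apply [simp]:
  "upd m a i j v b k l = (if b = a \<and> k = i \<and> l = j then v else m b k l)"
  by (auto simp: upd_def)

lemma upd_other [simp]: "b \<noteq> a \<Longrightarrow> upd m a i j v b = m b"
  by (auto simp: upd_def)

text \<open>The 40 per round pays for the guard with \<open>icost e \<le> 20\<close>, for the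
  increment and for the initialisation. The bound \<open>e\<close> is evaluated anew in each round,
  hence the invariant has to fix its value.\<close>

lemma runs_For:
  assumes I0: "I 0 (set_var v 0 s)"
    and bound: "\<And>k s. I k s \<Longrightarrow> icell s v 0 0 = int k \<Longrightarrow> ival e s = int N"
    and step: "\<And>k s. k < N \<Longrightarrow> I k s \<Longrightarrow> icell s v 0 0 = int k \<Longrightarrow>
      runs c s (\<lambda>t s'. t \<le> B \<and> icell s' v 0 0 = int k \<and> I (Suc k) (set_var v (int (Suc k)) s'))"
    and e: "icost e \<le> 20"
  shows "runs (For v e c) s (\<lambda>t s'. t \<le> (N + 1) * (B + 40) \<and> I N s' \<and> icell s' v 0 0 = int N)"
proof -
  let ?J = "\<lambda>k s. k \<le> N \<and> I k s \<and> icell s v 0 0 = int k"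
  let ?b = "ILess (var v) e" and ?c = "Seq c (Let_var v (IAdd (var v) (IConst 1)))"
  have "runs (While ?b ?c) (set_var v 0 s)
    (\<lambda>t s'. t \<le> (N + 1) * (B + 8 + 1 + bcost ?b) \<and> (\<exists>k\<le>N. ?J k s' \<and> \<not> bval ?b s'))"
  proof (rule runs_While)
    fix k s assume J: "?J k s" and b: "bval ?b s"
    with bound[of k s] have "k < N" by auto
    moreover have "runs ?c s (\<lambda>t s'. t \<le> B + 8 \<and> ?J (Suc k) s')"
      unfolding runs_Seq by (rule runs_mono[OF step]) (use J \<open>k < N\<close> in \<open>auto simp: add.commute\<close>)
    ultimately show "k < N \<and> runs ?c s (\<lambda>t s'. t \<le> B + 8 \<and> ?J (Suc k) s')" by blast
  qed (use I0 in simp)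
  then have "runs (While ?b ?c) (set_var v 0 s)
    (\<lambda>t s'. 4 + t \<le> (N + 1) * (B + 40) \<and> I N s' \<and> icell s' v 0 0 = int N)"
  proof (rule runs_mono)
    fix t s' assume *: "t \<le> (N + 1) * (B + 8 + 1 + bcost ?b) \<and> (\<exists>k\<le>N. ?J k s' \<and> \<not> bval ?b s')"
    then obtain k where k: "k \<le> N" "I k s'" "icell s' v 0 0 = int k" "\<not> int k < ival e s'" by auto
    with bound[of k s'] have "k = N" by simp
    moreover have "4 + t \<le> 4 * (N + 1) + (N + 1) * (B + 8 + 1 + bcost ?b)"
      using * by (intro add_mono) auto
    moreover have "\<dots> = (N + 1) * (4 + (B + 8 + 1 + bcost ?b))"
      by (simp add: algebra_simps)
    moreover have "\<dots> \<le> (N + 1) * (B + 40)" using e by (intro mult_le_mono2) simp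
    ultimately show "4 + t \<le> (N + 1) * (B + 40) \<and> I N s' \<and> icell s' v 0 0 = int N"
      using k by auto
  qed
  then show ?thesis by (simp add: For_def)
qed

section \<open>Frames: the arrays that a program may change\<close>

definition frame :: "string set \<Rightarrow> string set \<Rightarrow> state \<Rightarrow> state \<Rightarrow> bool" where
  "frame X Y s s' \<longleftrightarrow> (\<forall>a. a \<notin> X \<longrightarrow> icell s' a = icell s a) \<and> (\<forall>a. a \<notin> Y \<longrightarrow> rcell s' a = rcell s a)"

lemma frame_refl: "frame X Y s s"
  by (simp add: frame_def)

lemma frame_trans:
  "frame X Y s s' \<Longrightarrow> frame X' Y' s' s'' \<Longrightarrow> X \<subseteq> Z \<Longrightarrow> X' \<subseteq> Z \<Longrightarrow> Y \<subseteq> W \<Longrightarrow> Y' \<subseteq> W \<Longrightarrow> frame Z W s s''"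
  unfolding frame_def by (metis subsetD)

lemma frame_mono: "frame X Y s s' \<Longrightarrow> X \<subseteq> Z \<Longrightarrow> Y \<subseteq> W \<Longrightarrow> frame Z W s s'"
  unfolding frame_def by blast

lemma frame_icell: "frame X Y s s' \<Longrightarrow> a \<notin> X \<Longrightarrow> icell s' a = icell s a"
  by (simp add: frame_def)

lemma frame_rcell: "frame X Y s s' \<Longrightarrow> a \<notin> Y \<Longrightarrow> rcell s' a = rcell s a"
  by (simp add: frame_def)

lemma state_update_id [simp]:
  "s\<lparr>icell := icell s\<rparr> = s" "s\<lparr>rcell := rcell s\<rparr> = s"
  "s\<lparr>rcell := r, icell := icell s\<rparr> = s\<lparr>rcell := r\<rparr>"
  "s\<lparr>icell := f, rcell := rcell s\<rparr> = s\<lparr>icell := f\<rparr>"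
  by simp_all

lemma frame_upd_icell [simp]:
  assumes "a \<in> X"
  shows "frame X Y s (s'\<lparr>icell := upd m a i j x\<rparr>) \<longleftrightarrow> frame X Y s (s'\<lparr>icell := m\<rparr>)"
    "frame X Y s (s'\<lparr>icell := upd m a i j x, rcell := r\<rparr>) \<longleftrightarrow> frame X Y s (s'\<lparr>icell := m, rcell := r\<rparr>)"
  using assms by (auto simp: frame_def upd_def)

lemma frame_upd_rcell [simp]:
  assumes "a \<in> Y"
  shows "frame X Y s (s'\<lparr>rcell := upd m a i j x\<rparr>) \<longleftrightarrow> frame X Y s (s'\<lparr>rcell := m\<rparr>)"
    "frame X Y s (s'\<lparr>rcell := upd m a i j x, icell := f\<rparr>) \<longleftrightarrow> frame X Y s (s'\<lparr>rcell := m, icell := f\<rparr>)"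
  using assms by (auto simp: frame_def upd_def)

abbreviation cell :: "string \<Rightarrow> string \<Rightarrow> string \<Rightarrow> rexp" where
  "cell a u v \<equiv> RCell a (var u) (var v)"

abbreviation put :: "string \<Rightarrow> string \<Rightarrow> string \<Rightarrow> rexp \<Rightarrow> com" where
  "put a u v e \<equiv> RAssign a (var u) (var v) e"

definition Grid :: "com \<Rightarrow> com" where
  "Grid c = For ''i'' (var ''n'') (For ''j'' (var ''n'') c)"

text \<open>Two nested loops, verified once. The body has to change exactly one cell of
  \<open>d\<close>, and its frame excludes both counters. The values \<open>g i j\<close> are fixed
  beforehand, so they cannot depend on what \<open>d\<close> contains.\<close>

lemma runs_Grid:
  assumes n: "icell s ''n'' 0 0 = int n" "''n'' \<notin> X"
    and X: "{''i'', ''j''} \<subseteq> X"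
    and body: "\<And>s' i j. i < n \<Longrightarrow> j < n \<Longrightarrow> frame X {d} s s' \<Longrightarrow>
      icell s' ''i'' 0 0 = int i \<Longrightarrow> icell s' ''j'' 0 0 = int j \<Longrightarrow>
      runs c s' (\<lambda>t s''. t \<le> B \<and> frame (X - {''i'', ''j''}) {d} s' s'' \<and>
        (\<forall>k l. rcell s'' d k l = (if k = int i \<and> l = int j then g i j else rcell s' d k l)))"
  shows "runs (Grid c) s (\<lambda>t s'. t \<le> (n + 1) * ((n + 1) * (B + 40) + 40) \<and> frame X {d} s s' \<and>
    (\<forall>i<n. \<forall>j<n. rcell s' d (int i) (int j) = g i j))"
proof -
  have iX: "''i'' \<in> X" and jX: "''j'' \<in> X" using X by auto
  have nX: "icell s' ''n'' 0 0 = int n" if "frame X {d} s s'" for s'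
    using frame_icell[OF that n(2)] n(1) by simp
  define rows where "rows i f \<longleftrightarrow> (\<forall>i'<i. \<forall>j<n. f (int i') (int j) = g i' j)" for i and f :: "int \<Rightarrow> int \<Rightarrow> real"
  define row where "row i j f \<longleftrightarrow> (\<forall>j'<j. f (int i) (int j') = g i j')" for i j and f :: "int \<Rightarrow> int \<Rightarrow> real"
  have row_Suc: "rows i f' \<and> row i (Suc j) f'"
    if "rows i f" "row i j f" "\<forall>k l. f' k l = (if k = int i \<and> l = int j then g i j else f k l)" for i j f f'
    using that by (auto simp: rows_def row_def less_Suc_eq)
  have rows_Suc: "rows (Suc i) f" if "rows i f" "row i n f" for i f
    using that by (auto simp: rows_def row_def less_Suc_eq)
  have inner: "runs (For ''j'' (var ''n'') c) s1 (\<lambda>t s'. t \<le> (n + 1) * (B + 40) \<and>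
      icell s' ''i'' 0 0 = int i \<and>
      (frame X {d} s (set_var ''i'' (int (Suc i)) s') \<and> rows (Suc i) (rcell (set_var ''i'' (int (Suc i)) s') d)))"
    if i: "i < n" and s1: "frame X {d} s s1 \<and> rows i (rcell s1 d)" and icell: "icell s1 ''i'' 0 0 = int i" for i s1
  proof (rule runs_mono[OF runs_For[where N = n and B = B and
      I = "\<lambda>j s'. (frame X {d} s s' \<and> icell s' ''i'' 0 0 = int i) \<and> rows i (rcell s' d) \<and> row i j (rcell s' d)"]])
    fix j s2
    assume j: "j < n" and s2: "(frame X {d} s s2 \<and> icell s2 ''i'' 0 0 = int i) \<and> rows i (rcell s2 d) \<and> row i j (rcell s2 d)"
      and jcell: "icell s2 ''j'' 0 0 = int j"
    from s2 have s2': "frame X {d} s s2" and icell2: "icell s2 ''i'' 0 0 = int i" by blast+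
    show "runs c s2 (\<lambda>t s'. t \<le> B \<and> icell s' ''j'' 0 0 = int j \<and>
      (frame X {d} s (set_var ''j'' (int (Suc j)) s') \<and> icell (set_var ''j'' (int (Suc j)) s') ''i'' 0 0 = int i) \<and>
      rows i (rcell (set_var ''j'' (int (Suc j)) s') d) \<and> row i (Suc j) (rcell (set_var ''j'' (int (Suc j)) s') d))"
    proof (rule runs_mono[OF body[OF i j s2' icell2 jcell]])
      fix t s3
      assume s3: "t \<le> B \<and> frame (X - {''i'', ''j''}) {d} s2 s3 \<and>
        (\<forall>k l. rcell s3 d k l = (if k = int i \<and> l = int j then g i j else rcell s2 d k l))"
      then have s3': "frame (X - {''i'', ''j''}) {d} s2 s3" by blast
      have fr: "frame X {d} s s3" by (rule frame_trans[OF s2' s3']) auto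
      have ij3: "icell s3 ''i'' 0 0 = int i" "icell s3 ''j'' 0 0 = int j"
        using frame_icell[OF s3', of "''i''"] frame_icell[OF s3', of "''j''"] icell2 jcell by auto
      have "rows i (rcell s3 d) \<and> row i (Suc j) (rcell s3 d)"
        by (rule row_Suc) (use s2 s3 in blast)+
      with s3 fr ij3 jX show "t \<le> B \<and> icell s3 ''j'' 0 0 = int j \<and>
        (frame X {d} s (set_var ''j'' (int (Suc j)) s3) \<and> icell (set_var ''j'' (int (Suc j)) s3) ''i'' 0 0 = int i) \<and>
        rows i (rcell (set_var ''j'' (int (Suc j)) s3) d) \<and> row i (Suc j) (rcell (set_var ''j'' (int (Suc j)) s3) d)"
        by simp
    qed
  qed (use s1 icell iX jX nX rows_Suc in \<open>auto simp: row_def\<close>)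
  show ?thesis
    unfolding Grid_def
    by (rule runs_mono[OF runs_For[where N = n and B = "(n + 1) * (B + 40)" and
          I = "\<lambda>i s'. frame X {d} s s' \<and> rows i (rcell s' d)"]])
      (use inner iX nX in \<open>auto simp: rows_def frame_refl\<close>)
qed

text \<open>Turns the bound of \<open>runs_For\<close> into a multiple of one power of
  \<open>n + 1\<close>; the summand 40 is absorbed because \<open>(n + 1) ^ k\<close> is at least
  1.\<close>

lemma loop_bound:
  fixes x c n k :: nat
  assumes "x \<le> c * (n + 1) ^ k" "c + 40 \<le> C" "m = Suc k"
  shows "(n + 1) * (x + 40) \<le> C * (n + 1) ^ m"
proof -
  have "x + 40 \<le> c * (n + 1) ^ k + 40 * (n + 1) ^ k" using assms by (intro add_mono) auto
  also have "\<dots> = (c + 40) * (n + 1) ^ k" by (simp only: add_mult_distrib)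
  also have "\<dots> \<le> C * (n + 1) ^ k" using assms by (intro mult_le_mono1)
  finally have "(n + 1) * (x + 40) \<le> (n + 1) * (C * (n + 1) ^ k)" by (rule mult_le_mono2)
  then show ?thesis unfolding assms(3) by (simp only: power_Suc mult_ac)
qed

lemma grid_bound:
  fixes x c n k :: nat
  assumes "x \<le> c * (n + 1) ^ k" "c + 80 \<le> C" "m = k + 2"
  shows "(n + 1) * ((n + 1) * (x + 40) + 40) \<le> C * (n + 1) ^ m"
  by (rule loop_bound[OF loop_bound[OF assms(1) order_refl refl]]) (use assms in auto)

definition Copy :: "string \<Rightarrow> string \<Rightarrow> com" where
  "Copy d a = Grid (put d ''i'' ''j'' (cell a ''i'' ''j''))"

lemma runs_Copy:
  assumes "icell s ''n'' 0 0 = int n" "d \<noteq> a"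
  shows "runs (Copy d a) s (\<lambda>t s'. t \<le> 100 * (n + 1) ^ 2 \<and> frame {''i'', ''j''} {d} s s' \<and>
    (\<forall>i<n. \<forall>j<n. rcell s' d (int i) (int j) = rcell s a (int i) (int j)))"
  unfolding Copy_def
proof (rule runs_le[OF runs_Grid[where X = "{''i'', ''j''}" and B = 16 and d = d and
        g = "\<lambda>i j. rcell s a (int i) (int j)"]])
  show "(n + 1) * ((n + 1) * (16 + 40) + 40) \<le> 100 * (n + 1) ^ 2"
    by (rule grid_bound[where c = 16 and k = 0]) auto
qed (use assms in \<open>auto simp: frame_rcell frame_refl\<close>)

definition Mult :: "string \<Rightarrow> string \<Rightarrow> string \<Rightarrow> com" where
  "Mult d a b = Grid (Seq (put d ''i'' ''j'' (RConst 0))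
     (For ''h'' (var ''n'')
       (If (RLess (cell d ''i'' ''j'') (RMul (cell a ''i'' ''h'') (cell b ''h'' ''j'')))
         (put d ''i'' ''j'' (RMul (cell a ''i'' ''h'') (cell b ''h'' ''j''))) Skip)))"

text \<open>The maximum is accumulated in the destination cell itself, starting at 0, the value of
  the empty \<open>osum\<close>. So the destination must differ from both factors.\<close>

lemma runs_Mult:
  assumes n: "icell s ''n'' 0 0 = int n" and d: "d \<noteq> a" "d \<noteq> b"
  shows "runs (Mult d a b) s (\<lambda>t s'. t \<le> 300 * (n + 1) ^ 3 \<and> frame {''i'', ''j'', ''h''} {d} s s' \<and>
    (\<forall>i<n. \<forall>j<n. rcell s' d (int i) (int j) =
      osum (\<lambda>k. rcell s a (int i) (int k) * rcell s b (int k) (int j)) {..<n}))"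
  unfolding Mult_def
proof (rule runs_le[OF runs_Grid[where X = "{''i'', ''j'', ''h''}" and B = "200 * (n + 1)" and d = d and
        g = "\<lambda>i j. osum (\<lambda>k. rcell s a (int i) (int k) * rcell s b (int k) (int j)) {..<n}"]])
  fix s1 i j
  assume ij: "i < n" "j < n" and s1: "frame {''i'', ''j'', ''h''} {d} s s1"
    and i: "icell s1 ''i'' 0 0 = int i" and j: "icell s1 ''j'' 0 0 = int j"
  let ?g = "\<lambda>k. rcell s a (int i) (int k) * rcell s b (int k) (int j)"
  let ?e = "RMul (cell a ''i'' ''h'') (cell b ''h'' ''j'')"
  let ?upd = "If (RLess (cell d ''i'' ''j'') ?e) (put d ''i'' ''j'' ?e) Skip"
  let ?s = "s1\<lparr>rcell := upd (rcell s1) d (int i) (int j) 0\<rparr>"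
  have "runs (For ''h'' (var ''n'') ?upd) ?s
    (\<lambda>t s'. t \<le> (n + 1) * (60 + 40) \<and>
       (frame {''h''} {d} s1 s' \<and> (\<forall>k l. rcell s' d k l =
         (if k = int i \<and> l = int j then osum ?g {..<n} else rcell s1 d k l))) \<and>
       icell s' ''h'' 0 0 = int n)"
  proof (rule runs_For[where N = n and B = 60 and
      I = "\<lambda>m s'. frame {''h''} {d} s1 s' \<and> (\<forall>k l. rcell s' d k l =
         (if k = int i \<and> l = int j then osum ?g {..<m} else rcell s1 d k l))"])
    fix k s2
    assume k: "k < n" and s2: "frame {''h''} {d} s1 s2 \<and> (\<forall>k' l. rcell s2 d k' l =
         (if k' = int i \<and> l = int j then osum ?g {..<k} else rcell s1 d k' l))"
      and h: "icell s2 ''h'' 0 0 = int k"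
    have "icell s2 ''i'' 0 0 = int i" "icell s2 ''j'' 0 0 = int j"
      using s2 i j by (auto simp: frame_icell)
    moreover have "rcell s2 a = rcell s a" "rcell s2 b = rcell s b"
      using s2 s1 d by (auto simp: frame_rcell)
    moreover have "rcell s2 d (int i) (int j) = osum ?g {..<k}" using s2 by simp
    ultimately show "runs ?upd s2
      (\<lambda>t s'. t \<le> 60 \<and> icell s' ''h'' 0 0 = int k \<and>
        frame {''h''} {d} s1 (set_var ''h'' (int (Suc k)) s') \<and>
        (\<forall>k' l. rcell (set_var ''h'' (int (Suc k)) s') d k' l =
         (if k' = int i \<and> l = int j then osum ?g {..<Suc k} else rcell s1 d k' l)))"
      using s2 h by (auto simp: osum_lessThan_Suc max_def)
  qed (use n s1 i j in \<open>auto simp: frame_icell frame_refl\<close>)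
  then show "runs (Seq (put d ''i'' ''j'' (RConst 0)) (For ''h'' (var ''n'') ?upd)) s1
    (\<lambda>t s''. t \<le> 200 * (n + 1) \<and> frame ({''i'', ''j'', ''h''} - {''i'', ''j''}) {d} s1 s'' \<and>
      (\<forall>k l. rcell s'' d k l = (if k = int i \<and> l = int j then osum ?g {..<n} else rcell s1 d k l)))"
    unfolding runs_Seq runs_RAssign using i j by (auto elim!: runs_mono intro: frame_mono)
next
  show "(n + 1) * ((n + 1) * (200 * (n + 1) + 40) + 40) \<le> 300 * (n + 1) ^ 3"
    by (rule grid_bound[where c = 200 and k = 1]) auto
qed (use n in auto)

text \<open>The candidates are tested in descending order, so that the last success is the least one.\<close>

definition Search :: "string \<Rightarrow> iexp \<Rightarrow> com \<Rightarrow> com" where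
  "Search v b test = Seq (Let_var v (IConst 0))
     (For ''q'' b (Seq (Let_var ''e'' (ISub b (var ''q'')))
       (Seq test (If (IEq (var ''ok'') (IConst 1)) (Let_var v (var ''e'')) Skip))))"

lemma runs_Search:
  assumes X: "{v, ''q'', ''e'', ''ok''} \<subseteq> X" and v: "v \<notin> {''q'', ''e'', ''ok''}"
    and b: "icost b \<le> 20" "\<And>s'. frame X Y s s' \<Longrightarrow> ival b s' = int N"
    and test: "\<And>s' e. 1 \<le> e \<Longrightarrow> e \<le> N \<Longrightarrow> frame X Y s s' \<Longrightarrow> icell s' ''e'' 0 0 = int e \<Longrightarrow>
      runs test s' (\<lambda>t s''. t \<le> B \<and> frame (X - {v, ''q'', ''e''}) Y s' s'' \<and>
        (icell s'' ''ok'' 0 0 = (if P e then 1 else 0)))"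
    and ex: "1 \<le> p" "p \<le> N" "P p"
  shows "runs (Search v b test) s (\<lambda>t s'. t \<le> (N + 1) * (B + 100) \<and> frame X Y s s' \<and>
    icell s' v 0 0 = int (LEAST e. 1 \<le> e \<and> P e))"
proof -
  \<comment> \<open>Once a success occurs among the candidates above \<open>N - m\<close>,
    \<open>x\<close> is a success and no larger than any of these. Before that the condition is
    vacuous, which admits the start value 0.\<close>
  define best :: "nat \<Rightarrow> int \<Rightarrow> bool" where
    "best m x \<longleftrightarrow> (\<forall>e. N < e + m \<and> e \<le> N \<and> P e \<longrightarrow> x \<le> int e \<and> 1 \<le> x \<and> P (nat x))" for m x
  have best_Suc: "best (Suc k) (if P (N - k) then int (N - k) else x)" if "best k x" "k < N" for k x
    unfolding best_def
  proof (intro allI impI)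
    fix e assume e: "N < e + Suc k \<and> e \<le> N \<and> P e"
    show "(if P (N - k) then int (N - k) else x) \<le> int e \<and> 1 \<le> (if P (N - k) then int (N - k) else x) \<and>
        P (nat (if P (N - k) then int (N - k) else x))"
    proof (cases "P (N - k)")
      case True
      then show ?thesis using e \<open>k < N\<close> by (simp del: of_nat_diff) linarith
    next
      case False
      with e have "e \<noteq> N - k" by metis
      with e have "N < e + k" by linarith
      with e that False show ?thesis unfolding best_def by simp
    qed
  qed
  let ?I = "\<lambda>m s'. frame X Y s s' \<and> best m (icell s' v 0 0)"
  let ?if = "If (IEq (var ''ok'') (IConst 1)) (Let_var v (var ''e'')) Skip"
  let ?c = "Seq (Let_var ''e'' (ISub b (var ''q''))) (Seq test ?if)"
  have "runs (For ''q'' b ?c) (set_var v 0 s)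
    (\<lambda>t s'. t \<le> (N + 1) * (B + 50 + 40) \<and> ?I N s' \<and> icell s' ''q'' 0 0 = int N)"
  proof (rule runs_For)
    fix k s1
    assume k: "k < N" and I: "?I k s1" and q: "icell s1 ''q'' 0 0 = int k"
    let ?s = "set_var ''e'' (int (N - k)) s1"
    have fr: "frame X Y s s1" using I by blast
    then have bN: "ival b s1 - int k = int (N - k)" using b k by simp
    have fr2: "frame X Y s ?s" using fr X by simp
    have "runs test ?s (\<lambda>t s''. t \<le> B \<and> frame (X - {v, ''q'', ''e''}) Y ?s s'' \<and>
        (icell s'' ''ok'' 0 0 = (if P (N - k) then 1 else 0)))"
      by (rule test) (use k fr2 in auto)
    then have "runs test ?s (\<lambda>t s''. runs ?if s''
      (\<lambda>u s'. 7 + icost b + (t + u) \<le> B + 50 \<and> icell s' ''q'' 0 0 = int k \<and>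
         ?I (Suc k) (set_var ''q'' (int (Suc k)) s')))"
    proof (rule runs_mono)
      fix t s2
      assume s2: "t \<le> B \<and> frame (X - {v, ''q'', ''e''}) Y ?s s2 \<and>
        (icell s2 ''ok'' 0 0 = (if P (N - k) then 1 else 0))"
      from s2 have "frame (X - {v, ''q'', ''e''}) Y ?s s2" by blast
      from frame_trans[OF fr2 this] have fr3: "frame X Y s s2" by blast
      have keep: "icell s2 v 0 0 = icell s1 v 0 0" "icell s2 ''q'' 0 0 = int k"
        "icell s2 ''e'' 0 0 = int (N - k)"
        using s2 v q by (auto simp: frame_icell)
      have "''q'' \<noteq> v" using v by auto
      note v = v this
      have best: "best (Suc k) (if P (N - k) then int (N - k) else icell s1 v 0 0)"
        using best_Suc I k by blast
      show "runs ?if s2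
        (\<lambda>u s'. 7 + icost b + (t + u) \<le> B + 50 \<and> icell s' ''q'' 0 0 = int k \<and>
          ?I (Suc k) (set_var ''q'' (int (Suc k)) s'))"
      proof (cases "P (N - k)")
        case True
        then show ?thesis
          using s2 X v b(1) best keep fr3 by (simp del: of_nat_diff of_nat_Suc)
      next
        case False
        then show ?thesis
          using s2 X v b(1) best keep fr3 by (simp del: of_nat_diff of_nat_Suc)
      qed
    qed
    then have test': "runs test (set_var ''e'' (ival b s1 - int k) s1) (\<lambda>t s''. runs ?if s''
      (\<lambda>u s'. 7 + icost b + (t + u) \<le> B + 50 \<and> icell s' ''q'' 0 0 = int k \<and>
         ?I (Suc k) (set_var ''q'' (int (Suc k)) s')))"
      unfolding bN .
    have cost: "1 + icost (IConst 0) + icost (IConst 0) + icost (ISub b (var ''q'')) = 7 + icost b"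
      by simp
    show "runs ?c s1 (\<lambda>t s'. t \<le> B + 50 \<and> icell s' ''q'' 0 0 = int k \<and>
         ?I (Suc k) (set_var ''q'' (int (Suc k)) s'))"
      unfolding runs_Seq runs_IAssign cost using test' q by simp
  qed (use X v b in \<open>auto simp: best_def frame_refl\<close>)
  then have "runs (For ''q'' b ?c) (set_var v 0 s)
    (\<lambda>t s'. 4 + t \<le> (N + 1) * (B + 100) \<and> frame X Y s s' \<and>
      icell s' v 0 0 = int (LEAST e. 1 \<le> e \<and> P e))"
  proof (rule runs_mono)
    fix t s'
    assume *: "t \<le> (N + 1) * (B + 50 + 40) \<and> ?I N s' \<and> icell s' ''q'' 0 0 = int N"
    let ?x = "icell s' v 0 0"
    have x: "?x \<le> int e" "1 \<le> ?x" "P (nat ?x)" if "1 \<le> e" "e \<le> N" "P e" for e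
      using *[THEN conjunct2, THEN conjunct1, THEN conjunct2, unfolded best_def, rule_format, of e] that
      by auto
    have "(LEAST e. 1 \<le> e \<and> P e) = nat ?x"
    proof (rule Least_equality)
      show "1 \<le> nat ?x \<and> P (nat ?x)" using x(2,3)[OF ex] by simp
      show "nat ?x \<le> e" if "1 \<le> e \<and> P e" for e
        using x(1)[of e] x(1)[OF ex] that ex by (cases "e \<le> N") auto
    qed
    moreover have "4 + (N + 1) * (B + 50 + 40) \<le> (N + 1) * (B + 100)" by (simp add: algebra_simps)
    ultimately show "4 + t \<le> (N + 1) * (B + 100) \<and> frame X Y s s' \<and>
        icell s' v 0 0 = int (LEAST e. 1 \<le> e \<and> P e)"
      using * x(2)[OF ex] by auto
  qed
  then show ?thesis by (simp add: Search_def)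
qed

section \<open>The algorithms\<close>

lemma runs_Seq_le:
  assumes "runs c s (\<lambda>t s'. t \<le> B1 \<and> P s')"
    and "\<And>s'. P s' \<Longrightarrow> runs d s' (\<lambda>t s''. t \<le> B2 \<and> Q s'')"
  shows "runs (Seq c d) s (\<lambda>t s''. t \<le> B1 + B2 \<and> Q s'')"
  unfolding runs_Seq
proof (rule runs_mono[OF assms(1)])
  fix t s' assume "t \<le> B1 \<and> P s'"
  then show "runs d s' (\<lambda>u s''. t + u \<le> B1 + B2 \<and> Q s'')"
    by (intro runs_mono[OF assms(2)]) auto
qed

lemma frame_step:
  "frame Z W s s1 \<Longrightarrow> frame X Y s1 s2 \<Longrightarrow> X \<subseteq> Z \<Longrightarrow> Y \<subseteq> W \<Longrightarrow> frame Z W s s2"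
  by (rule frame_trans[where X = Z and Y = W]) auto

section \<open>Powers of \<open>I \<oplus> A\<close> and the test for critical edges\<close>

context irreducible_definite_matrix
begin

text \<open>This is \<open>I \<oplus> A\<close>, as no diagonal entry of \<open>A\<close> exceeds 1.
  Its powers maximise over all walks of length at most the exponent, so repeated squaring alone
  yields the optimal ways back, in place of a separate computation of the star.\<close>

definition unit_diag :: "nat \<Rightarrow> nat \<Rightarrow> real" where
  "unit_diag i j = (if i = j then 1 else a i j)"

sublocale U: nonneg_matrix n unit_diag
  by unfold_locales (auto simp: unit_diag_def nonneg)

text \<open>A diagonal factor is a pause; dropping the pauses leaves a walk of some length
  \<open>s\<close> for \<open>a\<close>. An entry 0 is covered by \<open>s = 0\<close>.\<close>

lemma unit_diag_power_le: "j < n \<Longrightarrow> \<exists>s. U.mpow N i j \<le> mpow s i j"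
proof (induction N arbitrary: j)
  case 0
  then show ?case by (intro exI[of _ 0]) auto
next
  case (Suc N)
  show ?case
  proof (cases "0 < U.mpow (Suc N) i j")
    case True
    then obtain k where k: "k < n" "U.mpow (Suc N) i j = U.mpow N i k * unit_diag k j"
      by (auto elim: osum_attained[rotated])
    from Suc.IH[OF k(1)] obtain s where s: "U.mpow N i k \<le> mpow s i k" by blast
    show ?thesis
    proof (cases "k = j")
      case True
      then have "unit_diag k j = 1" by (simp add: unit_diag_def)
      with True k s have "U.mpow (Suc N) i j \<le> mpow s i j" by (simp del: U.mpow.simps)
      then show ?thesis ..
    next
      case False
      have "U.mpow (Suc N) i j \<le> mpow s i k * a k j"
        using False k s Suc.prems nonneg by (simp add: unit_diag_def mult_right_mono del: U.mpow.simps)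
      also have "\<dots> \<le> mpow (s + 1) i j"
        using mpow_mult_le[OF k(1) Suc.prems, of s i 1] mpow_1[OF k(1) Suc.prems] by simp
      finally show ?thesis by blast
    qed
  next
    case False
    then show ?thesis
      using U.mpow_nonneg[of "Suc N" i j] mpow_nonneg[of 0 i j] by (meson not_less order_trans)
  qed
qed

lemma unit_diag_power_ge:
  assumes "i < n" "j < n" "s \<le> N"
  shows "mpow s i j \<le> U.mpow N i j"
  using assms(3)
proof (induction N rule: dec_induct)
  case base
  have "a i j \<le> unit_diag i j" if "i < n" "j < n" for i j
    using closed_le_1[of i 1] mpow_1[of i i] that by (auto simp: unit_diag_def)
  then show ?case
    using U.mpow_mono_matrix[OF nonneg_matrix_axioms] assms by blast
next
  case (step N)
  have "U.mpow N i j * unit_diag j j \<le> U.mpow (Suc N) i j"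
    using assms by (simp, intro osum_ge[where f = "\<lambda>k. U.mpow N i k * unit_diag k j"]) auto
  moreover have "unit_diag j j = 1" by (simp add: unit_diag_def)
  ultimately show ?case using step.IH by (simp del: U.mpow.simps)
qed

text \<open>Criticality of an edge becomes a single comparison with 1. Ways back of length below
  \<open>n\<close> suffice by \<open>mpow_short\<close>, and longer ones do no harm because closed
  walks never exceed 1.\<close>

lemma crit_edge_iff:
  assumes "i < n" "j < n" "n \<le> N"
  shows "a i j * U.mpow N j i = 1 \<longleftrightarrow> (\<exists>q. a i j * mpow q j i = 1)"
proof -
  have le: "a i j * mpow s j i \<le> 1" for s
    using mpow_mult_le[OF assms(2,1), of 1 i s] mpow_1[OF assms(1,2)] closed_le_1[OF assms(1), of "1 + s"]
    by (simp del: mpow.simps)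
  from unit_diag_power_le[OF assms(1), of N j] obtain s where s: "U.mpow N j i \<le> mpow s j i" by blast
  have a: "0 \<le> a i j" using nonneg assms by blast
  have Ule: "a i j * U.mpow N j i \<le> a i j * mpow s j i" using s a by (rule mult_left_mono)
  show ?thesis
  proof
    assume "a i j * U.mpow N j i = 1"
    with Ule le[of s] show "\<exists>q. a i j * mpow q j i = 1" by (intro exI[of _ s]) linarith
  next
    assume "\<exists>q. a i j * mpow q j i = 1"
    then obtain q where q: "a i j * mpow q j i = 1" ..
    from mpow_short[OF assms(2,1), of q] obtain p where p: "p < n" "mpow q j i \<le> mpow p j i" by blast
    have "mpow q j i \<le> U.mpow N j i"
      using p unit_diag_power_ge[OF assms(2,1), of p N] assms by linarith
    then have "a i j * mpow q j i \<le> a i j * U.mpow N j i" using a by (rule mult_left_mono)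
    with q Ule le[of s] show "a i j * U.mpow N j i = 1" by linarith
  qed
qed

definition stores :: "state \<Rightarrow> string \<Rightarrow> (nat \<Rightarrow> nat \<Rightarrow> real) \<Rightarrow> bool" where
  "stores s v f \<longleftrightarrow> (\<forall>i<n. \<forall>j<n. rcell s v (int i) (int j) = f i j)"

lemma stores_frame: "stores s v f \<Longrightarrow> frame X Y s s' \<Longrightarrow> v \<notin> Y \<Longrightarrow> stores s' v f"
  by (simp add: stores_def frame_rcell)

lemma stores_Mult:
  assumes "icell s ''n'' 0 0 = int n" "d \<noteq> u" "d \<noteq> v" "stores s u f" "stores s v g"
  shows "runs (Mult d u v) s (\<lambda>t s'. t \<le> 300 * (n + 1) ^ 3 \<and> frame {''i'', ''j'', ''h''} {d} s s' \<and>
    stores s' d (\<lambda>i j. osum (\<lambda>k. f i k * g k j) {..<n}))"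
  by (rule runs_le[OF runs_Mult[OF assms(1-3)]])
    (use assms(4,5) in \<open>auto simp: stores_def intro!: osum_cong\<close>)

lemma stores_Copy:
  assumes "icell s ''n'' 0 0 = int n" "d \<noteq> u" "stores s u f"
  shows "runs (Copy d u) s (\<lambda>t s'. t \<le> 100 * (n + 1) ^ 3 \<and> frame {''i'', ''j''} {d} s s' \<and> stores s' d f)"
proof (rule runs_le[OF runs_Copy[OF assms(1,2)]])
  show "100 * (n + 1) ^ 2 \<le> 100 * (n + 1) ^ 3"
    by (intro mult_le_mono power_increasing) auto
qed (use assms(3) in \<open>auto simp: stores_def\<close>)

end

text \<open>\<open>Mult\<close> cannot write into its own factors, hence the buffers
  \<open>Q\<close> and \<open>U\<close>. \<open>P\<close> and \<open>S\<close> hold powers of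
  \<open>A\<close> and of \<open>I \<oplus> A\<close> with the common exponent
  \<open>R\<close>.\<close>

definition Square :: com where
  "Square = Seq (Mult ''Q'' ''P'' ''P'') (Seq (Mult ''U'' ''S'' ''S'')
    (Seq (Copy ''P'' ''Q'') (Seq (Copy ''S'' ''U'') (Let_var ''R'' (IAdd (var ''R'') (var ''R''))))))"

text \<open>As \<open>a\<^sub>i\<^sub>i \<le> 1\<close>, this computes \<open>I \<oplus> A\<close>.\<close>

definition Unit_diag :: com where
  "Unit_diag = Grid (If (IEq (var ''i'') (var ''j'')) (put ''S'' ''i'' ''j'' (RConst 1))
     (put ''S'' ''i'' ''j'' (cell ''A'' ''i'' ''j'')))"

definition Powers :: com where
  "Powers = Seq (Copy ''P'' ''A'') (Seq Unit_diag (Seq (Let_var ''R'' (IConst 1))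
     (While (ILess (var ''R'') (IMul (var ''n'') (var ''n''))) Square)))"

text \<open>The mark -1 for noncritical nodes is written explicitly because the initial memory is
  arbitrary.\<close>

definition Successors :: com where
  "Successors = For ''i'' (var ''n'') (Seq (IAssign ''sg'' (var ''i'') (IConst 0) (IConst (-1)))
     (For ''j'' (var ''n'')
       (If (REq (RMul (cell ''A'' ''i'' ''j'') (cell ''S'' ''j'' ''i'')) (RConst 1))
         (IAssign ''sg'' (var ''i'') (IConst 0) (var ''j'')) Skip)))"

definition Orbit_step :: com where
  "Orbit_step = Seq (IAssign ''cs'' (var ''s'') (IConst 0) (var ''c''))
     (Seq (RAssign ''ws'' (var ''s'') (IConst 0) (RCell ''w'' (IConst 0) (IConst 0)))
     (Seq (RAssign ''w'' (IConst 0) (IConst 0) (RMul (RCell ''w'' (IConst 0) (IConst 0))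
        (RCell ''A'' (var ''c'') (ICell ''sg'' (var ''c'') (IConst 0)))))
       (Let_var ''c'' (ICell ''sg'' (var ''c'') (IConst 0)))))"

text \<open>Entries 0 to \<open>2 * n\<close> are tabulated: the tests look at positions up to
  \<open>n\<close> and then up to \<open>n\<close> steps further.\<close>

definition Orbit :: com where
  "Orbit = Seq (Let_var ''c'' (var ''i'')) (Seq (RAssign ''w'' (IConst 0) (IConst 0) (RConst 1))
     (For ''s'' (IAdd (var ''n'') (IAdd (var ''n'') (IConst 1))) Orbit_step))"

section \<open>Correctness of the preparation: powers, successors, orbits\<close>

context irreducible_definite_matrix
begin

definition powers_at :: "nat \<Rightarrow> state \<Rightarrow> bool" where
  "powers_at R s \<longleftrightarrow> icell s ''n'' 0 0 = int n \<and> icell s ''R'' 0 0 = int R \<and>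
     stores s ''A'' a \<and> stores s ''P'' (mpow R) \<and> stores s ''S'' (U.mpow R)"

lemma runs_Square:
  assumes "powers_at R s"
  shows "runs Square s (\<lambda>t s'. t \<le> 900 * (n + 1) ^ 3 \<and>
    frame {''i'', ''j'', ''h'', ''R''} {''P'', ''Q'', ''S'', ''U''} s s' \<and> powers_at (R + R) s')"
proof -
  let ?Z = "{''i'', ''j'', ''h'', ''R''}" and ?W = "{''P'', ''Q'', ''S'', ''U''}"
  from assms have n: "icell s ''n'' 0 0 = int n" and R: "icell s ''R'' 0 0 = int R"
    and A: "stores s ''A'' a" and P: "stores s ''P'' (mpow R)" and S: "stores s ''S'' (U.mpow R)"
    by (auto simp: powers_at_def)
  have "runs Square s (\<lambda>t s'. t \<le> 300 * (n + 1) ^ 3 + (300 * (n + 1) ^ 3 + (100 * (n + 1) ^ 3 + (100 * (n + 1) ^ 3 + 20))) \<and>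
    frame ?Z ?W s s' \<and> powers_at (R + R) s')"
    unfolding Square_def
  proof (rule runs_Seq_le[OF stores_Mult[OF n _ _ P P]], goal_cases)
    case (3 s1)
    then have f1': "frame {''i'', ''j'', ''h''} {''Q''} s s1" by blast
    have f1: "frame ?Z ?W s s1" by (rule frame_mono[OF f1']) auto
    have n1: "icell s1 ''n'' 0 0 = int n" using frame_icell[OF f1, of "''n''"] n by simp
    have S1: "stores s1 ''S'' (U.mpow R)" by (rule stores_frame[OF S f1']) simp
    have Q1: "stores s1 ''Q'' (mpow (R + R))" using 3 by (auto simp: stores_def mpow_add)
    show ?case
    proof (rule runs_Seq_le[OF stores_Mult[OF n1 _ _ S1 S1]], goal_cases)
      case (3 s2)
      then have f2': "frame {''i'', ''j'', ''h''} {''U''} s1 s2" by blast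
      have f2: "frame ?Z ?W s s2" by (rule frame_step[OF f1 f2']) auto
      have n2: "icell s2 ''n'' 0 0 = int n" using frame_icell[OF f2, of "''n''"] n by simp
      have U2: "stores s2 ''U'' (U.mpow (R + R))" using 3 by (auto simp: stores_def U.mpow_add)
      have Q2: "stores s2 ''Q'' (mpow (R + R))" by (rule stores_frame[OF Q1 f2']) simp
      show ?case
      proof (rule runs_Seq_le[OF stores_Copy[OF n2 _ Q2]], goal_cases)
        case s3: (2 s3)
        then have f3': "frame {''i'', ''j''} {''P''} s2 s3" by blast
        have f3: "frame ?Z ?W s s3" by (rule frame_step[OF f2 f3']) auto
        have n3: "icell s3 ''n'' 0 0 = int n" using frame_icell[OF f3, of "''n''"] n by simp
        have U3: "stores s3 ''U'' (U.mpow (R + R))" by (rule stores_frame[OF U2 f3']) simp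
        show ?case
        proof (rule runs_Seq_le[OF stores_Copy[OF n3 _ U3]], goal_cases)
          case s4: (2 s4)
          then have f4': "frame {''i'', ''j''} {''S''} s3 s4" by blast
          have f4: "frame ?Z ?W s s4" by (rule frame_step[OF f3 f4']) auto
          have P4: "stores s4 ''P'' (mpow (R + R))"
            by (rule stores_frame[OF conjunct2[OF s3] f4']) simp
          have A4: "stores s4 ''A'' a" by (rule stores_frame[OF A f4]) simp
          have n4: "icell s4 ''n'' 0 0 = int n" using frame_icell[OF f4, of "''n''"] n by simp
          have R4: "icell s4 ''R'' 0 0 = int R"
            using frame_icell[OF f1', of "''R''"] frame_icell[OF f2', of "''R''"]
              frame_icell[OF f3', of "''R''"] frame_icell[OF f4', of "''R''"] R by simp
          show ?case
            using f4 P4 A4 n4 R4 s4 by (auto simp: powers_at_def stores_def)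
        qed simp
      qed simp
    qed simp_all
  qed simp_all
  then show ?thesis
  proof (rule runs_le)
    have "1 \<le> (n + 1) ^ 3" by simp
    then show "300 * (n + 1) ^ 3 + (300 * (n + 1) ^ 3 + (100 * (n + 1) ^ 3 + (100 * (n + 1) ^ 3 + 20)))
      \<le> 900 * (n + 1) ^ 3" by linarith
  qed
qed

lemma runs_Unit_diag:
  assumes "icell s ''n'' 0 0 = int n" "stores s ''A'' a"
  shows "runs Unit_diag s (\<lambda>t s'. t \<le> 200 * (n + 1) ^ 2 \<and> frame {''i'', ''j''} {''S''} s s' \<and>
    stores s' ''S'' unit_diag)"
  unfolding Unit_diag_def stores_def
proof (rule runs_le[OF runs_Grid[where X = "{''i'', ''j''}" and B = 100 and d = "''S''" and g = unit_diag]])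
  fix s' i j
  assume ij: "i < n" "j < n" and fr: "frame {''i'', ''j''} {''S''} s s'"
    and cells: "icell s' ''i'' 0 0 = int i" "icell s' ''j'' 0 0 = int j"
  have "rcell s' ''A'' (int i) (int j) = a i j"
    using frame_rcell[OF fr, of "''A''"] assms ij by (simp add: stores_def)
  then show "runs (If (IEq (var ''i'') (var ''j'')) (put ''S'' ''i'' ''j'' (RConst 1))
     (put ''S'' ''i'' ''j'' (cell ''A'' ''i'' ''j''))) s'
    (\<lambda>t s''. t \<le> 100 \<and> frame ({''i'', ''j''} - {''i'', ''j''}) {''S''} s' s'' \<and>
      (\<forall>k l. rcell s'' ''S'' k l = (if k = int i \<and> l = int j then unit_diag i j else rcell s' ''S'' k l)))"
    using cells by (simp add: frame_refl unit_diag_def)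
next
  show "(n + 1) * ((n + 1) * (100 + 40) + 40) \<le> 200 * (n + 1) ^ 2"
    by (rule grid_bound[where c = 100 and k = 0]) auto
qed (use assms in auto)

text \<open>After \<open>k\<close> squarings the exponent is \<open>2 ^ k\<close>, and another
  squaring happens only while it is below \<open>n * n \<le> 2 ^ M\<close>; so there are at most
  \<open>M\<close> of them.\<close>

lemma runs_Powers:
  assumes n: "icell s ''n'' 0 0 = int n" and A: "stores s ''A'' a" and M: "n * n \<le> 2 ^ M"
  shows "runs Powers s (\<lambda>t s'. t \<le> 1300 * ((n + 1) ^ 3 * (M + 1)) \<and>
    frame {''i'', ''j'', ''h'', ''R''} {''P'', ''Q'', ''S'', ''U''} s s' \<and>
    (\<exists>R. n * n \<le> R \<and> 1 \<le> R \<and> powers_at R s'))"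
proof -
  let ?Z = "{''i'', ''j'', ''h'', ''R''}" and ?W = "{''P'', ''Q'', ''S'', ''U''}"
  let ?b = "ILess (var ''R'') (IMul (var ''n'') (var ''n''))"
  have "runs Powers s (\<lambda>t s'. t \<le> 100 * (n + 1) ^ 3 + (200 * (n + 1) ^ 2 + (20 + (M + 1) * (900 * (n + 1) ^ 3 + 1 + bcost ?b))) \<and>
    frame ?Z ?W s s' \<and> (\<exists>R. n * n \<le> R \<and> 1 \<le> R \<and> powers_at R s'))"
    unfolding Powers_def
  proof (rule runs_Seq_le[OF stores_Copy[OF n _ A]], goal_cases)
    case s1: (2 s1)
    then have f1': "frame {''i'', ''j''} {''P''} s s1" by blast
    have f1: "frame ?Z ?W s s1" by (rule frame_mono[OF f1']) auto
    have n1: "icell s1 ''n'' 0 0 = int n" using frame_icell[OF f1, of "''n''"] n by simp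
    have A1: "stores s1 ''A'' a" by (rule stores_frame[OF A f1]) simp
    show ?case
    proof (rule runs_Seq_le[OF runs_Unit_diag[OF n1 A1]], goal_cases)
      case s2: (1 s2)
      then have f2': "frame {''i'', ''j''} {''S''} s1 s2" by blast
      have f2: "frame ?Z ?W s s2" by (rule frame_step[OF f1 f2']) auto
      have n2: "icell s2 ''n'' 0 0 = int n" using frame_icell[OF f2, of "''n''"] n by simp
      have A2: "stores s2 ''A'' a" by (rule stores_frame[OF A f2]) simp
      have P2: "stores s2 ''P'' a" by (rule stores_frame[OF conjunct2[OF s1] f2']) simp
      let ?s = "set_var ''R'' 1 s2"
      have init: "frame ?Z ?W s ?s \<and> powers_at (2 ^ 0) ?s"
        using f2 n2 A2 P2 s2 mpow_1 U.mpow_1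
        by (simp add: powers_at_def stores_def del: mpow.simps U.mpow.simps)
      have "runs (While ?b Square) ?s (\<lambda>t s'. t \<le> (M + 1) * (900 * (n + 1) ^ 3 + 1 + bcost ?b) \<and>
          (\<exists>k\<le>M. (frame ?Z ?W s s' \<and> powers_at (2 ^ k) s') \<and> \<not> bval ?b s'))"
      proof (rule runs_While)
        fix k s3 assume s3: "frame ?Z ?W s s3 \<and> powers_at (2 ^ k) s3" and b: "bval ?b s3"
        from s3 b have "int (2 ^ k) < int n * int n" by (simp add: powers_at_def)
        then have lt: "2 ^ k < n * n" by (simp only: of_nat_mult[symmetric] of_nat_less_iff)
        with M have "(2::nat) ^ k < 2 ^ M" by linarith
        then have "k < M" by (rule power_less_imp_less_exp[rotated]) simp
        moreover have "runs Square s3 (\<lambda>t s'. t \<le> 900 * (n + 1) ^ 3 \<and> (frame ?Z ?W s s' \<and> powers_at (2 ^ Suc k) s'))"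
        proof (rule runs_mono[OF runs_Square[OF conjunct2[OF s3]]])
          fix t s'
          assume *: "t \<le> 900 * (n + 1) ^ 3 \<and> frame ?Z ?W s3 s' \<and> powers_at (2 ^ k + 2 ^ k) s'"
          then have "frame ?Z ?W s s'" by (intro frame_step[OF conjunct1[OF s3]]) auto
          with * show "t \<le> 900 * (n + 1) ^ 3 \<and> (frame ?Z ?W s s' \<and> powers_at (2 ^ Suc k) s')"
            by (simp add: mult_2)
        qed
        ultimately show "k < M \<and> runs Square s3 (\<lambda>t s'. t \<le> 900 * (n + 1) ^ 3 \<and> (frame ?Z ?W s s' \<and> powers_at (2 ^ Suc k) s'))"
          by blast
      qed (rule init)
      then show ?case
        unfolding runs_Seq runs_IAssign
      proof (simp only: ival.simps of_int_1, elim runs_mono)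
        fix t s'
        assume *: "t \<le> (M + 1) * (900 * (n + 1) ^ 3 + 1 + bcost ?b) \<and>
          (\<exists>k\<le>M. (frame ?Z ?W s s' \<and> powers_at (2 ^ k) s') \<and> \<not> bval ?b s')"
        then obtain k where k: "powers_at (2 ^ k) s'" "\<not> bval ?b s'" by blast
        then have "\<not> int (2 ^ k) < int n * int n" by (simp add: powers_at_def)
        then have "n * n \<le> 2 ^ k" by (simp only: of_nat_mult[symmetric] of_nat_less_iff not_less)
        moreover have "(1::nat) \<le> 2 ^ k" by simp
        ultimately show "1 + icost (IConst 0) + icost (IConst 0) + icost (IConst 1) + t
            \<le> 20 + (M + 1) * (900 * (n + 1) ^ 3 + 1 + bcost ?b) \<and>
          frame ?Z ?W s s' \<and> (\<exists>R. n * n \<le> R \<and> 1 \<le> R \<and> powers_at R s')"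
          using * k(1) by (auto simp del: bcost.simps)
      qed
    qed
  qed simp_all
  then show ?thesis
  proof (rule runs_le)
    let ?m = "(n + 1) ^ 3"
    have 1: "1 \<le> ?m" by (rule one_le_power) simp
    have 2: "(n + 1) ^ 2 \<le> ?m" by (rule power_increasing) auto
    have "(M + 1) * (900 * ?m + 1 + bcost ?b) \<le> (M + 1) * (920 * ?m)"
    proof (rule mult_le_mono2)
      have "bcost ?b = 11" by simp
      then show "900 * ?m + 1 + bcost ?b \<le> 920 * ?m" using 1 by linarith
    qed
    moreover have "?m \<le> ?m * (M + 1)" by simp
    ultimately show "100 * ?m + (200 * (n + 1) ^ 2 + (20 + (M + 1) * (900 * ?m + 1 + bcost ?b)))
        \<le> 1300 * (?m * (M + 1))"
      using 1 2 by (simp only: mult.commute[of "M + 1"] mult.assoc)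
  qed
qed

definition succ_at :: "(nat \<Rightarrow> nat) \<Rightarrow> state \<Rightarrow> bool" where
  "succ_at \<sigma> s \<longleftrightarrow> (\<forall>i<n. icell s ''sg'' (int i) 0 = (if crit i then int (\<sigma> i) else -1))"

definition prepared :: "(nat \<Rightarrow> nat) \<Rightarrow> nat \<Rightarrow> state \<Rightarrow> bool" where
  "prepared \<sigma> R s \<longleftrightarrow> icell s ''n'' 0 0 = int n \<and> n * n \<le> R \<and> crit_succ \<sigma> \<and>
     icell s ''R'' 0 0 = int R \<and> stores s ''A'' a \<and> stores s ''P'' (mpow R) \<and> succ_at \<sigma> s"

lemma prepared_frame:
  assumes "prepared \<sigma> R s" "frame X Y s s'" "''n'' \<notin> X" "''R'' \<notin> X" "''sg'' \<notin> X" "''A'' \<notin> Y" "''P'' \<notin> Y"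
  shows "prepared \<sigma> R s'"
  using assms frame_icell[OF assms(2)] stores_frame[OF _ assms(2)]
  by (auto simp: prepared_def succ_at_def)

definition edge :: "nat \<Rightarrow> nat \<Rightarrow> bool" where
  "edge i j \<longleftrightarrow> j < n \<and> (\<exists>q. a i j * mpow q j i = 1)"

lemma crit_edge_ex: "crit i \<longleftrightarrow> i < n \<and> (\<exists>j. edge i j)"
  unfolding edge_def by (metis crit_short crit_edgeI(3) crit_less)

text \<open>A later edge overwrites an earlier one, but any edge serves for
  \<open>crit_succ\<close>; the invariant therefore records only that one was found.\<close>

definition last_edge :: "nat \<Rightarrow> nat \<Rightarrow> int \<Rightarrow> bool" where
  "last_edge i m x \<longleftrightarrow> x = -1 \<and> (\<forall>j<m. \<not> edge i j) \<or> (\<exists>j. x = int j \<and> edge i j)"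

lemma runs_Successors:
  assumes n: "icell s ''n'' 0 0 = int n" and A: "stores s ''A'' a"
    and S: "stores s ''S'' (U.mpow R)" and R: "n \<le> R"
  shows "runs Successors s (\<lambda>t s'. t \<le> 300 * (n + 1) ^ 2 \<and> frame {''i'', ''j'', ''sg''} {} s s' \<and>
    (\<exists>\<sigma>. crit_succ \<sigma> \<and> succ_at \<sigma> s'))"
proof -
  let ?X = "{''i'', ''j'', ''sg''}"
  let ?test = "If (REq (RMul (cell ''A'' ''i'' ''j'') (cell ''S'' ''j'' ''i'')) (RConst 1))
         (IAssign ''sg'' (var ''i'') (IConst 0) (var ''j'')) Skip"
  let ?I = "\<lambda>i s'. frame ?X {} s s' \<and> (\<forall>i'<i. last_edge i' n (icell s' ''sg'' (int i') 0))"
  have "runs Successors s (\<lambda>t s'. t \<le> (n + 1) * (7 + (n + 1) * (60 + 40) + 40) \<and> ?I n s' \<and> icell s' ''i'' 0 0 = int n)"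
    unfolding Successors_def
  proof (rule runs_For[where I = ?I])
    fix i s1
    assume i: "i < n" and I: "?I i s1" and icell: "icell s1 ''i'' 0 0 = int i"
    from I have f1: "frame ?X {} s s1" by blast
    let ?s = "s1\<lparr>icell := upd (icell s1) ''sg'' (int i) 0 (-1)\<rparr>"
    let ?J = "\<lambda>j s'. frame ?X {} s s' \<and> icell s' ''i'' 0 0 = int i \<and>
      (\<forall>i'<i. icell s' ''sg'' (int i') 0 = icell s1 ''sg'' (int i') 0) \<and>
      last_edge i j (icell s' ''sg'' (int i) 0)"
    have "runs (For ''j'' (var ''n'') ?test) ?s (\<lambda>t s'. t \<le> (n + 1) * (60 + 40) \<and> ?J n s' \<and> icell s' ''j'' 0 0 = int n)"
    proof (rule runs_For[where I = ?J])
      fix j s2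
      assume j: "j < n" and J: "?J j s2" and jcell: "icell s2 ''j'' 0 0 = int j"
      from J have f2: "frame ?X {} s s2" by blast
      have AS: "rcell s2 ''A'' (int i) (int j) = a i j" "rcell s2 ''S'' (int j) (int i) = U.mpow R j i"
        using frame_rcell[OF f2] A S i j by (auto simp: stores_def)
      have edge: "a i j * U.mpow R j i = 1 \<longleftrightarrow> edge i j"
        using crit_edge_iff[OF i j R] j by (simp add: edge_def)
      have Suc: "last_edge i (Suc j) x" if "last_edge i j x" "\<not> edge i j" for x
        using that by (auto simp: last_edge_def less_Suc_eq)
      show "runs ?test s2 (\<lambda>t s'. t \<le> 60 \<and> icell s' ''j'' 0 0 = int j \<and>
         ?J (Suc j) (set_var ''j'' (int (Suc j)) s'))"
      proof (cases "edge i j")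
        case True
        then have "last_edge i (Suc j) (int j)" by (auto simp: last_edge_def)
        with True show ?thesis using J jcell AS edge f2 by (simp del: of_nat_Suc)
      next
        case False
        then show ?thesis using J jcell AS edge f2 Suc by (simp del: of_nat_Suc)
      qed
    next
      fix j s2
      assume "?J j s2"
      then show "ival (var ''n'') s2 = int n" using frame_icell[of ?X "{}" s s2 "''n''"] n by simp
    qed (use f1 icell in \<open>auto simp: last_edge_def\<close>)
    then have "runs (For ''j'' (var ''n'') ?test) ?s (\<lambda>t s'. 7 + t \<le> 7 + (n + 1) * (60 + 40) \<and>
        icell s' ''i'' 0 0 = int i \<and> ?I (Suc i) (set_var ''i'' (int (Suc i)) s'))"
      by (rule runs_mono) (use I in \<open>auto simp: less_Suc_eq simp del: of_nat_Suc\<close>)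
    then show "runs (Seq (IAssign ''sg'' (var ''i'') (IConst 0) (IConst (-1))) (For ''j'' (var ''n'') ?test)) s1
      (\<lambda>t s'. t \<le> 7 + (n + 1) * (60 + 40) \<and> icell s' ''i'' 0 0 = int i \<and> ?I (Suc i) (set_var ''i'' (int (Suc i)) s'))"
      unfolding runs_Seq runs_IAssign using icell by (auto elim!: runs_mono)
  next
    fix i s1
    assume "?I i s1"
    then show "ival (var ''n'') s1 = int n" using frame_icell[of ?X "{}" s s1 "''n''"] n by simp
  qed (auto simp: frame_refl)
  then show ?thesis
  proof (rule runs_le)
    have "7 + (n + 1) * (60 + 40) \<le> 107 * (n + 1) ^ 1" by simp
    then show "(n + 1) * (7 + (n + 1) * (60 + 40) + 40) \<le> 300 * (n + 1) ^ 2"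
      by (rule loop_bound) auto
  next
    fix s' assume *: "?I n s' \<and> icell s' ''i'' 0 0 = int n"
    \<comment> \<open>The table read as a function. The mark -1 turns into 0 at noncritical nodes,
      where \<open>crit_succ\<close> demands nothing.\<close>
    define \<sigma> where "\<sigma> i = nat (icell s' ''sg'' (int i) 0)" for i
    have sg: "icell s' ''sg'' (int i) 0 = (if crit i then int (\<sigma> i) else -1) \<and> (crit i \<longrightarrow> edge i (\<sigma> i))"
      if "i < n" for i
    proof -
      have "last_edge i n (icell s' ''sg'' (int i) 0)" using * that by blast
      then consider "icell s' ''sg'' (int i) 0 = -1" "\<forall>j<n. \<not> edge i j"
        | j where "icell s' ''sg'' (int i) 0 = int j" "edge i j"
        by (auto simp: last_edge_def)
      then show ?thesis
      proof cases
        case 1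
        then have "\<not> crit i" using crit_edge_ex by (auto simp: edge_def)
        with 1 show ?thesis by simp
      next
        case 2
        then have "crit i" using crit_edge_ex that by blast
        with 2 show ?thesis by (simp add: \<sigma>_def)
      qed
    qed
    then have "crit_succ \<sigma>" unfolding crit_succ_def using crit_less by (auto simp: edge_def)
    with * sg show "frame ?X {} s s' \<and> (\<exists>\<sigma>. crit_succ \<sigma> \<and> succ_at \<sigma> s')"
      by (auto simp: succ_at_def)
  qed
qed

lemma runs_prepare:
  assumes n: "icell s ''n'' 0 0 = int n" and A: "stores s ''A'' a" and M: "n * n \<le> 2 ^ M"
  shows "runs (Seq Powers Successors) s (\<lambda>t s'. t \<le> 1600 * ((n + 1) ^ 3 * (M + 1)) \<and>
    frame {''i'', ''j'', ''h'', ''R'', ''sg''} {''P'', ''Q'', ''S'', ''U''} s s' \<and> (\<exists>\<sigma> R. prepared \<sigma> R s'))"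
proof -
  let ?Z = "{''i'', ''j'', ''h'', ''R'', ''sg''}" and ?W = "{''P'', ''Q'', ''S'', ''U''}"
  have "runs (Seq Powers Successors) s (\<lambda>t s'. t \<le> 1300 * ((n + 1) ^ 3 * (M + 1)) + 300 * (n + 1) ^ 2 \<and>
    frame ?Z ?W s s' \<and> (\<exists>\<sigma> R. prepared \<sigma> R s'))"
  proof (rule runs_Seq_le[OF runs_Powers[OF n A M]])
    fix s1
    assume s1: "frame {''i'', ''j'', ''h'', ''R''} ?W s s1 \<and> (\<exists>R. n * n \<le> R \<and> 1 \<le> R \<and> powers_at R s1)"
    then obtain R where R: "n * n \<le> R" "1 \<le> R" "powers_at R s1" by blast
    from s1 have f1': "frame {''i'', ''j'', ''h'', ''R''} ?W s s1" by blast
    have f1: "frame ?Z ?W s s1" by (rule frame_mono[OF f1']) auto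
    from R(3) have s1': "icell s1 ''n'' 0 0 = int n" "icell s1 ''R'' 0 0 = int R"
      "stores s1 ''A'' a" "stores s1 ''P'' (mpow R)" "stores s1 ''S'' (U.mpow R)"
      by (auto simp: powers_at_def)
    have "n \<le> n * n" by (cases n) auto
    with R have nR: "n \<le> R" by linarith
    show "runs Successors s1 (\<lambda>t s'. t \<le> 300 * (n + 1) ^ 2 \<and> frame ?Z ?W s s' \<and> (\<exists>\<sigma> R. prepared \<sigma> R s'))"
    proof (rule runs_le[OF runs_Successors[OF s1'(1,3,5) nR] order_refl])
      fix s2 assume s2: "frame {''i'', ''j'', ''sg''} {} s1 s2 \<and> (\<exists>\<sigma>. crit_succ \<sigma> \<and> succ_at \<sigma> s2)"
      then have f2: "frame {''i'', ''j'', ''sg''} {} s1 s2" by blast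
      from s2 obtain \<sigma> where \<sigma>: "crit_succ \<sigma>" "succ_at \<sigma> s2" by blast
      have "prepared \<sigma> R s2"
        using \<sigma> R(1) s1' frame_icell[OF f2] stores_frame[OF _ f2] by (simp add: prepared_def)
      moreover have "frame ?Z ?W s s2" by (rule frame_step[OF f1 f2]) auto
      ultimately show "frame ?Z ?W s s2 \<and> (\<exists>\<sigma> R. prepared \<sigma> R s2)" by blast
    qed
  qed
  then show ?thesis
  proof (rule runs_le)
    have "(n + 1) ^ 2 \<le> (n + 1) ^ 3" by (rule power_increasing) auto
    also have "\<dots> \<le> (n + 1) ^ 3 * (M + 1)" by simp
    finally show "1300 * ((n + 1) ^ 3 * (M + 1)) + 300 * (n + 1) ^ 2 \<le> 1600 * ((n + 1) ^ 3 * (M + 1))"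
      by linarith
  qed
qed

definition orbit_at :: "(nat \<Rightarrow> nat) \<Rightarrow> nat \<Rightarrow> nat \<Rightarrow> state \<Rightarrow> bool" where
  "orbit_at \<sigma> i m s \<longleftrightarrow> (\<forall>k<m. icell s ''cs'' (int k) 0 = int ((\<sigma> ^^ k) i) \<and>
     rcell s ''ws'' (int k) 0 = succ_weight \<sigma> i k)"

lemma orbit_at_frame: "orbit_at \<sigma> i m s \<Longrightarrow> frame X Y s s' \<Longrightarrow> ''cs'' \<notin> X \<Longrightarrow> ''ws'' \<notin> Y \<Longrightarrow> orbit_at \<sigma> i m s'"
  by (simp add: orbit_at_def frame_icell frame_rcell)

lemma runs_Orbit:
  assumes prep: "prepared \<sigma> R s" and i: "crit i" "icell s ''i'' 0 0 = int i"
  shows "runs Orbit s (\<lambda>t s'. t \<le> 200 * (n + 1) \<and> frame {''c'', ''s'', ''cs''} {''w'', ''ws''} s s' \<and>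
    orbit_at \<sigma> i (2 * n + 1) s')"
proof -
  let ?X = "{''c'', ''s'', ''cs''}" and ?Y = "{''w'', ''ws''}"
  let ?I = "\<lambda>m s'. frame ?X ?Y s s' \<and> icell s' ''c'' 0 0 = int ((\<sigma> ^^ m) i) \<and>
     rcell s' ''w'' 0 0 = succ_weight \<sigma> i m \<and> orbit_at \<sigma> i m s'"
  let ?s = "(set_var ''c'' (int i) s)\<lparr>rcell := upd (rcell s) ''w'' 0 0 1\<rparr>"
  from prep have n: "icell s ''n'' 0 0 = int n" and \<sigma>: "crit_succ \<sigma>" and A: "stores s ''A'' a"
    and sg: "succ_at \<sigma> s" by (auto simp: prepared_def)
  have "runs (For ''s'' (IAdd (var ''n'') (IAdd (var ''n'') (IConst 1))) Orbit_step) ?s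
    (\<lambda>t s'. t \<le> (2 * n + 1 + 1) * (50 + 40) \<and> ?I (2 * n + 1) s' \<and> icell s' ''s'' 0 0 = int (2 * n + 1))"
  proof (rule runs_For[where I = ?I])
    fix m s1
    assume I: "?I m s1" and m: "icell s1 ''s'' 0 0 = int m"
    then have f1: "frame ?X ?Y s s1" by blast
    let ?c = "(\<sigma> ^^ m) i"
    have c: "crit ?c" "?c < n" using crit_orbit[OF \<sigma> i(1)] crit_less by auto
    have c': "\<sigma> ?c < n" using \<sigma> c by (auto simp: crit_succ_def)
    have cells: "icell s1 ''sg'' (int ?c) 0 = int (\<sigma> ?c)" "rcell s1 ''A'' (int ?c) (int (\<sigma> ?c)) = a ?c (\<sigma> ?c)"
      using frame_icell[OF f1, of "''sg''"] frame_rcell[OF f1, of "''A''"] sg A c c'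
      by (auto simp: succ_at_def stores_def)
    have w: "succ_weight \<sigma> i (Suc m) = succ_weight \<sigma> i m * a ?c (\<sigma> ?c)"
      by (simp add: succ_weight_def)
    have c_Suc: "(\<sigma> ^^ Suc m) i = \<sigma> ?c" by simp
    show "runs Orbit_step s1 (\<lambda>t s'. t \<le> 50 \<and> icell s' ''s'' 0 0 = int m \<and> ?I (Suc m) (set_var ''s'' (int (Suc m)) s'))"
      using I m cells f1 unfolding w c_Suc Orbit_step_def
      by (simp del: of_nat_Suc funpow.simps) (auto simp: orbit_at_def less_Suc_eq simp del: funpow.simps)
  next
    fix m s1 assume "?I m s1"
    then show "ival (IAdd (var ''n'') (IAdd (var ''n'') (IConst 1))) s1 = int (2 * n + 1)"
      using frame_icell[of ?X ?Y s s1 "''n''"] n by simp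
  qed (auto simp: orbit_at_def succ_weight_def frame_refl)
  then show ?thesis
    unfolding Orbit_def runs_Seq runs_IAssign runs_RAssign
    using i(2) by (auto elim!: runs_mono)
qed

end

section \<open>Programs for periods, attraction cones and periodic powers\<close>

definition Test_period :: com where
  "Test_period = Seq (Let_var ''ok'' (IConst 1)) (For ''s'' (var ''n'')
     (If (REq (RMul (RCell ''ws'' (IAdd (var ''s'') (var ''e'')) (IConst 0))
                 (RCell ''y'' (ICell ''cs'' (IAdd (var ''s'') (var ''e'')) (IConst 0)) (IConst 0)))
              (RMul (RCell ''ws'' (var ''s'') (IConst 0))
                 (RCell ''y'' (ICell ''cs'' (var ''s'') (IConst 0)) (IConst 0))))
        Skip (Let_var ''ok'' (IConst 0))))"

definition Test_multiple :: com where
  "Test_multiple = If (IEq (IMod (IMul (var ''out'') (var ''e'')) (var ''p'')) (IConst 0))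
     (Let_var ''ok'' (IConst 1)) (Let_var ''ok'' (IConst 0))"

text \<open>The lcm is formed with the least cofactor, which is at most \<open>p \<le> n\<close>.
  Its linear search takes time linear in \<open>n\<close>, however large \<open>out\<close> has
  become.\<close>

definition Lcm_orbit_period :: com where
  "Lcm_orbit_period = Seq Orbit (Seq (Search ''p'' (var ''n'') Test_period)
     (Seq (Search ''m'' (var ''p'') Test_multiple) (Let_var ''out'' (IMul (var ''out'') (var ''m'')))))"

text \<open>A vector sits in column 0 of its array, so the matrix product also serves for vectors.
  The other columns of \<open>x\<close> contain arbitrary values, and only column 0 of
  \<open>y\<close> is read afterwards.\<close>

definition Period :: com where
  "Period = Seq (Seq Powers Successors) (Seq (Mult ''y'' ''P'' ''x'') (Seq (Let_var ''out'' (IConst 1))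
     (For ''i'' (var ''n'') (If (ILess (IConst (-1)) (ICell ''sg'' (var ''i'') (IConst 0)))
        Lcm_orbit_period Skip))))"

definition Attraction :: com where
  "Attraction = Seq Period (If (IEq (IMod (var ''t'') (var ''out'')) (IConst 0))
     (Let_var ''out'' (IConst 1)) (Let_var ''out'' (IConst 0)))"

text \<open>The comparison starts at position \<open>n\<close> because by then the orbit has entered
  its cycle.\<close>

definition Test_cycle :: com where
  "Test_cycle = If (IEq (ICell ''cs'' (IAdd (var ''n'') (var ''e'')) (IConst 0)) (ICell ''cs'' (var ''n'') (IConst 0)))
     (Let_var ''ok'' (IConst 1)) (Let_var ''ok'' (IConst 0))"

definition Fill_row :: "rexp \<Rightarrow> com" where
  "Fill_row e = For ''j'' (var ''n'') (put ''B'' ''i'' ''j'' e)"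

text \<open>The remainder is taken modulo a positive number, so it lies in \<open>0..<p\<close> even
  when \<open>k < 2 * R\<close>.\<close>

definition Shifted_row :: com where
  "Shifted_row = Seq Orbit (Seq (Search ''p'' (var ''n'') Test_cycle)
     (Seq (Let_var ''s'' (IMod (ISub (var ''k'') (IMul (IConst 2) (var ''R''))) (var ''p'')))
       (Fill_row (RMul (RCell ''ws'' (var ''s'') (IConst 0))
          (RCell ''P'' (ICell ''cs'' (var ''s'') (IConst 0)) (var ''j''))))))"

definition Periodic_power :: com where
  "Periodic_power = Seq (Seq Powers Successors) (Seq
     (For ''i'' (var ''n'') (If (ILess (IConst (-1)) (ICell ''sg'' (var ''i'') (IConst 0)))
        Shifted_row (Fill_row (RConst 0))))
     (Mult ''out'' ''P'' ''B''))"

text \<open>The condition \<open>p dvd d * e\<close> makes \<open>d * e\<close> a common multiple,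
  so every such \<open>e\<close> is a multiple of the cofactor of the lcm.\<close>

lemma least_cofactor_lcm:
  fixes d p :: nat
  assumes "1 \<le> d" "1 \<le> p"
  shows "d * (LEAST e. 1 \<le> e \<and> p dvd d * e) = lcm d p"
proof -
  obtain k where k: "lcm d p = d * k" by (metis dvd_def dvd_lcm1)
  have "(LEAST e. 1 \<le> e \<and> p dvd d * e) = k"
  proof (rule Least_equality)
    have "lcm d p \<noteq> 0" using assms by (simp add: lcm_eq_0_iff)
    then show "1 \<le> k \<and> p dvd d * k" using k by (metis dvd_lcm2 less_one mult_0_right not_less)
    show "k \<le> e" if "1 \<le> e \<and> p dvd d * e" for e
    proof -
      have "d * k dvd d * e" using that k by (metis dvd_triv_left lcm_least)
      then show ?thesis using assms that by (auto dest!: dvd_imp_le)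
    qed
  qed
  then show ?thesis using k by simp
qed

section \<open>Correctness of the main programs\<close>

context irreducible_definite_matrix
begin

definition column_at :: "string \<Rightarrow> (nat \<Rightarrow> real) \<Rightarrow> state \<Rightarrow> bool" where
  "column_at v y s \<longleftrightarrow> (\<forall>k<n. rcell s v (int k) 0 = y k)"

lemma runs_Test_period:
  assumes n: "icell s ''n'' 0 0 = int n" and e: "icell s ''e'' 0 0 = int e" "e \<le> n"
    and orbit: "orbit_at \<sigma> i (2 * n + 1) s" "crit_succ \<sigma>" "crit i" and y: "column_at ''y'' y s"
  shows "runs Test_period s (\<lambda>t s'. t \<le> 100 * (n + 1) \<and> frame {''ok'', ''s''} {} s s' \<and>
    icell s' ''ok'' 0 0 = (if \<forall>k<n. orbit_val \<sigma> y i (k + e) = orbit_val \<sigma> y i k then 1 else 0))"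
proof -
  let ?X = "{''ok'', ''s''}"
  let ?P = "\<lambda>k. orbit_val \<sigma> y i (k + e) = orbit_val \<sigma> y i k"
  let ?b = "REq (RMul (RCell ''ws'' (IAdd (var ''s'') (var ''e'')) (IConst 0))
                 (RCell ''y'' (ICell ''cs'' (IAdd (var ''s'') (var ''e'')) (IConst 0)) (IConst 0)))
              (RMul (RCell ''ws'' (var ''s'') (IConst 0))
                 (RCell ''y'' (ICell ''cs'' (var ''s'') (IConst 0)) (IConst 0)))"
  let ?test = "If ?b Skip (Let_var ''ok'' (IConst 0))"
  let ?I = "\<lambda>m s'. frame ?X {} s s' \<and> icell s' ''ok'' 0 0 = (if \<forall>k<m. ?P k then 1 else 0)"
  have "runs (For ''s'' (var ''n'') ?test) (set_var ''ok'' 1 s)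
    (\<lambda>t s'. t \<le> (n + 1) * (45 + 40) \<and> ?I n s' \<and> icell s' ''s'' 0 0 = int n)"
  proof (rule runs_For[where I = ?I])
    fix m s1
    assume m: "m < n" and I: "?I m s1" and s: "icell s1 ''s'' 0 0 = int m"
    from I have f1: "frame ?X {} s s1" by blast
    have e1: "icell s1 ''e'' 0 0 = int e" using frame_icell[OF f1, of "''e''"] e by simp
    have val: "rcell s1 ''ws'' (int k) 0 * rcell s1 ''y'' (icell s1 ''cs'' (int k) 0) 0 = orbit_val \<sigma> y i k"
      if "k \<le> 2 * n" for k
    proof -
      have "(\<sigma> ^^ k) i < n" using crit_orbit crit_less orbit by blast
      then show ?thesis
        using orbit_at_frame[OF orbit(1) f1] frame_rcell[OF f1, of "''y''"] y that
        by (simp add: orbit_at_def orbit_val_def column_at_def)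
    qed
    have P: "bval ?b s1 \<longleftrightarrow> ?P m"
      using val[of "m + e"] val[of m] m e s e1 by simp
    have Suc: "(\<forall>k<Suc m. ?P k) \<longleftrightarrow> (\<forall>k<m. ?P k) \<and> ?P m" by (auto simp: less_Suc_eq)
    show "runs ?test s1 (\<lambda>t s'. t \<le> 45 \<and> icell s' ''s'' 0 0 = int m \<and> ?I (Suc m) (set_var ''s'' (int (Suc m)) s'))"
      unfolding runs_If P Suc using I s by (cases "?P m") (simp_all del: of_nat_Suc)
  next
    fix m s1 assume "?I m s1"
    then show "ival (var ''n'') s1 = int n" using frame_icell[of ?X "{}" s s1 "''n''"] n by simp
  qed (auto simp: frame_refl)
  then show ?thesis
    unfolding Test_period_def runs_Seq runs_IAssign by (auto elim!: runs_mono)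
qed

text \<open>The quadratic time is that of testing up to \<open>n\<close> candidates at
  \<open>n\<close> positions each; over all critical nodes this stays cubic.\<close>

lemma runs_Lcm_orbit_period:
  assumes prep: "prepared \<sigma> R s" and i: "crit i" "icell s ''i'' 0 0 = int i"
    and y: "column_at ''y'' (mvec R x) s" and d: "icell s ''out'' 0 0 = int d" "1 \<le> d"
  defines "X \<equiv> {''c'', ''s'', ''cs'', ''p'', ''q'', ''e'', ''ok'', ''m'', ''out''}" and "Y \<equiv> {''w'', ''ws''}"
  shows "runs Lcm_orbit_period s (\<lambda>t s'. t \<le> 700 * (n + 1) ^ 2 \<and> frame X Y s s' \<and>
    icell s' ''out'' 0 0 = int (lcm d (orbit_period \<sigma> (mvec R x) i)))"
proof -
  from prep have \<sigma>: "crit_succ \<sigma>" and R: "n * n \<le> R" and n: "icell s ''n'' 0 0 = int n"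
    by (auto simp: prepared_def)
  let ?z = "orbit_val \<sigma> (mvec R x) i"
  let ?p = "orbit_period \<sigma> (mvec R x) i"
  note p = orbit_period[OF \<sigma> i(1) R, where x = x]
  let ?X1 = "{''p'', ''q'', ''e'', ''ok'', ''s''}" and ?X2 = "{''m'', ''q'', ''e'', ''ok''}"
  have "runs Lcm_orbit_period s (\<lambda>t s'. t \<le> 200 * (n + 1) + ((n + 1) * (100 * (n + 1) + 100) + ((n + 1) * (50 + 100) + 20)) \<and>
    frame X Y s s' \<and> icell s' ''out'' 0 0 = int (lcm d ?p))"
    unfolding Lcm_orbit_period_def
  proof (rule runs_Seq_le[OF runs_Orbit[OF prep i]], goal_cases)
    case s1: (1 s1)
    then have f1': "frame {''c'', ''s'', ''cs''} {''w'', ''ws''} s s1" by blast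
    have f1: "frame X Y s s1" by (rule frame_mono[OF f1']) (auto simp: X_def Y_def)
    have n1: "icell s1 ''n'' 0 0 = int n" using frame_icell[OF f1', of "''n''"] n by simp
    have y1: "column_at ''y'' (mvec R x) s1" using frame_rcell[OF f1', of "''y''"] y by (simp add: column_at_def)
    have d1: "icell s1 ''out'' 0 0 = int d" using frame_icell[OF f1', of "''out''"] d by simp
    have search1: "runs (Search ''p'' (var ''n'') Test_period) s1
      (\<lambda>t s'. t \<le> (n + 1) * (100 * (n + 1) + 100) \<and> frame ?X1 {} s1 s' \<and> icell s' ''p'' 0 0 = int ?p)"
    proof -
      from p(4) obtain q where q: "1 \<le> q" "q \<le> n"
        "\<forall>k<n. ?z (k + q) = ?z k" by blast
      show ?thesis
        unfolding orbit_period_def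
      proof (rule runs_Search[where P = "\<lambda>p. \<forall>k<n. ?z (k + p) = ?z k" and p = q])
        fix s' e
        assume e: "e \<le> n" "icell s' ''e'' 0 0 = int e" and f: "frame ?X1 {} s1 s'"
        have n': "icell s' ''n'' 0 0 = int n" using frame_icell[OF f, of "''n''"] n1 by simp
        have o': "orbit_at \<sigma> i (2 * n + 1) s'" by (rule orbit_at_frame[OF conjunct2[OF s1] f]) auto
        have y': "column_at ''y'' (mvec R x) s'" using frame_rcell[OF f, of "''y''"] y1 by (simp add: column_at_def)
        show "runs Test_period s' (\<lambda>t s''. t \<le> 100 * (n + 1) \<and> frame (?X1 - {''p'', ''q'', ''e''}) {} s' s'' \<and>
          (icell s'' ''ok'' 0 0 = (if \<forall>k<n. ?z (k + e) = ?z k then 1 else 0)))"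
          by (rule runs_le[OF runs_Test_period[OF n' e(2,1) o' \<sigma> i(1) y']])
            (auto elim: frame_mono)
      next
        fix s' assume "frame ?X1 {} s1 s'"
        then show "ival (var ''n'') s' = int n" using frame_icell[of ?X1 "{}" s1 s' "''n''"] n1 by simp
      qed (use q in auto)
    qed
    show ?case
    proof (rule runs_Seq_le[OF search1], goal_cases)
      case s2: (1 s2)
      then have f2': "frame ?X1 {} s1 s2" by blast
      have f2: "frame X Y s s2" by (rule frame_step[OF f1 f2']) (auto simp: X_def)
      have d2: "icell s2 ''out'' 0 0 = int d" using frame_icell[OF f2', of "''out''"] d1 by simp
      have search2: "runs (Search ''m'' (var ''p'') Test_multiple) s2
        (\<lambda>t s'. t \<le> (?p + 1) * (50 + 100) \<and> frame ?X2 {} s2 s' \<and>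
          icell s' ''m'' 0 0 = int (LEAST e. 1 \<le> e \<and> ?p dvd d * e))"
      proof (rule runs_Search[where p = ?p])
        fix s' e
        assume e: "icell s' ''e'' 0 0 = int e" and f: "frame ?X2 {} s2 s'"
        have c: "icell s' ''out'' 0 0 = int d" "icell s' ''p'' 0 0 = int ?p"
          using frame_icell[OF f, of "''out''"] frame_icell[OF f, of "''p''"] d2 s2 by auto
        have "(int d * int e) mod int ?p = 0 \<longleftrightarrow> ?p dvd d * e"
          by (metis mod_0_imp_dvd dvd_imp_mod_0 of_nat_dvd_iff of_nat_mult)
        then show "runs Test_multiple s' (\<lambda>t s''. t \<le> 50 \<and> frame (?X2 - {''m'', ''q'', ''e''}) {} s' s'' \<and>
          (icell s'' ''ok'' 0 0 = (if ?p dvd d * e then 1 else 0)))"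
          using c e by (auto simp: Test_multiple_def frame_refl simp del: of_nat_mult)
      next
        fix s' assume "frame ?X2 {} s2 s'"
        then show "ival (var ''p'') s' = int ?p" using frame_icell[of ?X2 "{}" s2 s' "''p''"] s2 by simp
      qed (use p in auto)
      show ?case
      proof (rule runs_Seq_le[OF runs_le[OF search2]])
        show "(?p + 1) * (50 + 100) \<le> (n + 1) * (50 + 100)" using p(2) by simp
      next
        fix s3
        assume s3: "frame ?X2 {} s2 s3 \<and> icell s3 ''m'' 0 0 = int (LEAST e. 1 \<le> e \<and> ?p dvd d * e)"
        then have f3': "frame ?X2 {} s2 s3" by blast
        have f3: "frame X Y s s3" by (rule frame_step[OF f2 f3']) (auto simp: X_def)
        have "icell s3 ''out'' 0 0 = int d" using frame_icell[OF f3', of "''out''"] d2 by simp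
        then have "icell s3 ''out'' 0 0 * icell s3 ''m'' 0 0 = int (d * (LEAST e. 1 \<le> e \<and> ?p dvd d * e))"
          using s3 by simp
        then have "icell s3 ''out'' 0 0 * icell s3 ''m'' 0 0 = int (lcm d ?p)"
          unfolding least_cofactor_lcm[OF d(2) p(1)] .
        moreover have "''out'' \<in> X" by (simp add: X_def)
        ultimately show "runs (Let_var ''out'' (IMul (var ''out'') (var ''m''))) s3
          (\<lambda>t s'. t \<le> 20 \<and> frame X Y s s' \<and> icell s' ''out'' 0 0 = int (lcm d ?p))"
          using f3 by simp
      qed
    qed
  qed
  then show ?thesis
  proof (rule runs_le)
    let ?m = "n + 1"
    have bound: "200 * m + (m * (100 * m + 100) + (m * (50 + 100) + 20)) \<le> 700 * m ^ 2" if "1 \<le> m" for m :: nat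
    proof -
      have "m \<le> m * m" using that by (cases m) auto
      moreover have "1 \<le> m * m" using that by (cases m) auto
      ultimately have "100 * (m * m) + 450 * m + 20 \<le> 700 * (m * m)" by linarith
      then show ?thesis by (simp add: power2_eq_square algebra_simps)
    qed
    show "200 * ?m + (?m * (100 * ?m + 100) + (?m * (50 + 100) + 20)) \<le> 700 * ?m ^ 2"
      by (rule bound) simp
  qed
qed

lemma n_pos: "0 < n"
  using crit_exists crit_less by fastforce

text \<open>\<open>D\<close> is specified by which \<alpha> it divides, not as an lcm over a set, so
  \<open>lcm_least_iff\<close> extends the loop invariant by one node. Divisibility also is the form
  in which both the cone test and the ultimate period use it. The clause on \<open>t\<close>
  preserves the input of the cone test.\<close>

lemma runs_Period:
  assumes n: "icell s ''n'' 0 0 = int n" and A: "stores s ''A'' a" and M: "n * n \<le> 2 ^ M"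
    and x: "column_at ''x'' x s" "\<And>k. k < n \<Longrightarrow> 0 \<le> x k"
  shows "runs Period s (\<lambda>t s'. t \<le> 2800 * ((n + 1) ^ 3 * (M + 1)) \<and>
    icell s' ''t'' = icell s ''t'' \<and>
    (\<exists>D. icell s' ''out'' 0 0 = int D \<and> 1 \<le> D \<and>
      (\<forall>\<alpha>. D dvd \<alpha> \<longleftrightarrow> (\<forall>\<^sub>F r in sequentially. \<forall>i<n. mvec (r + \<alpha>) x i = mvec r x i))))"
proof -
  let ?V = "{''i'', ''j'', ''h'', ''R'', ''sg''}" and ?W = "{''P'', ''Q'', ''S'', ''U''}"
  let ?X = "{''c'', ''s'', ''cs'', ''p'', ''q'', ''e'', ''ok'', ''m'', ''out''}" and ?Y = "{''w'', ''ws''}"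
  let ?post = "\<lambda>s'. icell s' ''t'' = icell s ''t'' \<and>
    (\<exists>D. icell s' ''out'' 0 0 = int D \<and> 1 \<le> D \<and>
      (\<forall>\<alpha>. D dvd \<alpha> \<longleftrightarrow> (\<forall>\<^sub>F r in sequentially. \<forall>i<n. mvec (r + \<alpha>) x i = mvec r x i)))"
  let ?body = "If (ILess (IConst (-1)) (ICell ''sg'' (var ''i'') (IConst 0))) Lcm_orbit_period Skip"
  have "runs Period s (\<lambda>t s'. t \<le> 1600 * ((n + 1) ^ 3 * (M + 1)) + (300 * (n + 1) ^ 3 + (20 + (n + 1) * (20 + 700 * (n + 1) ^ 2 + 40))) \<and> ?post s')"
    unfolding Period_def
  proof (rule runs_Seq_le[OF runs_prepare[OF n A M]], goal_cases)
    case (1 s1)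
    note s1 = this
    then have f1: "frame ?V ?W s s1" by blast
    from s1 obtain \<sigma> R where prep1: "prepared \<sigma> R s1" by blast
    then have \<sigma>: "crit_succ \<sigma>" and R: "n * n \<le> R" and n1: "icell s1 ''n'' 0 0 = int n"
      and P1: "stores s1 ''P'' (mpow R)" by (auto simp: prepared_def)
    have x1: "column_at ''x'' x s1" using frame_rcell[OF f1, of "''x''"] x(1) by (simp add: column_at_def)
    show ?case
    proof (rule runs_Seq_le[OF runs_Mult[OF n1]], goal_cases)
      case s2: (3 s2)
      then have f2: "frame {''i'', ''j'', ''h''} {''y''} s1 s2" by blast
      have prep2: "prepared \<sigma> R s2" by (rule prepared_frame[OF prep1 f2]) auto
      have y2: "column_at ''y'' (mvec R x) s2"
        unfolding column_at_def
      proof (intro allI impI)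
        fix k assume k: "k < n"
        from s2 have "\<forall>i<n. \<forall>j<n. rcell s2 ''y'' (int i) (int j) =
          osum (\<lambda>k. rcell s1 ''P'' (int i) (int k) * rcell s1 ''x'' (int k) (int j)) {..<n}" by blast
        \<comment> \<open>Column 0 is within the range of the product because \<open>n\<close> is
          positive.\<close>
        from this[rule_format, OF k n_pos] show "rcell s2 ''y'' (int k) 0 = mvec R x k"
          using P1 x1 k by (auto simp: mvec_def stores_def column_at_def intro!: osum_cong)
      qed
      let ?I = "\<lambda>i s'. prepared \<sigma> R s' \<and> column_at ''y'' (mvec R x) s' \<and> icell s' ''t'' = icell s ''t'' \<and>
        (\<exists>D. icell s' ''out'' 0 0 = int D \<and> 1 \<le> D \<and>
          (\<forall>\<alpha>. D dvd \<alpha> \<longleftrightarrow> (\<forall>k<i. crit k \<longrightarrow> orbit_period \<sigma> (mvec R x) k dvd \<alpha>)))"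
      have I_set_i: "?I i (set_var ''i'' v s') \<longleftrightarrow> ?I i s'" for i v s'
        by (simp add: prepared_def column_at_def stores_def succ_at_def)
      let ?s = "set_var ''out'' 1 s2"
      have "runs (For ''i'' (var ''n'') ?body) ?s (\<lambda>t s'. t \<le> (n + 1) * (20 + 700 * (n + 1) ^ 2 + 40) \<and>
        ?I n s' \<and> icell s' ''i'' 0 0 = int n)"
      proof (rule runs_For[where I = ?I])
        have "icell s2 ''t'' = icell s ''t''"
          using frame_icell[OF f1, of "''t''"] frame_icell[OF f2, of "''t''"] by simp
        then have "?I 0 ?s"
          using prep2 y2
          by (auto simp: prepared_def column_at_def stores_def succ_at_def intro!: exI[of _ 1])
        then show "?I 0 (set_var ''i'' 0 ?s)" unfolding I_set_i .
      next
        fix i s3 assume "?I i s3"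
        then show "ival (var ''n'') s3 = int n" by (simp add: prepared_def)
      next
        fix i s3
        assume i: "i < n" and I: "?I i s3" and icell: "icell s3 ''i'' 0 0 = int i"
        from I have prep3: "prepared \<sigma> R s3" and y3: "column_at ''y'' (mvec R x) s3" by blast+
        from I obtain D where D: "icell s3 ''out'' 0 0 = int D" "1 \<le> D"
          "\<And>\<alpha>. D dvd \<alpha> \<longleftrightarrow> (\<forall>k<i. crit k \<longrightarrow> orbit_period \<sigma> (mvec R x) k dvd \<alpha>)" by blast
        have sg: "icell s3 ''sg'' (int i) 0 = (if crit i then int (\<sigma> i) else -1)"
          using prep3 i by (simp add: prepared_def succ_at_def)
        show "runs ?body s3 (\<lambda>t s'. t \<le> 20 + 700 * (n + 1) ^ 2 \<and> icell s' ''i'' 0 0 = int i \<and>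
          ?I (Suc i) (set_var ''i'' (int (Suc i)) s'))"
          unfolding I_set_i
        proof (cases "crit i")
          case True
          have "runs Lcm_orbit_period s3 (\<lambda>t s'. 9 + t \<le> 20 + 700 * (n + 1) ^ 2 \<and> icell s' ''i'' 0 0 = int i \<and> ?I (Suc i) s')"
          proof (rule runs_mono[OF runs_Lcm_orbit_period[OF prep3 True icell y3 D(1,2)]])
            fix t s4
            assume s4: "t \<le> 700 * (n + 1) ^ 2 \<and> frame ?X ?Y s3 s4 \<and>
              icell s4 ''out'' 0 0 = int (lcm D (orbit_period \<sigma> (mvec R x) i))"
            then have f4: "frame ?X ?Y s3 s4" by blast
            have "prepared \<sigma> R s4" by (rule prepared_frame[OF prep3 f4]) auto
            moreover have "column_at ''y'' (mvec R x) s4" "icell s4 ''t'' = icell s ''t''" "icell s4 ''i'' 0 0 = int i"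
              using frame_rcell[OF f4, of "''y''"] frame_icell[OF f4, of "''t''"] frame_icell[OF f4, of "''i''"]
                y3 I icell by (auto simp: column_at_def)
            moreover have "1 \<le> lcm D (orbit_period \<sigma> (mvec R x) i)"
              using D(2) orbit_period(1)[OF \<sigma> True R, of x] by (metis lcm_eq_0_iff less_one not_less)
            moreover have "lcm D (orbit_period \<sigma> (mvec R x) i) dvd \<alpha> \<longleftrightarrow>
                (\<forall>k<Suc i. crit k \<longrightarrow> orbit_period \<sigma> (mvec R x) k dvd \<alpha>)" for \<alpha>
              unfolding lcm_least_iff D(3) using True by (auto simp: less_Suc_eq)
            ultimately show "9 + t \<le> 20 + 700 * (n + 1) ^ 2 \<and> icell s4 ''i'' 0 0 = int i \<and> ?I (Suc i) s4"
              using s4 by auto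
          qed
          then show "runs ?body s3 (\<lambda>t s'. t \<le> 20 + 700 * (n + 1) ^ 2 \<and> icell s' ''i'' 0 0 = int i \<and> ?I (Suc i) s')"
            using sg True icell by (auto elim!: runs_mono)
        next
          case False
          then have "(\<forall>k<Suc i. crit k \<longrightarrow> orbit_period \<sigma> (mvec R x) k dvd \<alpha>) \<longleftrightarrow>
            (\<forall>k<i. crit k \<longrightarrow> orbit_period \<sigma> (mvec R x) k dvd \<alpha>)" for \<alpha> by (auto simp: less_Suc_eq)
          then show "runs ?body s3 (\<lambda>t s'. t \<le> 20 + 700 * (n + 1) ^ 2 \<and> icell s' ''i'' 0 0 = int i \<and> ?I (Suc i) s')"
            using sg False icell I by simp
        qed
      qed simp
      then have "runs (For ''i'' (var ''n'') ?body) ?s (\<lambda>t s'. 4 + t \<le> 20 + (n + 1) * (20 + 700 * (n + 1) ^ 2 + 40) \<and> ?post s')"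
      proof (rule runs_mono)
        fix t s'
        assume *: "t \<le> (n + 1) * (20 + 700 * (n + 1) ^ 2 + 40) \<and> ?I n s' \<and> icell s' ''i'' 0 0 = int n"
        have "(\<forall>k<n. crit k \<longrightarrow> orbit_period \<sigma> (mvec R x) k dvd \<alpha>) \<longleftrightarrow>
            (\<forall>\<^sub>F r in sequentially. \<forall>i<n. mvec (r + \<alpha>) x i = mvec r x i)" for \<alpha>
          using eventual_period_iff[where \<sigma> = \<sigma> and R = R and x = x and \<alpha> = \<alpha>] \<sigma> R x(2) crit_less
          by blast
        with * show "4 + t \<le> 20 + (n + 1) * (20 + 700 * (n + 1) ^ 2 + 40) \<and> ?post s'" by auto
      qed
      then show ?case by simp
    qed simp_all
  qed
  then show ?thesis
  proof (rule runs_le)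
    let ?m = "(n + 1) ^ 3"
    have "20 + 700 * (n + 1) ^ 2 \<le> 20 * (n + 1) ^ 2 + 700 * (n + 1) ^ 2" by (intro add_right_mono) simp
    then have "20 + 700 * (n + 1) ^ 2 \<le> 720 * (n + 1) ^ 2" by linarith
    then have "(n + 1) * (20 + 700 * (n + 1) ^ 2 + 40) \<le> 800 * ?m"
      by (rule loop_bound) auto
    moreover have "1 \<le> ?m" by (rule one_le_power) simp
    moreover have "?m \<le> ?m * (M + 1)" by simp
    ultimately show "1600 * (?m * (M + 1)) + (300 * ?m + (20 + (n + 1) * (20 + 700 * (n + 1) ^ 2 + 40)))
      \<le> 2800 * (?m * (M + 1))" by linarith
  qed
qed

lemma orbit_returns:
  assumes "crit_succ \<sigma>" "crit i"
  shows "\<exists>l. 1 \<le> l \<and> l \<le> n \<and> (\<sigma> ^^ (n + l)) i = (\<sigma> ^^ n) i"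
proof -
  have "\<not> inj_on (\<lambda>k. (\<sigma> ^^ k) i) {..n}"
  proof
    assume "inj_on (\<lambda>k. (\<sigma> ^^ k) i) {..n}"
    then have "card {..n} \<le> card {..<n}"
      using crit_less[OF crit_orbit[OF assms]] by (intro card_inj_on_le) auto
    then show False by simp
  qed
  then obtain p q where pq: "p < q" "q \<le> n" "(\<sigma> ^^ p) i = (\<sigma> ^^ q) i"
    unfolding inj_on_def by (metis atMost_iff linorder_neqE_nat)
  \<comment> \<open>The repetition found at times \<open>p < q \<le> n\<close> is moved by
    \<open>n - p\<close>, so that it starts at time \<open>n\<close>.\<close>
  have "(\<sigma> ^^ (n - p + p)) i = (\<sigma> ^^ (n - p + q)) i"
    using pq by (simp only: funpow_add comp_apply)
  then show ?thesis using pq by (intro exI[of _ "q - p"]) auto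
qed

text \<open>The length of the cycle on which the orbit of \<open>i\<close> ends. It is a period of
  row \<open>i\<close>, but need not be the least one.\<close>

definition cycle_length :: "(nat \<Rightarrow> nat) \<Rightarrow> nat \<Rightarrow> nat" where
  "cycle_length \<sigma> i = (LEAST l. 1 \<le> l \<and> (\<sigma> ^^ (n + l)) i = (\<sigma> ^^ n) i)"

lemma cycle_length:
  assumes "crit_succ \<sigma>" "crit i"
  shows "1 \<le> cycle_length \<sigma> i" "cycle_length \<sigma> i \<le> n" "(\<sigma> ^^ (n + cycle_length \<sigma> i)) i = (\<sigma> ^^ n) i"
proof -
  from orbit_returns[OF assms] obtain l where
    l: "1 \<le> l" "l \<le> n" "(\<sigma> ^^ (n + l)) i = (\<sigma> ^^ n) i" by blast
  let ?P = "\<lambda>l. 1 \<le> l \<and> (\<sigma> ^^ (n + l)) i = (\<sigma> ^^ n) i"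
  have "?P l" using l by blast
  from LeastI[of ?P, OF this]
  have "1 \<le> cycle_length \<sigma> i \<and> (\<sigma> ^^ (n + cycle_length \<sigma> i)) i = (\<sigma> ^^ n) i"
    unfolding cycle_length_def .
  then show "1 \<le> cycle_length \<sigma> i" "(\<sigma> ^^ (n + cycle_length \<sigma> i)) i = (\<sigma> ^^ n) i" by auto
  have "cycle_length \<sigma> i \<le> l"
    unfolding cycle_length_def by (rule Least_le[of ?P]) (fact \<open>?P l\<close>)
  then show "cycle_length \<sigma> i \<le> n" using l by simp
qed

text \<open>
  Row \<open>c\<close> is needed at a time congruent to \<open>k - R\<close>, because the final product with \<open>A\<^sup>R\<close> adds \<open>R\<close>;
  counted from time \<open>R\<close> this is \<open>k - 2R\<close>.
\<close>

definition shift :: "(nat \<Rightarrow> nat) \<Rightarrow> nat \<Rightarrow> nat \<Rightarrow> nat \<Rightarrow> nat" where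
  "shift \<sigma> R k c = nat ((int k - 2 * int R) mod int (cycle_length \<sigma> c))"

text \<open>Noncritical rows are 0, which is neutral for \<open>max\<close>, so the full product
  with \<open>mpow R\<close> is a maximum over critical nodes.\<close>

definition shifted_row :: "(nat \<Rightarrow> nat) \<Rightarrow> nat \<Rightarrow> nat \<Rightarrow> nat \<Rightarrow> nat \<Rightarrow> real" where
  "shifted_row \<sigma> R k c j = (if crit c
     then succ_weight \<sigma> c (shift \<sigma> R k c) * mpow R ((\<sigma> ^^ shift \<sigma> R k c) c) j else 0)"

text \<open>A frame speaks of whole arrays; the last clause adds that the other rows of
  \<open>B\<close> survive.\<close>

lemma runs_Fill_row:
  assumes n: "icell s ''n'' 0 0 = int n" and i: "icell s ''i'' 0 0 = int i"
    and e: "rcost e \<le> 40"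
      "\<And>s' j. j < n \<Longrightarrow> frame {''j''} {''B''} s s' \<Longrightarrow> icell s' ''j'' 0 0 = int j \<Longrightarrow> rval e s' = g j"
  shows "runs (Fill_row e) s (\<lambda>t s'. t \<le> 100 * (n + 1) \<and> frame {''j''} {''B''} s s' \<and>
    (\<forall>j<n. rcell s' ''B'' (int i) (int j) = g j) \<and>
    (\<forall>k l. k \<noteq> int i \<longrightarrow> rcell s' ''B'' k l = rcell s ''B'' k l))"
proof -
  let ?I = "\<lambda>m s'. frame {''j''} {''B''} s s' \<and> (\<forall>j<m. rcell s' ''B'' (int i) (int j) = g j) \<and>
    (\<forall>k l. k \<noteq> int i \<longrightarrow> rcell s' ''B'' k l = rcell s ''B'' k l)"
  have "runs (For ''j'' (var ''n'') (put ''B'' ''i'' ''j'' e)) s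
    (\<lambda>t s'. t \<le> (n + 1) * (50 + 40) \<and> ?I n s' \<and> icell s' ''j'' 0 0 = int n)"
  proof (rule runs_For[where I = ?I])
    fix m s1
    assume m: "m < n" and I: "?I m s1" and j: "icell s1 ''j'' 0 0 = int m"
    from I have f1: "frame {''j''} {''B''} s s1" by blast
    have i1: "icell s1 ''i'' 0 0 = int i" using frame_icell[OF f1, of "''i''"] i by simp
    show "runs (put ''B'' ''i'' ''j'' e) s1 (\<lambda>t s'. t \<le> 50 \<and> icell s' ''j'' 0 0 = int m \<and>
      ?I (Suc m) (set_var ''j'' (int (Suc m)) s'))"
      using I i1 j e(1) e(2)[OF m f1 j] f1 by (auto simp: less_Suc_eq simp del: of_nat_Suc)
  next
    fix m s1 assume "?I m s1"
    then show "ival (var ''n'') s1 = int n" using frame_icell[of "{''j''}" "{''B''}" s s1 "''n''"] n by simp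
  qed (auto simp: frame_refl)
  then show ?thesis unfolding Fill_row_def by (rule runs_le) auto
qed

lemma runs_Shifted_row:
  assumes prep: "prepared \<sigma> R s" and i: "crit i" "icell s ''i'' 0 0 = int i"
    and k: "icell s ''k'' 0 0 = int k"
  defines "X \<equiv> {''c'', ''s'', ''cs'', ''p'', ''q'', ''e'', ''ok'', ''j''}" and "Y \<equiv> {''w'', ''ws'', ''B''}"
  shows "runs Shifted_row s (\<lambda>t s'. t \<le> 600 * (n + 1) \<and> frame X Y s s' \<and>
    (\<forall>j<n. rcell s' ''B'' (int i) (int j) = shifted_row \<sigma> R k i j) \<and>
    (\<forall>k l. k \<noteq> int i \<longrightarrow> rcell s' ''B'' k l = rcell s ''B'' k l))"
proof -
  from prep have \<sigma>: "crit_succ \<sigma>" and R: "icell s ''R'' 0 0 = int R" and n: "icell s ''n'' 0 0 = int n"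
    and P: "stores s ''P'' (mpow R)"
    by (auto simp: prepared_def)
  let ?l = "cycle_length \<sigma> i" and ?t = "shift \<sigma> R k i"
  note l = cycle_length[OF \<sigma> i(1)]
  have "0 \<le> (int k - 2 * int R) mod int ?l" "(int k - 2 * int R) mod int ?l < int ?l"
    using l(1) by simp_all
  then have t: "int ?t = (int k - 2 * int R) mod int ?l" "?t < ?l"
    unfolding shift_def by (simp_all add: nat_less_iff)
  let ?X1 = "{''p'', ''q'', ''e'', ''ok''}"
  let ?e = "RMul (RCell ''ws'' (var ''s'') (IConst 0)) (RCell ''P'' (ICell ''cs'' (var ''s'') (IConst 0)) (var ''j''))"
  let ?set = "Let_var ''s'' (IMod (ISub (var ''k'') (IMul (IConst 2) (var ''R''))) (var ''p''))"
  let ?post = "\<lambda>s'. frame X Y s s' \<and>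
    (\<forall>j<n. rcell s' ''B'' (int i) (int j) = shifted_row \<sigma> R k i j) \<and>
    (\<forall>k l. k \<noteq> int i \<longrightarrow> rcell s' ''B'' k l = rcell s ''B'' k l)"
  have "runs Shifted_row s (\<lambda>t s'. t \<le> 200 * (n + 1) + ((n + 1) * (50 + 100) + (20 + 100 * (n + 1))) \<and> ?post s')"
    unfolding Shifted_row_def
  proof (rule runs_Seq_le[OF runs_Orbit[OF prep i]], goal_cases)
    case (1 s1)
    then have f1': "frame {''c'', ''s'', ''cs''} {''w'', ''ws''} s s1"
      and o1: "orbit_at \<sigma> i (2 * n + 1) s1" by blast+
    have f1: "frame X Y s s1" by (rule frame_mono[OF f1']) (auto simp: X_def Y_def)
    have search: "runs (Search ''p'' (var ''n'') Test_cycle) s1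
      (\<lambda>t s'. t \<le> (n + 1) * (50 + 100) \<and> frame ?X1 {} s1 s' \<and> icell s' ''p'' 0 0 = int ?l)"
      unfolding cycle_length_def
    proof (rule runs_Search[where P = "\<lambda>l. (\<sigma> ^^ (n + l)) i = (\<sigma> ^^ n) i" and p = ?l])
      fix s' e
      assume e: "e \<le> n" "icell s' ''e'' 0 0 = int e" and f: "frame ?X1 {} s1 s'"
      have n': "icell s' ''n'' 0 0 = int n"
        using frame_icell[OF f, of "''n''"] frame_icell[OF f1', of "''n''"] n by simp
      have o': "orbit_at \<sigma> i (2 * n + 1) s'" by (rule orbit_at_frame[OF o1 f]) auto
      have "icell s' ''cs'' (int (n + e)) 0 = int ((\<sigma> ^^ (n + e)) i)"
        "icell s' ''cs'' (int n) 0 = int ((\<sigma> ^^ n) i)"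
        using o'[unfolded orbit_at_def, rule_format, of "n + e"] o'[unfolded orbit_at_def, rule_format, of n] e(1)
        by simp_all
      then show "runs Test_cycle s' (\<lambda>t s''. t \<le> 50 \<and> frame (?X1 - {''p'', ''q'', ''e''}) {} s' s'' \<and>
        (icell s'' ''ok'' 0 0 = (if (\<sigma> ^^ (n + e)) i = (\<sigma> ^^ n) i then 1 else 0)))"
        using n' e by (auto simp: Test_cycle_def frame_refl)
    next
      fix s' assume f: "frame ?X1 {} s1 s'"
      then show "ival (var ''n'') s' = int n"
        using frame_icell[OF f, of "''n''"] frame_icell[OF f1', of "''n''"] n by simp
    qed (use l in auto)
    show ?case
    proof (rule runs_Seq_le[OF search], goal_cases)
      case (1 s2)
      then have f2': "frame ?X1 {} s1 s2" and p2: "icell s2 ''p'' 0 0 = int ?l" by blast+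
      have f2: "frame X Y s s2" by (rule frame_step[OF f1 f2']) (auto simp: X_def)
      have cells2: "icell s2 ''k'' 0 0 = int k" "icell s2 ''R'' 0 0 = int R" "icell s2 ''n'' 0 0 = int n"
        "icell s2 ''i'' 0 0 = int i"
        using frame_icell[OF f2, of "''k''"] frame_icell[OF f2, of "''R''"] frame_icell[OF f2, of "''n''"]
          frame_icell[OF f2, of "''i''"] k R n i by (auto simp: X_def)
      let ?s = "set_var ''s'' (int ?t) s2"
      have fs: "frame X Y s ?s" using f2 by (simp add: X_def)
      have o2: "orbit_at \<sigma> i (2 * n + 1) ?s"
        using orbit_at_frame[OF o1 f2'] by (simp add: orbit_at_def)
      have Ps: "stores ?s ''P'' (mpow R)" by (rule stores_frame[OF P fs]) (simp add: Y_def)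
      have B2: "rcell s2 ''B'' = rcell s ''B''"
        using frame_rcell[OF f1', of "''B''"] frame_rcell[OF f2', of "''B''"] by simp
      have "runs (Fill_row ?e) ?s (\<lambda>t s'. t \<le> 100 * (n + 1) \<and> frame {''j''} {''B''} ?s s' \<and>
        (\<forall>j<n. rcell s' ''B'' (int i) (int j) = shifted_row \<sigma> R k i j) \<and>
        (\<forall>k l. k \<noteq> int i \<longrightarrow> rcell s' ''B'' k l = rcell ?s ''B'' k l))"
      proof (rule runs_Fill_row)
        fix s' j
        assume j: "j < n" "icell s' ''j'' 0 0 = int j" and f: "frame {''j''} {''B''} ?s s'"
        have o': "orbit_at \<sigma> i (2 * n + 1) s'" by (rule orbit_at_frame[OF o2 f]) auto
        have P': "stores s' ''P'' (mpow R)" by (rule stores_frame[OF Ps f]) simp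
        have s': "icell s' ''s'' 0 0 = int ?t" using frame_icell[OF f, of "''s''"] by simp
        have "?t < 2 * n + 1" using t l by linarith
        then have "icell s' ''cs'' (int ?t) 0 = int ((\<sigma> ^^ ?t) i)" "rcell s' ''ws'' (int ?t) 0 = succ_weight \<sigma> i ?t"
          using o' unfolding orbit_at_def by auto
        moreover have "(\<sigma> ^^ ?t) i < n" using crit_orbit[OF \<sigma> i(1)] crit_less by blast
        ultimately show "rval ?e s' = shifted_row \<sigma> R k i j"
          using P' s' j i by (simp add: shifted_row_def stores_def)
      qed (use cells2 in auto)
      then have "runs (Fill_row ?e) ?s (\<lambda>t s'. 20 + t \<le> 20 + 100 * (n + 1) \<and> ?post s')"
      proof (rule runs_mono)
        fix t s'
        assume *: "t \<le> 100 * (n + 1) \<and> frame {''j''} {''B''} ?s s' \<and>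
          (\<forall>j<n. rcell s' ''B'' (int i) (int j) = shifted_row \<sigma> R k i j) \<and>
          (\<forall>k l. k \<noteq> int i \<longrightarrow> rcell s' ''B'' k l = rcell ?s ''B'' k l)"
        then have f: "frame {''j''} {''B''} ?s s'" by blast
        have "frame X Y s s'" by (rule frame_step[OF fs f]) (auto simp: X_def Y_def)
        with * B2 show "20 + t \<le> 20 + 100 * (n + 1) \<and> ?post s'" by simp
      qed
      then show ?case
        unfolding runs_Seq runs_IAssign using cells2 p2 t(1) by (auto elim!: runs_mono)
    qed
  qed
  then show ?thesis by (rule runs_le) auto
qed

text \<open>The program knows neither \<gamma> nor a transient. Its one output is therefore shown
  correct for every period \<open>g\<close>, threshold \<open>T\<close> and exponent
  \<open>r\<close> that fit.\<close>

lemma runs_Periodic_power: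
  assumes n: "icell s ''n'' 0 0 = int n" and A: "stores s ''A'' a" and M: "n * n \<le> 2 ^ M"
    and k: "icell s ''k'' 0 0 = int k"
  shows "runs Periodic_power s (\<lambda>t s'. t \<le> 2800 * ((n + 1) ^ 3 * (M + 1)) \<and>
    (\<forall>g T r. 1 \<le> g \<and> (\<forall>r\<ge>T. \<forall>i<n. \<forall>j<n. mpow (r + g) i j = mpow r i j) \<and> T \<le> r \<and> [r = k] (mod g) \<longrightarrow>
      stores s' ''out'' (mpow r)))"
proof -
  let ?X = "{''c'', ''s'', ''cs'', ''p'', ''q'', ''e'', ''ok'', ''j''}" and ?Y = "{''w'', ''ws'', ''B''}"
  let ?post = "\<lambda>s'. \<forall>g T r. 1 \<le> g \<and> (\<forall>r\<ge>T. \<forall>i<n. \<forall>j<n. mpow (r + g) i j = mpow r i j) \<and> T \<le> r \<and> [r = k] (mod g) \<longrightarrow>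
      stores s' ''out'' (mpow r)"
  let ?body = "If (ILess (IConst (-1)) (ICell ''sg'' (var ''i'') (IConst 0))) Shifted_row (Fill_row (RConst 0))"
  have "runs Periodic_power s (\<lambda>t s'. t \<le> 1600 * ((n + 1) ^ 3 * (M + 1)) +
      ((n + 1) * (20 + 600 * (n + 1) + 40) + 300 * (n + 1) ^ 3) \<and> ?post s')"
    unfolding Periodic_power_def
  proof (rule runs_Seq_le[OF runs_prepare[OF n A M]], goal_cases)
    case (1 s1)
    then obtain \<sigma> R where f1: "frame {''i'', ''j'', ''h'', ''R'', ''sg''} {''P'', ''Q'', ''S'', ''U''} s s1"
      and prep1: "prepared \<sigma> R s1" by blast
    then have \<sigma>: "crit_succ \<sigma>" and R: "n * n \<le> R" by (auto simp: prepared_def)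
    have k1: "icell s1 ''k'' 0 0 = int k" using frame_icell[OF f1, of "''k''"] k by simp
    let ?I = "\<lambda>i s'. (prepared \<sigma> R s' \<and> icell s' ''k'' 0 0 = int k) \<and>
      (\<forall>c<i. \<forall>j<n. rcell s' ''B'' (int c) (int j) = shifted_row \<sigma> R k c j)"
    have I_set_i: "?I i (set_var ''i'' v s') \<longleftrightarrow> ?I i s'" for i v s'
      by (simp add: prepared_def stores_def succ_at_def)
    have "runs (For ''i'' (var ''n'') ?body) s1 (\<lambda>t s'. t \<le> (n + 1) * (20 + 600 * (n + 1) + 40) \<and>
      ?I n s' \<and> icell s' ''i'' 0 0 = int n)"
    proof (rule runs_For[where I = ?I])
      show "?I 0 (set_var ''i'' 0 s1)" unfolding I_set_i using prep1 k1 by simp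
    next
      fix i s2 assume "?I i s2"
      then show "ival (var ''n'') s2 = int n" by (simp add: prepared_def)
    next
      fix i s2
      assume i: "i < n" and I: "?I i s2" and icell: "icell s2 ''i'' 0 0 = int i"
      then have prep2: "prepared \<sigma> R s2" and k2: "icell s2 ''k'' 0 0 = int k"
        and B2: "\<And>c j. c < i \<Longrightarrow> j < n \<Longrightarrow> rcell s2 ''B'' (int c) (int j) = shifted_row \<sigma> R k c j" by blast+
      have n2: "icell s2 ''n'' 0 0 = int n" using prep2 by (simp add: prepared_def)
      have sg: "icell s2 ''sg'' (int i) 0 = (if crit i then int (\<sigma> i) else -1)"
        using prep2 i by (simp add: prepared_def succ_at_def)
      have row: "t \<le> 600 * (n + 1) \<longrightarrow> 9 + t \<le> 20 + 600 * (n + 1) \<and> icell s' ''i'' 0 0 = int i \<and> ?I (Suc i) s'"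
        if f: "frame ?X ?Y s2 s'"
          and B: "\<forall>j<n. rcell s' ''B'' (int i) (int j) = shifted_row \<sigma> R k i j"
            "\<forall>k l. k \<noteq> int i \<longrightarrow> rcell s' ''B'' k l = rcell s2 ''B'' k l" for t s'
      proof -
        have "prepared \<sigma> R s'" by (rule prepared_frame[OF prep2 f]) auto
        moreover have "icell s' ''k'' 0 0 = int k" "icell s' ''i'' 0 0 = int i"
          using frame_icell[OF f, of "''k''"] frame_icell[OF f, of "''i''"] k2 icell by auto
        moreover have "\<forall>c<Suc i. \<forall>j<n. rcell s' ''B'' (int c) (int j) = shifted_row \<sigma> R k c j"
          using B B2 by (auto simp: less_Suc_eq)
        ultimately show ?thesis by auto
      qed
      show "runs ?body s2 (\<lambda>t s'. t \<le> 20 + 600 * (n + 1) \<and> icell s' ''i'' 0 0 = int i \<and>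
        ?I (Suc i) (set_var ''i'' (int (Suc i)) s'))"
        unfolding I_set_i
      proof (cases "crit i")
        case True
        have "runs Shifted_row s2 (\<lambda>t s'. 9 + t \<le> 20 + 600 * (n + 1) \<and> icell s' ''i'' 0 0 = int i \<and> ?I (Suc i) s')"
          by (rule runs_mono[OF runs_Shifted_row[OF prep2 True icell k2]]) (use row in blast)
        then show "runs ?body s2 (\<lambda>t s'. t \<le> 20 + 600 * (n + 1) \<and> icell s' ''i'' 0 0 = int i \<and> ?I (Suc i) s')"
          using sg True icell by (auto elim!: runs_mono)
      next
        case False
        have "runs (Fill_row (RConst 0)) s2 (\<lambda>t s'. 9 + t \<le> 20 + 600 * (n + 1) \<and> icell s' ''i'' 0 0 = int i \<and> ?I (Suc i) s')"
        proof (rule runs_mono[OF runs_Fill_row[OF n2 icell, where g = "\<lambda>_. 0"]], goal_cases)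
          case (3 t s')
          then have f: "frame ?X ?Y s2 s'" by (auto elim: frame_mono)
          show ?case using row[OF f, of t] 3 False by (simp add: shifted_row_def)
        qed auto
        then show "runs ?body s2 (\<lambda>t s'. t \<le> 20 + 600 * (n + 1) \<and> icell s' ''i'' 0 0 = int i \<and> ?I (Suc i) s')"
          using sg False icell by (auto elim!: runs_mono)
      qed
    qed simp
    then show ?case
    proof (rule runs_Seq_le, goal_cases)
      case (1 s3)
      then have prep3: "prepared \<sigma> R s3"
        and B3: "stores s3 ''B'' (shifted_row \<sigma> R k)" by (auto simp: stores_def)
      then have n3: "icell s3 ''n'' 0 0 = int n" and P3: "stores s3 ''P'' (mpow R)"
        by (auto simp: prepared_def)
      show ?case
      proof (rule runs_le[OF stores_Mult[OF n3 _ _ P3 B3]], goal_cases)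
        case (4 s4)
        show ?case
        proof (intro allI impI, elim conjE)
          fix g T r
          assume g: "1 \<le> g" and T: "\<forall>r\<ge>T. \<forall>i<n. \<forall>j<n. mpow (r + g) i j = mpow r i j"
            and r: "T \<le> r" "[r = k] (mod g)"
          have "mpow r i j = osum (\<lambda>c. mpow R i c * shifted_row \<sigma> R k c j) {..<n}" if "i < n" "j < n" for i j
            unfolding shifted_row_def
            by (rule periodic_power_eq[OF \<sigma> R g _ r]) (use T that cycle_length[OF \<sigma>] in \<open>auto simp: shift_def\<close>)
          then show "stores s4 ''out'' (mpow r)" using 4 by (simp add: stores_def)
        qed
      qed auto
    qed
  qed
  then show ?thesis
  proof (rule runs_le)
    let ?m = "(n + 1) ^ 3"
    have "20 + 600 * (n + 1) \<le> 620 * (n + 1) ^ 1" by simp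
    then have "(n + 1) * (20 + 600 * (n + 1) + 40) \<le> 700 * (n + 1) ^ 2" by (rule loop_bound) auto
    moreover have "(n + 1) ^ 2 \<le> ?m" by (rule power_increasing) auto
    moreover have "?m \<le> ?m * (M + 1)" by simp
    ultimately show "1600 * (?m * (M + 1)) + ((n + 1) * (20 + 600 * (n + 1) + 40) + 300 * ?m) \<le> 2800 * (?m * (M + 1))"
      by linarith
  qed auto
qed

end

section \<open>The digraph of a matrix\<close>

lemma wf_mat_digraph: "wf_digraph (mat_digraph A)"
  by unfold_locales (auto simp: mat_digraph_def)

lemma wf_critical_graph: "wf_digraph (critical_graph A)"
  by unfold_locales (fastforce simp: critical_graph_def critical_nodes_def)+

lemma mat_digraph_simps [simp]:
  "tail (mat_digraph A) = fst" "head (mat_digraph A) = snd" "verts (mat_digraph A) = {..<dim_row A}"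
  by (simp_all add: mat_digraph_def)

lemma arcs_mat_digraph: "e \<in> arcs (mat_digraph A) \<longleftrightarrow> fst e < dim_row A \<and> snd e < dim_row A \<and> A $$ e \<noteq> 0"
  by (cases e) (auto simp: mat_digraph_def)

lemma finite_arcs_mat_digraph: "finite (arcs (mat_digraph A))"
  by (rule finite_subset[of _ "{..<dim_row A} \<times> {..<dim_row A}"]) (auto simp: mat_digraph_def)

text \<open>\<open>osum\<close> rests on \<open>Max\<close> and so needs finite sets. A cycle
  repeats no arc, which bounds its length.\<close>

lemma finite_cycles: "finite {p. pre_digraph.cycle (mat_digraph A) p}"
proof (rule finite_subset)
  interpret wf_digraph "mat_digraph A" by (rule wf_mat_digraph)
  let ?B = "{p. set p \<subseteq> arcs (mat_digraph A) \<and> length p \<le> card (arcs (mat_digraph A))}"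
  show "{p. cycle p} \<subseteq> ?B"
  proof
    fix p assume "p \<in> {p. cycle p}"
    then have "distinct p" "set p \<subseteq> arcs (mat_digraph A)"
      by (auto simp: cycle_conv awalk_def)
    then show "p \<in> ?B"
      by (auto simp: distinct_card[symmetric] intro: card_mono finite_arcs_mat_digraph)
  qed
  show "finite ?B" by (rule finite_lists_length_le) (rule finite_arcs_mat_digraph)
qed

context nonneg_matrix
begin

text \<open>The bridge from arc walks in the digraph to power entries. Positivity holds because arcs
  are nonzero entries of a nonnegative matrix.\<close>

lemma walk_weight_le_mpow:
  assumes "dim_row A = n" "\<And>i j. i < n \<Longrightarrow> j < n \<Longrightarrow> A $$ (i, j) = a i j"
  shows "pre_digraph.awalk (mat_digraph A) u p v \<Longrightarrow>
    0 < walk_weight A p \<and> walk_weight A p \<le> mpow (length p) u v"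
proof (induction p arbitrary: u)
  interpret wf_digraph "mat_digraph A" by (rule wf_mat_digraph)
  case Nil
  then show ?case by (simp add: awalk_Nil_iff walk_weight_def)
next
  interpret wf_digraph "mat_digraph A" by (rule wf_mat_digraph)
  case (Cons e p)
  obtain i j where e: "e = (i, j)" by (cases e)
  from Cons.prems e have *: "i < n" "j < n" "u = i" "awalk j p v" "A $$ (i, j) \<noteq> 0"
    using assms(1) by (auto simp: awalk_Cons_iff arcs_mat_digraph)
  have v: "v < n" using awalk_last_in_verts[OF *(4)] assms(1) by simp
  have pos: "0 < a i j" using * assms(2) nonneg[of i j] by fastforce
  note IH = Cons.IH[OF *(4)]
  have "a i j * walk_weight A p \<le> mpow 1 i j * mpow (length p) j v"
    using IH pos mpow_1[OF *(1,2)] by (intro mult_mono) auto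
  also have "\<dots> \<le> mpow (1 + length p) i v" using * v by (intro mpow_mult_le) auto
  finally show ?case
    using IH pos e * assms(2) by (simp add: walk_weight_def del: mpow.simps)
qed

end

text \<open>The maximum cycle mean controls only elementary cycles. Closed walks follow by strong
  induction on the length: a repeated node splits the walk into two shorter closed ones, and without
  a repetition it is a cycle of the digraph.\<close>

lemma irreducible_definite_matrixI:
  assumes "A \<in> irreducible_definite"
  shows "irreducible_definite_matrix (dim_row A) (\<lambda>i j. A $$ (i, j))"
proof -
  let ?n = "dim_row A" and ?a = "\<lambda>i j. A $$ (i, j)"
  interpret G: wf_digraph "mat_digraph A" by (rule wf_mat_digraph)
  from assms have nn: "A \<in> nonneg_mats ?n" and irr: "irreducible_mat A" and "definite_mat A"
    by (auto simp: irreducible_definite_def)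
  interpret nonneg_matrix ?n ?a
    by unfold_locales (use nn in \<open>auto simp: nonneg_mats_def\<close>)
  note weight = walk_weight_le_mpow[OF refl refl]
  have mean: "max_cycle_mean A = 1" using \<open>definite_mat A\<close> by (simp add: definite_mat_def)
  have cycle_le: "walk_weight A p \<le> 1" if "G.cycle p" for p
  proof -
    have "geometric_mean A p \<le> 1"
      using osum_ge[OF finite_cycles, of p A "geometric_mean A"] that mean by (simp add: max_cycle_mean_def)
    moreover have "p \<noteq> []" using that by (auto simp: G.cycle_def)
    ultimately show ?thesis by (simp add: geometric_mean_def)
  qed
  have closed: "mpow r i i \<le> 1" if "i < ?n" for r i
    using that
  proof (induction r arbitrary: i rule: less_induct)
    case (less r)
    show ?case
    proof (cases "0 < mpow r i i")
      case True
      obtain v where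
        v: "v 0 = i" "v r = i" "\<And>k. v k < ?n" "walk_prod v 0 r = mpow r i i"
        "\<And>p q. p \<le> q \<Longrightarrow> q \<le> r \<Longrightarrow>
          mpow r i i = mpow p i (v p) * mpow (q - p) (v p) (v q) * mpow (r - q) (v q) i"
        by (rule mpow_optimal_walk[OF True less.prems less.prems], rule that)
      show ?thesis
      proof (cases "inj_on v {..<r}")
        case False
        then have "\<exists>p q. p < q \<and> q < r \<and> v p = v q"
          unfolding inj_on_def by (metis lessThan_iff nat_neq_iff)
        then obtain p q where pq: "p < q" "q < r" "v p = v q" by blast
        have "mpow r i i = mpow p i (v p) * mpow (q - p) (v p) (v p) * mpow (r - q) (v p) i"
          using v(5)[of p q] pq by simp
        also have "\<dots> \<le> mpow p i (v p) * 1 * mpow (r - q) (v p) i"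
          using pq v(3) by (intro mult_right_mono mult_left_mono less.IH) auto
        also have "\<dots> \<le> mpow (p + (r - q)) i i"
          using v(3) less.prems by (simp add: mpow_mult_le)
        also have "\<dots> \<le> 1" using pq less.prems by (intro less.IH) auto
        finally show ?thesis .
      next
        case inj: True
        show ?thesis
        proof (cases "r = 0")
          case False
          let ?p = "\<lambda>k. map (\<lambda>k. (v k, v (Suc k))) [k..<r]"
          have nz: "A $$ (v k, v (Suc k)) \<noteq> 0" if "k < r" for k
          proof
            assume "A $$ (v k, v (Suc k)) = 0"
            then have "walk_prod v 0 r = 0" unfolding walk_prod_def using that by (intro prod_zero) auto
            with True v(4) show False by simp
          qed
          have walk: "G.awalk (v k) (?p k) i \<and> G.awalk_verts (v k) (?p k) = map v [k..<Suc r]" if "k \<le> r" for k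
            using that
          proof (induction k rule: inc_induct)
            case base
            then show ?case using v(2) less.prems by (simp add: G.awalk_Nil_iff)
          next
            case (step m)
            then have "?p m = (v m, v (Suc m)) # ?p (Suc m)" by (simp add: upt_rec)
            moreover have "[m..<Suc r] = m # [Suc m..<Suc r]" using step by (simp add: upt_rec)
            ultimately show ?case
              using step nz[of m] v(3) by (simp add: G.awalk_Cons_iff arcs_mat_digraph)
          qed
          have "distinct (map v [Suc 0..<Suc r])"
            unfolding distinct_map
          proof
            show "inj_on v (set [Suc 0..<Suc r])"
            proof (rule inj_onI)
              fix p q assume "p \<in> set [Suc 0..<Suc r]" "q \<in> set [Suc 0..<Suc r]" and eq: "v p = v q"
              then have pq: "0 < p" "p \<le> r" "0 < q" "q \<le> r" by auto
              \<comment> \<open>Injectivity is known for times below \<open>r\<close>, whereas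
                \<open>cycle\<close> asks for distinct nodes at times 1 to \<open>r\<close>;
                \<open>m\<close> sends time \<open>r\<close> to time 0, where the node is the
                same.\<close>
              define m where "m k = (if k = r then 0 else k)" for k
              have "v (m p) = v (m q)" using eq v(1,2) by (auto simp: m_def)
              with inj pq False have "m p = m q" by (auto simp: m_def inj_on_def)
              then show "p = q" using pq by (auto simp: m_def split: if_splits)
            qed
          qed simp
          moreover have "tl (map v [0..<Suc r]) = map v [Suc 0..<Suc r]"
            by (simp add: map_tl[symmetric] del: upt_Suc)
          ultimately have "G.cycle (?p 0)"
            using walk[of 0] False v(1) by (auto simp: G.cycle_def simp del: upt_Suc)
          moreover have "walk_weight A (?p 0) = walk_prod v 0 r"
            unfolding walk_weight_def walk_prod_def by (induction r) auto
          ultimately show ?thesis using cycle_le v(4) by metis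
        qed simp
      qed
    qed simp
  qed
  interpret definite_matrix ?n ?a by unfold_locales (rule closed)
  show ?thesis
  proof
    fix i j assume ij: "i < ?n" "j < ?n"
    with irr have "i \<rightarrow>\<^sup>*\<^bsub>mat_digraph A\<^esub> j" by (simp add: irreducible_mat_def strongly_connected_def)
    then obtain p where "G.awalk i p j" by (auto simp: G.reachable_awalk)
    from weight[OF this] show "\<exists>r. 0 < mpow r i j" by (intro exI[of _ "length p"]) linarith
  next
    \<comment> \<open>Being positive, the mean is attained by an actual cycle and is not the default
      0 of \<open>osum\<close>.\<close>
    have "0 < osum (geometric_mean A) {p. G.cycle p}"
      using mean by (simp add: max_cycle_mean_def)
    then obtain p where p: "G.cycle p" "geometric_mean A p = 1"
      using osum_attained[OF finite_cycles] mean unfolding max_cycle_mean_def by (metis mem_Collect_eq)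
    then obtain u where u: "G.awalk u p u" "p \<noteq> []" by (auto simp: G.cycle_def)
    have "walk_weight A p = 1" using p u by (simp add: geometric_mean_def)
    with weight[OF u(1)] have "1 \<le> mpow (length p) u u" by simp
    moreover have un: "u < ?n" using G.awalk_hd_in_verts[OF u(1)] by simp
    ultimately have "mpow (length p) u u = 1" using closed[of u "length p"] by simp
    moreover have "1 \<le> length p" using u(2) by (cases p) auto
    ultimately have "crit u" using un unfolding crit_def by blast
    then show "\<exists>i. crit i" ..
  qed
qed

text \<open>With cyclicity 0 the congruence and the periodicity would say nothing useful. On
  naturals the \<open>Lcm\<close> of an infinite set and the \<open>Gcd\<close> of the empty set are
  0; so the proof shows that there are finitely many components and that each contains a
  cycle.\<close>

lemma crit_cyclicity_pos: "0 < crit_cyclicity A"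
proof -
  let ?G = "critical_graph A"
  interpret D: wf_digraph "mat_digraph A" by (rule wf_mat_digraph)
  interpret G: wf_digraph ?G by (rule wf_critical_graph)
  have verts: "verts ?G \<subseteq> {..<dim_row A}"
    by (auto simp: critical_graph_def critical_nodes_def critical_cycle_def D.cycle_def D.awalk_def arcs_mat_digraph)
  have "finite G.sccs"
  proof (rule finite_imageD)
    have "verts ` G.sccs \<subseteq> Pow {..<dim_row A}"
      using verts by (auto simp: G.sccs_def induced_subgraph_def subgraph_def)
    then show "finite (verts ` G.sccs)" by (rule finite_subset) simp
  qed (rule G.inj_on_verts_sccs)
  moreover have "sc_cyclicity c \<noteq> 0" if c: "c \<in> G.sccs" for c
  proof -
    from c have ind: "induced_subgraph c ?G" and "strongly_connected c" by (auto simp: G.sccs_def)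
    then obtain v where v: "v \<in> verts c" by (auto simp: strongly_connected_def)
    from ind have "subgraph c ?G" by (simp add: induced_subgraph_def)
    then have compat: "compatible c ?G" and vc: "verts c \<subseteq> verts ?G"
      by (auto simp: subgraph_def compatible_def)
    have compat': "compatible (mat_digraph A) ?G" by (simp add: compatible_def critical_graph_def)
    from v vc obtain p e where p: "critical_cycle A p" "e \<in> set p" "v = fst e \<or> v = snd e"
      by (auto simp: critical_graph_def critical_nodes_def)
    then obtain u where u: "D.awalk u p u" "distinct (tl (D.awalk_verts u p))" "p \<noteq> []"
      by (auto simp: critical_cycle_def D.cycle_def)
    have arcs: "set p \<subseteq> arcs ?G" using p(1) by (auto simp: critical_graph_def)
    have "u = fst (hd p)" using u(1,3) by (cases p) (auto simp: D.awalk_Cons_iff)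
    then have "u \<in> critical_nodes A"
      unfolding critical_nodes_def using p(1) hd_in_set[OF u(3)] by blast
    then have "u \<in> verts ?G" by (simp add: critical_graph_def)
    then have wG: "G.awalk u p u"
      using u(1) arcs by (simp add: G.awalk_def D.awalk_def compatible_cas[OF compat'])
    have ends: "tail ?G = fst" "head ?G = snd" by (simp_all add: critical_graph_def)
    have on_p: "fst e \<in> set (G.awalk_verts u p)" "snd e \<in> set (G.awalk_verts u p)" if "e \<in> set p" for e
      using G.awalk_verts_arc1[OF that, of u] G.awalk_verts_arc2[OF wG that] by (simp_all add: ends)
    have vp: "v \<in> set (G.awalk_verts u p)" using on_p p by metis
    have "verts c \<in> G.sccs_verts" using c by (auto simp: G.sccs_verts_conv)
    \<comment> \<open>A critical cycle through \<open>v\<close> stays in the component of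
      \<open>v\<close>, since its nodes reach each other.\<close>
    have in_c: "w \<in> verts c" if "w \<in> set (G.awalk_verts u p)" for w
    proof (rule ccontr)
      assume "w \<notin> verts c"
      have "v \<rightarrow>\<^sup>*\<^bsub>?G\<^esub> w" "w \<rightarrow>\<^sup>*\<^bsub>?G\<^esub> v"
        using G.awalk_verts_reachable_from[OF wG] G.awalk_verts_reachable_to[OF wG] vp that
        by (blast intro: G.reachable_trans)+
      with \<open>w \<notin> verts c\<close> v \<open>verts c \<in> G.sccs_verts\<close> show False
        unfolding G.in_sccs_verts_conv_reachable by blast
    qed
    have "set p \<subseteq> arcs c"
    proof
      fix e assume e: "e \<in> set p"
      with arcs in_c on_p show "e \<in> arcs c" using ind by (auto simp: induced_subgraph_def ends)
    qed
    moreover have "u \<in> verts c"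
      using in_c on_p(1)[of "hd p"] u(3) \<open>u = fst (hd p)\<close> by auto
    ultimately have "pre_digraph.cycle c p"
      using wG u(2,3) unfolding pre_digraph.cycle_def pre_digraph.awalk_def
      by (auto simp: compatible_cas[OF compat] compatible_awalk_verts[OF compat] compatible_awalk_verts[OF compat'])
    then show ?thesis
      using u(3) unfolding sc_cyclicity_def Gcd_0_iff by auto
  qed
  then have "0 \<notin> sc_cyclicity ` G.sccs" by force
  ultimately have "crit_cyclicity A \<noteq> 0"
    unfolding crit_cyclicity_def by (simp add: Lcm_0_iff_nat del: image_iff)
  then show ?thesis by simp
qed

section \<open>Running times\<close>

lemma max_pow_carrier: "dim_col A = dim_row A \<Longrightarrow> dim_row (max_pow A r) = dim_row A \<and> dim_col (max_pow A r) = dim_row A"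
  by (induction r) (auto simp: max_mult_mat_def)

context nonneg_matrix
begin

lemma max_pow_eq_mpow:
  assumes "dim_row A = n" "dim_col A = n" "\<And>i j. i < n \<Longrightarrow> j < n \<Longrightarrow> A $$ (i, j) = a i j"
  shows "i < n \<Longrightarrow> j < n \<Longrightarrow> max_pow A r $$ (i, j) = mpow r i j"
proof (induction r arbitrary: j)
  case (Suc r)
  then show ?case
    using assms max_pow_carrier[of A r] by (auto simp: max_mult_mat_def intro!: osum_cong)
qed (use assms in auto)

lemma max_pow_vec_eq_iff:
  assumes "dim_row A = n" "dim_col A = n" "\<And>i j. i < n \<Longrightarrow> j < n \<Longrightarrow> A $$ (i, j) = a i j"
  shows "max_pow A r \<otimes>\<^sub>v x = max_pow A s \<otimes>\<^sub>v x \<longleftrightarrow> (\<forall>i<n. mvec r (\<lambda>k. x $ k) i = mvec s (\<lambda>k. x $ k) i)"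
proof -
  have "(max_pow A r \<otimes>\<^sub>v x) $ i = mvec r (\<lambda>k. x $ k) i" "dim_vec (max_pow A r \<otimes>\<^sub>v x) = n" if "i < n" for i r
    using that assms max_pow_carrier[of A r] max_pow_eq_mpow[OF assms, of i _ r]
    by (auto simp: max_mult_vec_def mvec_def intro!: osum_cong)
  moreover have "dim_vec (max_pow A r \<otimes>\<^sub>v x) = n" for r
    using assms max_pow_carrier[of A r] by (simp add: max_mult_vec_def)
  ultimately show ?thesis by (auto simp: vec_eq_iff)
qed

lemma mvec_eq_shift:
  assumes "\<And>k. k < n \<Longrightarrow> 0 \<le> x k" "\<forall>i<n. mvec r x i = mvec s x i" "i < n"
  shows "mvec (m + r) x i = mvec (m + s) x i"
  using assms by (simp add: mvec_add cong: osum_cong) (intro osum_cong; simp)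

end

context irreducible_definite_matrix
begin

text \<open>A single coincidence persists: applying further powers to both sides preserves
  it.\<close>

lemma ex_eq_iff_eventually:
  assumes "\<And>k. k < n \<Longrightarrow> 0 \<le> x k"
  shows "(\<exists>r. \<forall>i<n. mvec r x i = mvec (r + t) x i) \<longleftrightarrow>
    (\<forall>\<^sub>F r in sequentially. \<forall>i<n. mvec (r + t) x i = mvec r x i)"
proof
  assume "\<exists>r. \<forall>i<n. mvec r x i = mvec (r + t) x i"
  then obtain r where r: "\<forall>i<n. mvec r x i = mvec (r + t) x i" ..
  show "\<forall>\<^sub>F r in sequentially. \<forall>i<n. mvec (r + t) x i = mvec r x i"
    using eventually_ge_at_top[of r]
  proof eventually_elim
    case (elim s)
    show ?case
      using mvec_eq_shift[OF assms r, of _ "s - r"] elim by (simp add: add.assoc[symmetric])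
  qed
next
  assume "\<forall>\<^sub>F r in sequentially. \<forall>i<n. mvec (r + t) x i = mvec r x i"
  then obtain r where "\<forall>i<n. mvec (r + t) x i = mvec r x i"
    by (auto simp: eventually_sequentially)
  then show "\<exists>r. \<forall>i<n. mvec r x i = mvec (r + t) x i" by (intro exI[of _ r]) simp
qed

text \<open>The threshold hidden in "eventually" may lie far beyond \<open>T\<close>; a multiple of
  \<open>g\<close> carries every \<open>r \<ge> T\<close> past it without changing the
  vector.\<close>

lemma transient_period_iff:
  assumes g: "1 \<le> g" and T: "\<And>r i. T \<le> r \<Longrightarrow> i < n \<Longrightarrow> mvec (r + g) x i = mvec r x i"
  shows "(\<forall>r\<ge>T. \<forall>i<n. mvec (r + \<alpha>) x i = mvec r x i) \<longleftrightarrow>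
    (\<forall>\<^sub>F r in sequentially. \<forall>i<n. mvec (r + \<alpha>) x i = mvec r x i)"
proof
  assume "\<forall>\<^sub>F r in sequentially. \<forall>i<n. mvec (r + \<alpha>) x i = mvec r x i"
  then obtain r0 where r0: "\<And>r i. r0 \<le> r \<Longrightarrow> i < n \<Longrightarrow> mvec (r + \<alpha>) x i = mvec r x i"
    by (auto simp: eventually_sequentially)
  have shift: "mvec (r + g * m) x i = mvec r x i" if "T \<le> r" "i < n" for r m i
  proof (induction m)
    case (Suc m)
    have "mvec (r + g * Suc m) x i = mvec (r + g * m + g) x i" by (simp add: algebra_simps)
    then show ?case using T[of "r + g * m" i] that Suc by simp
  qed simp
  show "\<forall>r\<ge>T. \<forall>i<n. mvec (r + \<alpha>) x i = mvec r x i"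
  proof (intro allI impI)
    fix r i assume ri: "T \<le> r" "i < n"
    have "r0 \<le> g * r0" using g by (cases g) auto
    have "mvec (r + \<alpha>) x i = mvec (r + g * r0 + \<alpha>) x i"
      using shift[of "r + \<alpha>" i r0] ri by (simp add: algebra_simps)
    also have "\<dots> = mvec (r + g * r0) x i" using \<open>r0 \<le> g * r0\<close> ri by (intro r0) linarith+
    also have "\<dots> = mvec r x i" using shift ri by simp
    finally show "mvec (r + \<alpha>) x i = mvec r x i" .
  qed
qed (auto simp: eventually_sequentially)

end

text \<open>The base-2 logarithm of \<open>n * n\<close>, rounded up.\<close>

definition squarings :: "nat \<Rightarrow> nat" where
  "squarings n = nat \<lceil>2 * log 2 (real n)\<rceil>"

lemma squarings: "0 < n \<Longrightarrow> n * n \<le> 2 ^ squarings n"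
proof -
  assume n: "0 < n"
  have "real (n * n) = 2 powr (log 2 (real n) + log 2 (real n))"
    using n unfolding powr_add by simp
  also have "log 2 (real n) + log 2 (real n) = 2 * log 2 (real n)" by simp
  also have "2 powr (2 * log 2 (real n)) \<le> 2 powr real (squarings n)"
    unfolding squarings_def by (intro powr_mono) linarith+
  also have "\<dots> = real (2 ^ squarings n)" by (simp add: powr_realpow)
  finally show "n * n \<le> 2 ^ squarings n" by (simp only: of_nat_le_iff)
qed

text \<open>2900 leaves room for the last test of \<open>Attraction\<close> on top of 2800. The
  summand 2 covers the rounding in \<open>squarings\<close> and one further round; it also keeps the
  bound positive at \<open>n = 1\<close>, where the logarithm vanishes.\<close>

definition time_bound :: "nat \<Rightarrow> real" where
  "time_bound n = 2900 * ((real n + 1) ^ 3 * (2 * log 2 (real n) + 2))"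

lemma time_bound_bigo: "time_bound \<in> O(\<lambda>n. real n ^ 3 * ln (real n))"
  unfolding time_bound_def log_def by real_asymp

lemma time_bound:
  assumes "0 < n" "t \<le> 2900 * ((n + 1) ^ 3 * (squarings n + 1))"
  shows "real t \<le> time_bound n"
proof -
  have "0 \<le> log 2 (real n)" using assms by simp
  then have sq: "real (squarings n) \<le> 2 * log 2 (real n) + 1" unfolding squarings_def by linarith
  have "real t \<le> real (2900 * ((n + 1) ^ 3 * (squarings n + 1)))" using assms(2) by (simp only: of_nat_le_iff)
  also have "\<dots> = 2900 * ((real n + 1) ^ 3 * (real (squarings n) + 1))"
    by (simp add: algebra_simps)
  also have "\<dots> \<le> time_bound n"
    unfolding time_bound_def using sq by (intro mult_left_mono) auto
  finally show ?thesis .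
qed

lemma solvable_in_timeI:
  assumes "\<And>p s. p \<in> insts \<Longrightarrow> input p s \<Longrightarrow> 0 < sz p \<and>
      runs c s (\<lambda>t s'. t \<le> 2900 * ((sz p + 1) ^ 3 * (squarings (sz p) + 1)) \<and> output p s')"
  shows "solvable_in_time insts sz input output O(\<lambda>n. real n ^ 3 * ln (real n))"
  unfolding solvable_in_time_def
proof (intro exI[of _ c] bexI[of _ time_bound] ballI allI impI time_bound_bigo)
  fix p s assume "p \<in> insts" "input p s"
  from assms[OF this] show "\<exists>t s'. exec c s t s' \<and> real t \<le> time_bound (sz p) \<and> output p s'"
    unfolding runs_def using time_bound by blast
qed

theorem theorem4p11:
  shows
    "(solvable_in_time
       {(A, x, t). A \<in> irreducible_definite \<and> x \<in> nonneg_vecs (dim_row A) \<and> 1 \<le> t}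
       (\<lambda>(A, x, t). dim_row A)
       (\<lambda>(A, x, t) s. holds_int s ''n'' (int (dim_row A)) \<and> holds_mat s ''A'' A \<and>
          holds_vec s ''x'' x \<and> holds_int s ''t'' (int t))
       (\<lambda>(A, x, t) s. holds_int s ''out'' (if x \<in> attraction_cone A t then 1 else 0))
       (O(\<lambda>n. real n ^ 3 * ln (real n))))
     \<and>
     (solvable_in_time
       {(A, k). A \<in> irreducible_definite \<and> k < crit_cyclicity A}
       (\<lambda>(A, k). dim_row A)
       (\<lambda>(A, k) s. holds_int s ''n'' (int (dim_row A)) \<and> holds_mat s ''A'' A \<and>
          holds_int s ''k'' (int k))
       (\<lambda>(A, k) s. \<forall>T r. is_transient A T \<and> T \<le> r \<and> [r = k] (mod crit_cyclicity A)
          \<longrightarrow> holds_mat s ''out'' (max_pow A r))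
       (O(\<lambda>n. real n ^ 3 * ln (real n))))
     \<and>
     (solvable_in_time
       {(A, x). A \<in> irreducible_definite \<and> x \<in> nonneg_vecs (dim_row A)}
       (\<lambda>(A, x). dim_row A)
       (\<lambda>(A, x) s. holds_int s ''n'' (int (dim_row A)) \<and> holds_mat s ''A'' A \<and>
          holds_vec s ''x'' x)
       (\<lambda>(A, x) s. \<forall>T. is_transient A T
          \<longrightarrow> holds_int s ''out'' (int (ultimate_period A x T)))
       (O(\<lambda>n. real n ^ 3 * ln (real n))))"
proof (intro conjI, goal_cases)
  case 1
  show ?case
  proof (rule solvable_in_timeI[where c = Attraction], goal_cases)
    case (1 p s)
    obtain A x t where p: "p = (A, x, t)" by (cases p) auto
    with 1 have A: "A \<in> irreducible_definite" and x: "x \<in> nonneg_vecs (dim_row A)"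
      and s: "holds_int s ''n'' (int (dim_row A))" "holds_mat s ''A'' A" "holds_vec s ''x'' x" "holds_int s ''t'' (int t)"
      by auto
    interpret irreducible_definite_matrix "dim_row A" "\<lambda>i j. A $$ (i, j)"
      by (rule irreducible_definite_matrixI[OF A])
    from A have col: "dim_col A = dim_row A" by (auto simp: irreducible_definite_def nonneg_mats_def)
    let ?x = "\<lambda>k. x $ k"
    have x0: "\<And>k. k < dim_row A \<Longrightarrow> 0 \<le> ?x k" using x by (auto simp: nonneg_vecs_def)
    have n: "icell s ''n'' 0 0 = int (dim_row A)" using s by (simp add: holds_int_def)
    have stA: "stores s ''A'' (\<lambda>i j. A $$ (i, j))" using s col by (simp add: holds_mat_def stores_def)
    have stx: "column_at ''x'' ?x s" using s x by (auto simp: holds_vec_def column_at_def nonneg_vecs_def)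
    \<comment> \<open>Membership asks for one coincidence; its eventual form is what divisibility by
      \<open>D\<close> decides.\<close>
    have cone: "x \<in> attraction_cone A t \<longleftrightarrow>
        (\<forall>\<^sub>F r in sequentially. \<forall>i<dim_row A. mvec (r + t) ?x i = mvec r ?x i)"
      using x ex_eq_iff_eventually[OF x0] max_pow_vec_eq_iff[OF refl col refl]
      by (simp add: attraction_cone_def)
    have t: "icell s ''t'' 0 0 = int t" using s by (simp add: holds_int_def)
    have "runs Attraction s (\<lambda>t' s'. t' \<le> 2800 * ((dim_row A + 1) ^ 3 * (squarings (dim_row A) + 1)) + 20 \<and>
        holds_int s' ''out'' (if x \<in> attraction_cone A t then 1 else 0))"
      unfolding Attraction_def
    proof (rule runs_Seq_le[OF runs_Period[OF n stA squarings[OF n_pos] stx x0]], assumption)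
      fix s1 :: state
      assume "icell s1 ''t'' = icell s ''t'' \<and>
        (\<exists>D. icell s1 ''out'' 0 0 = int D \<and> 1 \<le> D \<and>
          (\<forall>\<alpha>. D dvd \<alpha> \<longleftrightarrow> (\<forall>\<^sub>F r in sequentially. \<forall>i<dim_row A. mvec (r + \<alpha>) ?x i = mvec r ?x i)))"
      then obtain D where D: "icell s1 ''t'' 0 0 = int t" "icell s1 ''out'' 0 0 = int D"
        "D dvd t \<longleftrightarrow> x \<in> attraction_cone A t" using t cone by auto
      have "int t mod int D = 0 \<longleftrightarrow> D dvd t" by (metis mod_0_imp_dvd dvd_imp_mod_0 of_nat_dvd_iff)
      then show "runs (If (IEq (IMod (var ''t'') (var ''out'')) (IConst 0))
         (Let_var ''out'' (IConst 1)) (Let_var ''out'' (IConst 0))) s1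
        (\<lambda>t' s'. t' \<le> 20 \<and> holds_int s' ''out'' (if x \<in> attraction_cone A t then 1 else 0))"
        using D by (auto simp: holds_int_def)
    qed
    then have "runs Attraction s (\<lambda>t' s'. t' \<le> 2900 * ((dim_row A + 1) ^ 3 * (squarings (dim_row A) + 1)) \<and>
        holds_int s' ''out'' (if x \<in> attraction_cone A t then 1 else 0))"
    proof (rule runs_le)
      have "1 \<le> (dim_row A + 1) ^ 3 * (squarings (dim_row A) + 1)" by (simp add: Suc_le_eq)
      then show "2800 * ((dim_row A + 1) ^ 3 * (squarings (dim_row A) + 1)) + 20
          \<le> 2900 * ((dim_row A + 1) ^ 3 * (squarings (dim_row A) + 1))"
        by linarith
    qed
    then show ?case unfolding p prod.case by (intro conjI n_pos)
  qed
next
  case 2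
  show ?case
  proof (rule solvable_in_timeI[where c = Periodic_power], goal_cases)
    case (1 p s)
    obtain A k where p: "p = (A, k)" by (cases p) auto
    with 1 have A: "A \<in> irreducible_definite"
      and s: "holds_int s ''n'' (int (dim_row A))" "holds_mat s ''A'' A" "holds_int s ''k'' (int k)"
      by auto
    interpret irreducible_definite_matrix "dim_row A" "\<lambda>i j. A $$ (i, j)"
      by (rule irreducible_definite_matrixI[OF A])
    from A have col: "dim_col A = dim_row A" by (auto simp: irreducible_definite_def nonneg_mats_def)
    have n: "icell s ''n'' 0 0 = int (dim_row A)" using s by (simp add: holds_int_def)
    have stA: "stores s ''A'' (\<lambda>i j. A $$ (i, j))" using s col by (simp add: holds_mat_def stores_def)
    have k: "icell s ''k'' 0 0 = int k" using s by (simp add: holds_int_def)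
    note pow = max_pow_eq_mpow[OF refl col refl]
    have "runs Periodic_power s (\<lambda>t s'. t \<le> 2900 * ((dim_row A + 1) ^ 3 * (squarings (dim_row A) + 1)) \<and>
        (\<forall>T r. is_transient A T \<and> T \<le> r \<and> [r = k] (mod crit_cyclicity A)
            \<longrightarrow> holds_mat s' ''out'' (max_pow A r)))"
    proof (rule runs_le[OF runs_Periodic_power[OF n stA squarings[OF n_pos] k]])
      fix s' :: state
      assume *: "\<forall>g T r. 1 \<le> g \<and> (\<forall>r\<ge>T. \<forall>i<dim_row A. \<forall>j<dim_row A. mpow (r + g) i j = mpow r i j) \<and> T \<le> r \<and>
        [r = k] (mod g) \<longrightarrow> stores s' ''out'' (mpow r)"
      show "\<forall>T r. is_transient A T \<and> T \<le> r \<and> [r = k] (mod crit_cyclicity A) \<longrightarrow> holds_mat s' ''out'' (max_pow A r)"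
      proof (intro allI impI, elim conjE)
        fix T r assume T: "is_transient A T" and r: "T \<le> r" "[r = k] (mod crit_cyclicity A)"
        have "\<forall>r\<ge>T. \<forall>i<dim_row A. \<forall>j<dim_row A. mpow (r + crit_cyclicity A) i j = mpow r i j"
          using T pow unfolding is_transient_def by metis
        moreover have "1 \<le> crit_cyclicity A" using crit_cyclicity_pos[of A] by simp
        \<comment> \<open>Here \<open>g\<close> is \<gamma>; positivity together with periodicity
          from \<open>T\<close> on is all that the program's specification asks of it.\<close>
        ultimately have "stores s' ''out'' (mpow r)" using * r by blast
        then show "holds_mat s' ''out'' (max_pow A r)"
          using max_pow_carrier[OF col, of r] pow by (simp add: holds_mat_def stores_def)
      qed
    qed simp
    then show ?case unfolding p prod.case by (intro conjI n_pos)
  qed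
next
  case 3
  show ?case
  proof (rule solvable_in_timeI[where c = Period], goal_cases)
    case (1 p s)
    obtain A x where p: "p = (A, x)" by (cases p) auto
    with 1 have A: "A \<in> irreducible_definite" and x: "x \<in> nonneg_vecs (dim_row A)"
      and s: "holds_int s ''n'' (int (dim_row A))" "holds_mat s ''A'' A" "holds_vec s ''x'' x"
      by auto
    interpret irreducible_definite_matrix "dim_row A" "\<lambda>i j. A $$ (i, j)"
      by (rule irreducible_definite_matrixI[OF A])
    from A have col: "dim_col A = dim_row A" by (auto simp: irreducible_definite_def nonneg_mats_def)
    let ?x = "\<lambda>k. x $ k"
    have x0: "\<And>k. k < dim_row A \<Longrightarrow> 0 \<le> ?x k" using x by (auto simp: nonneg_vecs_def)
    have n: "icell s ''n'' 0 0 = int (dim_row A)" using s by (simp add: holds_int_def)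
    have stA: "stores s ''A'' (\<lambda>i j. A $$ (i, j))" using s col by (simp add: holds_mat_def stores_def)
    have stx: "column_at ''x'' ?x s" using s x by (auto simp: holds_vec_def column_at_def nonneg_vecs_def)
    note vec_eq = max_pow_vec_eq_iff[OF refl col refl]
    have "runs Period s (\<lambda>t s'. t \<le> 2900 * ((dim_row A + 1) ^ 3 * (squarings (dim_row A) + 1)) \<and>
        (\<forall>T. is_transient A T \<longrightarrow> holds_int s' ''out'' (int (ultimate_period A x T))))"
    proof (rule runs_le[OF runs_Period[OF n stA squarings[OF n_pos] stx x0]], assumption)
      fix s' :: state
      assume "icell s' ''t'' = icell s ''t'' \<and>
        (\<exists>D. icell s' ''out'' 0 0 = int D \<and> 1 \<le> D \<and>
          (\<forall>\<alpha>. D dvd \<alpha> \<longleftrightarrow> (\<forall>\<^sub>F r in sequentially. \<forall>i<dim_row A. mvec (r + \<alpha>) ?x i = mvec r ?x i)))"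
      then obtain D where D: "icell s' ''out'' 0 0 = int D" "1 \<le> D"
        "\<And>\<alpha>. D dvd \<alpha> \<longleftrightarrow> (\<forall>\<^sub>F r in sequentially. \<forall>i<dim_row A. mvec (r + \<alpha>) ?x i = mvec r ?x i)"
        by blast
      show "\<forall>T. is_transient A T \<longrightarrow> holds_int s' ''out'' (int (ultimate_period A x T))"
      proof (intro allI impI)
        fix T assume T: "is_transient A T"
        have g: "1 \<le> crit_cyclicity A" using crit_cyclicity_pos[of A] by simp
        have "mvec (r + crit_cyclicity A) ?x i = mvec r ?x i" if "T \<le> r" "i < dim_row A" for r i
        proof -
          have "max_pow A (r + crit_cyclicity A) \<otimes>\<^sub>v x = max_pow A r \<otimes>\<^sub>v x"
            using T that by (simp add: is_transient_def)
          then show ?thesis using vec_eq that by simp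
        qed
        \<comment> \<open>For each transient \<open>T\<close> the periods valid from
          \<open>T\<close> on are exactly the multiples of \<open>D\<close>, so the least positive
          one is \<open>D\<close> itself.\<close>
        from transient_period_iff[OF g this]
        have "(\<forall>r\<ge>T. max_pow A (r + \<alpha>) \<otimes>\<^sub>v x = max_pow A r \<otimes>\<^sub>v x) \<longleftrightarrow> D dvd \<alpha>" for \<alpha>
          unfolding vec_eq D(3) by blast
        then have "ultimate_period A x T = (LEAST \<alpha>. 1 \<le> \<alpha> \<and> D dvd \<alpha>)"
          by (simp add: ultimate_period_def)
        also have "\<dots> = D"
          by (rule Least_equality) (use D(2) in \<open>auto dest: dvd_imp_le\<close>)
        finally show "holds_int s' ''out'' (int (ultimate_period A x T))"
          using D(1) by (simp add: holds_int_def)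
      qed
    qed simp
    then show ?case unfolding p prod.case by (intro conjI n_pos)
  qed
qed

end
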